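(* Assume that the kernel $\mathcal K$, the map $M$ and the coefficients $A,B,C,\Sigma,Q,\bar Q,S,Q_t,\bar Q_t,S_t,R_t$ satisfy the assumptions listed in the context, and assume that (for every $m\in C([0,T];\mathbb{R}^d)$ and $\xi\in\mathbb{L}^2(\mathcal F_0;\mathbb{R}^d)$) the coupled forward-backward stochastic Volterra system $$ \begin{aligned} X^{m,\xi}_t &= \mathcal{K}(t,0)\xi+M(m)_t + \int_0^t \mathcal{K}(t,s)\big(A_s X^{m,\xi}_s - B_s R_s^{-1} B_s^\top Y^{m,\xi}_s + C_s m_s\big)\,ds + \int_0^t \mathcal{K}(t,s)\Sigma_s\,dW_s,\\ Y^{m,\xi}_t &= \mathcal{K}(T,t)^\top\big((Q+\bar Q) X_T^{m,\xi} - \bar Q Sm_T\big)+\int_t^T \mathcal{K}(s,t)^\top\Big((Q_s+\bar Q_s) X_s^{m,\xi} - \bar Q_s S_s m_s+A_s^{\top} Y^{m,\xi}_s\Big) ds\\ &\quad -\int_t^T \mathcal{K}(s,t)^\top Z^{m,\xi}_s\,dW_s,\qquad t\in[0,T], \end{aligned} $$ has a unique solution $(X^{m,\xi},Y^{m,\xi},Z^{m,\xi}) \in \mathbb{S}^2([0,T];\mathbb{R}^d)\times \mathbb{S}^2([0,T];\mathbb{R}^d)\times \mathbb{H}^2([0,T];\mathbb{R}^{d\times q})$. Then, for every fixed $m\in C([0,T];\mathbb{R}^d)$ and $\xi\in \mathbb{L}^2(\mathcal{F}_0;\mathbb{R}^d)$, the stochastic optimal control problem of minimizing $\mathcal J^{m,\xi}(\alpha)$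 over $\alpha\in\widehat{\mathcal A}$, subject to the Volterra state dynamics of $X^{\alpha,m,\xi}$ (both defined in the context), has a unique solution $(\alpha^*,X^{\alpha^*,m,\xi})$, where $X^{\alpha^*,m,\xi}=X^{m,\xi}$ and the optimal control is given explicitly by $$\alpha_t^* = - R_t^{-1} B_t^\top Y^{m,\xi}_t .$$
   Context: Fix $T>0$ and $d,q,\kappa\in\mathbb N$. $(\Omega,\mathcal F,(\mathcal F_t)_{t\ge 0},\mathbb P)$ is a complete filtered probability space whose filtration is the usual augmentation of the filtration generated by a $q$-dimensional Brownian motion $W$ and a $\sigma$-algebra $\mathcal F^0_0$ independent of $W$. For matrices, $A\succeq B$ (resp. $A\succ B$) means that $A-B$ is symmetric and non-negative (resp. positive) definite. Spaces: $\mathbb L^2(\mathcal F_0;\mathbb R^d)$ is the space of square-integrable $\mathcal F_0$-measurable $\mathbb R^d$-valued random variables; $\mathbb S^2([0,T];\mathbb R^d)$ is the space of progressively measurable $Z$ with $\mathbb E[\sup_{t\in[0,T]}|Z_t|^2]<\infty$; $\mathbb H^2([0,T];V)$ is the space of progressively measurable $V$-valued $Z$ with $\|Z\|_{\mathbb H^2}^2=\mathbb E[\int_0^T|Z_t|^2dt]<\infty$. The admissible control space is $\widehat{\mathcal A}:=\mathbb H^2([0,T];\mathbb R^\kappa)$. Assumptions. (1) $\mathcal K:[0,T]\times[0,T]\to\mathbb R^{d\times d}$ satisfies $\mathcal K(t,t)=\mathrm{Id}_{d\times d}$ for all $t$; $\mathcal K(t,s)=\mathcal K(t,u)\mathcal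 K(u,s)$ for all $s,u,t\in[0,T]$; and $t\mapsto\mathcal K(t,0)$ is continuous. (2) $A,C:[0,T]\to\mathbb R^{d\times d}$ and $B:[0,T]\to\mathbb R^{d\times\kappa}$ are continuous, $M:C([0,T];\mathbb R^d)\to C([0,T];\mathbb R^d)$ is a map, and $\Sigma\in\mathbb H^2([0,T];\mathbb R^{d\times q})$. (3) $Q,\bar Q,S\in\mathbb R^{d\times d}$ with $Q,\bar Q\succeq0$; $S_t,Q_t,\bar Q_t:[0,T]\to\mathbb R^{d\times d}$ and $R_t:[0,T]\to\mathbb R^{\kappa\times\kappa}$ are continuous, with $R_t\succ\lambda\,\mathrm{Id}_{\kappa\times\kappa}$ for some $\lambda>0$ and $Q_t,\bar Q_t\succeq0$. State dynamics: for $\alpha\in\widehat{\mathcal A}$, $X^{\alpha,m,\xi}\in\mathbb S^2([0,T];\mathbb R^d)$ is the unique solution of $$X^{\alpha,m,\xi}_t = \mathcal{K}(t,0)\xi+M(m)_t + \int_0^t \mathcal{K}(t,s)\big(A_s X^{\alpha,m,\xi}_s + B_s \alpha_s + C_s m_s\big)ds + \int_0^t \mathcal{K}(t,s)\Sigma_s\,dW_s.$$ Cost functional: $$\mathcal J^{m,\xi}(\alpha)=\mathbb E\Big[\int_0^T\ell^m_t(X^{\alpha,m,\xi}_t,\alpha_t)dt+\Phi^m(X^{\alpha,m,\xi}_T)\Big],$$ $$\ell^m_t(x,a)=\tfrac12\big(x^\top Q_tx+a^\top R_ta+(x-S_tm_t)^\top\bar Q_t(x-S_tm_t)\big),\quad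 \Phi^m(x)=\tfrac12\big(x^\top Qx+(x-Sm_T)^\top\bar Q(x-Sm_T)\big).$$ *)

theory Defs
  imports "HOL-Probability.Probability"
begin

section \<open>Stochastic basis\<close>

definition generated_sigma ::
  "'w measure \<Rightarrow> ('i \<Rightarrow> 'w \<Rightarrow> 'v::topological_space) \<Rightarrow> 'i set \<Rightarrow> 'w set set" where
  "generated_sigma P X I =
     sigma_sets (space P) {X i -` U \<inter> space P | i U. i \<in> I \<and> U \<in> sets borel}"

definition brownian_motion :: "'w measure \<Rightarrow> (real \<Rightarrow> 'w \<Rightarrow> real^'q) \<Rightarrow> bool" where
  "brownian_motion P W \<longleftrightarrow>
     (\<forall>t\<ge>0. W t \<in> borel_measurable P) \<and>
     (AE \<omega> in P. W 0 \<omega> = 0) \<and>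
     (AE \<omega> in P. continuous_on {0..} (\<lambda>t. W t \<omega>)) \<and>
     (\<forall>s t. 0 \<le> s \<and> s < t \<longrightarrow>
        prob_space.indep_set P (generated_sigma P W {0..s})
          (generated_sigma P (\<lambda>u \<omega>. W u \<omega> - W s \<omega>) {t}) \<and>
        prob_space.indep_vars P (\<lambda>_. borel) (\<lambda>i \<omega>. (W t \<omega> - W s \<omega>) $ i) UNIV \<and>
        (\<forall>i. distributed P lborel (\<lambda>\<omega>. (W t \<omega> - W s \<omega>) $ i) (normal_density 0 (sqrt (t - s)))))"

text \<open>Adjoin the null sets of the (complete) measure \<open>P\<close>, then make the filtration
  right-continuous; only times \<open>t \<ge> 0\<close> are meaningful.\<close>

definition usual_augmentation ::
  "'w measure \<Rightarrow> (real \<Rightarrow> 'w set set) \<Rightarrow> real \<Rightarrow> 'w measure" where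
  "usual_augmentation P G t =
     sigma (space P) (\<Inter>u\<in>{t<..}. sigma_sets (space P) (G u \<union> null_sets P))"

section \<open>Spaces of random variables, processes and paths\<close>

definition L2_space :: "'w measure \<Rightarrow> 'w measure \<Rightarrow> ('w \<Rightarrow> 'v::euclidean_space) set" where
  "L2_space P G = {\<xi> \<in> borel_measurable G. integrable P (\<lambda>\<omega>. (norm (\<xi> \<omega>))\<^sup>2)}"

definition progressive ::
  "(real \<Rightarrow> 'w measure) \<Rightarrow> real \<Rightarrow> real \<Rightarrow> (real \<Rightarrow> 'w \<Rightarrow> 'v::euclidean_space) \<Rightarrow> bool" where
  "progressive F a b Z \<longleftrightarrow>
     (\<forall>t\<in>{a..b}. (\<lambda>(s, \<omega>). Z s \<omega>) \<in> borel_measurable (restrict_space borel {a..t} \<Otimes>\<^sub>M F t))"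

text \<open>On a complete probability space the running supremum of a progressively measurable
  process is a random variable (measurable projection), so the integral below is its expectation.\<close>

definition S2_space ::
  "'w measure \<Rightarrow> (real \<Rightarrow> 'w measure) \<Rightarrow> real \<Rightarrow> real \<Rightarrow> (real \<Rightarrow> 'w \<Rightarrow> 'v::euclidean_space) set" where
  "S2_space P F a b = {Z. progressive F a b Z \<and>
     (\<integral>\<^sup>+\<omega>. (SUP t\<in>{a..b}. ennreal ((norm (Z t \<omega>))\<^sup>2)) \<partial>P) < \<infinity>}"

text \<open>For matrix-valued processes \<open>norm\<close> is the Frobenius norm.\<close>

definition H2_space ::
  "'w measure \<Rightarrow> (real \<Rightarrow> 'w measure) \<Rightarrow> real \<Rightarrow> real \<Rightarrow> (real \<Rightarrow> 'w \<Rightarrow> 'v::euclidean_space) set" where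
  "H2_space P F a b = {Z. progressive F a b Z \<and>
     (\<integral>\<^sup>+\<omega>. (\<integral>\<^sup>+t\<in>{a..b}. ennreal ((norm (Z t \<omega>))\<^sup>2) \<partial>lborel) \<partial>P) < \<infinity>}"

text \<open>The two notions of equality of processes: in \<open>S2_space\<close> processes are identified when
  they are indistinguishable, in \<open>H2_space\<close> when they agree \<open>dt \<otimes> dP\<close>-almost everywhere.\<close>

definition indistinguishable ::
  "'w measure \<Rightarrow> real \<Rightarrow> real \<Rightarrow> (real \<Rightarrow> 'w \<Rightarrow> 'v) \<Rightarrow> (real \<Rightarrow> 'w \<Rightarrow> 'v) \<Rightarrow> bool" where
  "indistinguishable P a b Z Z' \<longleftrightarrow> (AE \<omega> in P. \<forall>t\<in>{a..b}. Z t \<omega> = Z' t \<omega>)"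

definition equal_ae ::
  "'w measure \<Rightarrow> real \<Rightarrow> real \<Rightarrow> (real \<Rightarrow> 'w \<Rightarrow> 'v) \<Rightarrow> (real \<Rightarrow> 'w \<Rightarrow> 'v) \<Rightarrow> bool" where
  "equal_ae P a b Z Z' \<longleftrightarrow>
     (AE (t, \<omega>) in restrict_space lborel {a..b} \<Otimes>\<^sub>M P. Z t \<omega> = Z' t \<omega>)"

text \<open>The space \<open>C([0,T];V)\<close>; extensionality makes a path depend only on its values on \<open>[0,T]\<close>.\<close>

definition path_space :: "real \<Rightarrow> (real \<Rightarrow> 'v::topological_space) set" where
  "path_space T = {m \<in> extensional {0..T}. continuous_on {0..T} m}"

section \<open>The It\^o integral\<close>

text \<open>Step integrands \<open>\<Sum>i<n. 1\<^bsub>(\<tau> i, \<tau> (i+1)]\<^esub> \<eta> i\<close> on \<open>[a,b]\<close> with bounded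
  \<open>\<F>\<^bsub>\<tau> i\<^esub>\<close>-measurable coefficients.\<close>

definition adapted_step ::
  "'w measure \<Rightarrow> (real \<Rightarrow> 'w measure) \<Rightarrow> real \<Rightarrow> real \<Rightarrow> nat \<Rightarrow> (nat \<Rightarrow> real)
     \<Rightarrow> (nat \<Rightarrow> 'w \<Rightarrow> real^'q^'d) \<Rightarrow> bool" where
  "adapted_step P F a b n \<tau> \<eta> \<longleftrightarrow>
     (\<forall>i\<le>n. a \<le> \<tau> i \<and> \<tau> i \<le> b) \<and> (\<forall>i<n. \<tau> i \<le> \<tau> (Suc i)) \<and>
     (\<forall>i<n. \<eta> i \<in> borel_measurable (F (\<tau> i)) \<and> (\<exists>c. \<forall>\<omega>\<in>space P. norm (\<eta> i \<omega>) \<le> c))"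

definition step_process ::
  "nat \<Rightarrow> (nat \<Rightarrow> real) \<Rightarrow> (nat \<Rightarrow> 'w \<Rightarrow> real^'q^'d) \<Rightarrow> real \<Rightarrow> 'w \<Rightarrow> real^'q^'d" where
  "step_process n \<tau> \<eta> s \<omega> = (\<Sum>i<n. indicator {\<tau> i<..\<tau> (Suc i)} s *\<^sub>R \<eta> i \<omega>)"

definition step_integral ::
  "(real \<Rightarrow> 'w \<Rightarrow> real^'q) \<Rightarrow> nat \<Rightarrow> (nat \<Rightarrow> real) \<Rightarrow> (nat \<Rightarrow> 'w \<Rightarrow> real^'q^'d) \<Rightarrow> 'w \<Rightarrow> real^'d" where
  "step_integral W n \<tau> \<eta> \<omega> = (\<Sum>i<n. \<eta> i \<omega> *v (W (\<tau> (Suc i)) \<omega> - W (\<tau> i) \<omega>))"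

text \<open>\<open>J = \<integral>\<^sub>a\<^sup>b H\<^sub>s dW\<^sub>s\<close> almost surely, for \<open>H\<close> in \<open>H2_space\<close>: the \<open>L\<^sup>2(P)\<close>-limit of the
  integrals of step integrands converging to \<open>H\<close> in \<open>L\<^sup>2(dt \<otimes> dP)\<close>.\<close>

definition has_ito_integral ::
  "'w measure \<Rightarrow> (real \<Rightarrow> 'w measure) \<Rightarrow> (real \<Rightarrow> 'w \<Rightarrow> real^'q) \<Rightarrow> real \<Rightarrow> real
     \<Rightarrow> (real \<Rightarrow> 'w \<Rightarrow> real^'q^'d) \<Rightarrow> ('w \<Rightarrow> real^'d) \<Rightarrow> bool" where
  "has_ito_integral P F W a b H J \<longleftrightarrow>
     H \<in> H2_space P F a b \<and> J \<in> borel_measurable P \<and>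
     (\<exists>n \<tau> \<eta>. (\<forall>k. adapted_step P F a b (n k) (\<tau> k) (\<eta> k)) \<and>
        (\<lambda>k. \<integral>\<^sup>+\<omega>. (\<integral>\<^sup>+s\<in>{a..b}.
            ennreal ((norm (step_process (n k) (\<tau> k) (\<eta> k) s \<omega> - H s \<omega>))\<^sup>2) \<partial>lborel) \<partial>P)
          \<longlonglongrightarrow> 0 \<and>
        (\<lambda>k. \<integral>\<^sup>+\<omega>. ennreal ((norm (step_integral W (n k) (\<tau> k) (\<eta> k) \<omega> - J \<omega>))\<^sup>2) \<partial>P)
          \<longlonglongrightarrow> 0)"

section \<open>Definiteness\<close>

definition nonneg_def_mat :: "real^'n^'n \<Rightarrow> bool" where
  "nonneg_def_mat A \<longleftrightarrow> transpose A = A \<and> (\<forall>x. 0 \<le> x \<bullet> (A *v x))"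

definition pos_def_mat :: "real^'n^'n \<Rightarrow> bool" where
  "pos_def_mat A \<longleftrightarrow> transpose A = A \<and> (\<forall>x. x \<noteq> 0 \<longrightarrow> 0 < x \<bullet> (A *v x))"

section \<open>Linear-quadratic Volterra control\<close>

text \<open>The Volterra equations below hold almost surely, simultaneously for all \<open>t \<in> [0,T]\<close>, where
  \<open>N\<close> is a continuous version of the stochastic integral, as a process in \<open>t\<close>.\<close>

definition is_controlled_state where
  "is_controlled_state P F W T K Mop A B C Sig m \<xi> \<alpha> X \<longleftrightarrow>
     X \<in> S2_space P F 0 T \<and>
     (\<exists>N. (AE \<omega> in P. continuous_on {0..T} (\<lambda>t. N t \<omega>)) \<and>
        (\<forall>t\<in>{0..T}. has_ito_integral P F W 0 t (\<lambda>s \<omega>. K t s ** Sig s \<omega>) (N t)) \<and>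
        (AE \<omega> in P. \<forall>t\<in>{0..T}.
           X t \<omega> = K t 0 *v \<xi> \<omega> + Mop m t
             + (LINT s:{0..t}|lborel. K t s *v (A s *v X s \<omega> + B s *v \<alpha> s \<omega> + C s *v m s))
             + N t \<omega>))"
  for P :: "'w measure" and F :: "real \<Rightarrow> 'w measure" and W :: "real \<Rightarrow> 'w \<Rightarrow> real^'q" and T :: real
    and K :: "real \<Rightarrow> real \<Rightarrow> real^'d^'d" and Mop :: "(real \<Rightarrow> real^'d) \<Rightarrow> real \<Rightarrow> real^'d"
    and A :: "real \<Rightarrow> real^'d^'d" and B :: "real \<Rightarrow> real^'k^'d" and C :: "real \<Rightarrow> real^'d^'d"
    and Sig :: "real \<Rightarrow> 'w \<Rightarrow> real^'q^'d" and m :: "real \<Rightarrow> real^'d" and \<xi> :: "'w \<Rightarrow> real^'d"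
    and \<alpha> :: "real \<Rightarrow> 'w \<Rightarrow> real^'k" and X :: "real \<Rightarrow> 'w \<Rightarrow> real^'d"

text \<open>The state equation is a linear equation with a unique solution up to
  indistinguishability, so the choice only picks a representative.\<close>

definition controlled_state where
  "controlled_state P F W T K Mop A B C Sig m \<xi> \<alpha> =
     (SOME X. is_controlled_state P F W T K Mop A B C Sig m \<xi> \<alpha> X)"

definition running_cost where
  "running_cost Qt Qbart St Rt m t x a =
     1 / 2 * (x \<bullet> (Qt t *v x) + a \<bullet> (Rt t *v a)
              + (x - St t *v m t) \<bullet> (Qbart t *v (x - St t *v m t)))"
  for Qt Qbart St :: "real \<Rightarrow> real^'d^'d" and Rt :: "real \<Rightarrow> real^'k^'k"
    and m :: "real \<Rightarrow> real^'d" and t :: real and x :: "real^'d" and a :: "real^'k"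

definition terminal_cost where
  "terminal_cost Q Qbar S T m x =
     1 / 2 * (x \<bullet> (Q *v x) + (x - S *v m T) \<bullet> (Qbar *v (x - S *v m T)))"
  for Q Qbar S :: "real^'d^'d" and T :: real and m :: "real \<Rightarrow> real^'d" and x :: "real^'d"

definition control_cost where
  "control_cost P F W T K Mop A B C Sig Q Qbar S Qt Qbart St Rt m \<xi> \<alpha> =
     (let X = controlled_state P F W T K Mop A B C Sig m \<xi> \<alpha> in
      prob_space.expectation P (\<lambda>\<omega>.
        (LINT t:{0..T}|lborel. running_cost Qt Qbart St Rt m t (X t \<omega>) (\<alpha> t \<omega>))
        + terminal_cost Q Qbar S T m (X T \<omega>)))"

definition solves_control_problem where
  "solves_control_problem P F W T K Mop A B C Sig Q Qbar S Qt Qbart St Rt m \<xi> \<alpha> X \<longleftrightarrow>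
     \<alpha> \<in> H2_space P F 0 T \<and>
     is_controlled_state P F W T K Mop A B C Sig m \<xi> \<alpha> X \<and>
     (\<forall>\<beta>\<in>H2_space P F 0 T.
        control_cost P F W T K Mop A B C Sig Q Qbar S Qt Qbart St Rt m \<xi> \<alpha>
        \<le> control_cost P F W T K Mop A B C Sig Q Qbar S Qt Qbart St Rt m \<xi> \<beta>)"

definition feedback where
  "feedback B Rt Y t \<omega> = - (matrix_inv (Rt t) *v (transpose (B t) *v Y t \<omega>))"
  for B :: "real \<Rightarrow> real^'k^'d" and Rt :: "real \<Rightarrow> real^'k^'k" and Y :: "real \<Rightarrow> 'w \<Rightarrow> real^'d"

text \<open>The forward equation is the state equation for the control \<open>- R\<^sub>t\<inverse> B\<^sub>t\<^sup>T Y\<^sub>t\<close>.\<close>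

definition solves_fbsde where
  "solves_fbsde P F W T K Mop A B C Sig Q Qbar S Qt Qbart St Rt m \<xi> X Y Z \<longleftrightarrow>
     X \<in> S2_space P F 0 T \<and> Y \<in> S2_space P F 0 T \<and> Z \<in> H2_space P F 0 T \<and>
     (\<exists>N. (AE \<omega> in P. continuous_on {0..T} (\<lambda>t. N t \<omega>)) \<and>
        (\<forall>t\<in>{0..T}. has_ito_integral P F W 0 t (\<lambda>s \<omega>. K t s ** Sig s \<omega>) (N t)) \<and>
        (AE \<omega> in P. \<forall>t\<in>{0..T}.
           X t \<omega> = K t 0 *v \<xi> \<omega> + Mop m t
             + (LINT s:{0..t}|lborel. K t s *v
                  (A s *v X s \<omega> - B s *v (matrix_inv (Rt s) *v (transpose (B s) *v Y s \<omega>))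
                   + C s *v m s))
             + N t \<omega>)) \<and>
     (\<exists>N. (AE \<omega> in P. continuous_on {0..T} (\<lambda>t. N t \<omega>)) \<and>
        (\<forall>t\<in>{0..T}. has_ito_integral P F W t T (\<lambda>s \<omega>. transpose (K s t) ** Z s \<omega>) (N t)) \<and>
        (AE \<omega> in P. \<forall>t\<in>{0..T}.
           Y t \<omega> = transpose (K T t) *v ((Q + Qbar) *v X T \<omega> - Qbar *v (S *v m T))
             + (LINT s:{t..T}|lborel. transpose (K s t) *v
                  ((Qt s + Qbart s) *v X s \<omega> - Qbart s *v (St s *v m s)
                   + transpose (A s) *v Y s \<omega>))
             - N t \<omega>))"
  for P :: "'w measure" and F :: "real \<Rightarrow> 'w measure" and W :: "real \<Rightarrow> 'w \<Rightarrow> real^'q" and T :: real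
    and K :: "real \<Rightarrow> real \<Rightarrow> real^'d^'d" and Mop :: "(real \<Rightarrow> real^'d) \<Rightarrow> real \<Rightarrow> real^'d"
    and A :: "real \<Rightarrow> real^'d^'d" and B :: "real \<Rightarrow> real^'k^'d" and C :: "real \<Rightarrow> real^'d^'d"
    and Sig :: "real \<Rightarrow> 'w \<Rightarrow> real^'q^'d" and Q Qbar S :: "real^'d^'d"
    and Qt Qbart St :: "real \<Rightarrow> real^'d^'d" and Rt :: "real \<Rightarrow> real^'k^'k"
    and m :: "real \<Rightarrow> real^'d" and \<xi> :: "'w \<Rightarrow> real^'d"
    and X Y :: "real \<Rightarrow> 'w \<Rightarrow> real^'d" and Z :: "real \<Rightarrow> 'w \<Rightarrow> real^'q^'d"

end

theory Submission
  imports Defs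
begin

text \<open>The kernel factorises as \<open>K t s = K t 0 ** K 0 s\<close>, so the difference \<open>D\<close> of the states of two
  controls no longer contains the stochastic integral and solves a linear Volterra equation path by
  path; it is given by a fundamental matrix. This yields a state for every control (perturb the
  forward component of the given system) and, by a Gronwall argument, its uniqueness.

  The cost is quadratic, and its first variation at the feedback control in the direction \<open>\<gamma>\<close> is
  \<open>E[D T \<bullet> G] + E \<integral> D \<bullet> g - E \<integral> (B \<gamma>) \<bullet> Y\<close>, where \<open>G\<close> and \<open>g\<close> are the data of the backward
  equation. It vanishes by Fubini's theorem, because an It\^o integral over \<open>[t,T]\<close> is orthogonal to
  the \<open>F t\<close>-measurable square-integrable vectors. The second variation is at least \<open>lam * E \<integral> |\<gamma>|\<^sup>2\<close>,
  so the feedback control is the only minimiser.\<close>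

text \<open>\<open>has_ito_integral\<close> only relates an integrand to a limit of step integrals.
  The two facts used about it, almost sure uniqueness and orthogonality to the past, are derived
  from the moments of Brownian increments. The first makes the noise of two states cancel; the
  second is all that the duality asks of the stochastic integral.

  Controls are merely square-integrable in time, so a difference of states need not satisfy its
  linear equation in differentiated form at every time. The explicit formula for it is checked in
  integral form, by exchanging the order of integration over a triangle.

  No derivative of the cost is taken. Expanding the quadratic cost around the feedback control
  \<alpha> gives J(\<beta>) \<ge> J(\<alpha>) + lam/2 E \<integral> |\<beta> - \<alpha>|^2 for every
  admissible \<beta>, and this one estimate contains both minimality and uniqueness. Since the cost
  is evaluated at a chosen state, existence and uniqueness of states are settled before costs are
  compared.\<close>

section \<open>Lower integrals, matrix-valued functions and linear differential equations\<close>

text \<open>For a function that is not known to be measurable, such as the running supremum in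
  \<open>S2_space\<close>, \<open>nn_integral\<close> is the lower integral and only the following inequalities remain.\<close>

lemma nn_integral_add_le:
  assumes g [measurable]: "g \<in> borel_measurable M"
  shows "(\<integral>\<^sup>+x. f x + g x \<partial>M) \<le> (\<integral>\<^sup>+x. f x \<partial>M) + (\<integral>\<^sup>+x. g x \<partial>M)"
  unfolding nn_integral_def[of M "\<lambda>x. f x + g x"]
proof (rule SUP_least, clarify)
  fix h assume h: "simple_function M h" and le: "h \<le> (\<lambda>x. f x + g x)"
  have hm [measurable]: "h \<in> borel_measurable M" using h by (rule borel_measurable_simple_function)
  have "integral\<^sup>S M h = (\<integral>\<^sup>+x. h x \<partial>M)" using h by (simp add: nn_integral_eq_simple_integral)
  \<comment> \<open>Since \<open>\<top> - \<top> = \<top>\<close> in \<open>ennreal\<close>, the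
    difference \<open>h x - g x\<close> need not lie below \<open>f x\<close> where \<open>g\<close>
    is infinite; the value 0 does, and it suffices there.\<close>
  also have "\<dots> \<le> (\<integral>\<^sup>+x. (if g x = \<top> then 0 else h x - g x) + g x \<partial>M)"
  proof (intro nn_integral_mono)
    fix x show "h x \<le> (if g x = \<top> then 0 else h x - g x) + g x"
      by (cases "g x \<le> h x") (auto simp: diff_add_cancel_ennreal intro: order_trans[of _ "g x"] add_increasing)
  qed
  also have "\<dots> = (\<integral>\<^sup>+x. (if g x = \<top> then 0 else h x - g x) \<partial>M) + (\<integral>\<^sup>+x. g x \<partial>M)"
    by (rule nn_integral_add) measurable
  also have "(\<integral>\<^sup>+x. (if g x = \<top> then 0 else h x - g x) \<partial>M) \<le> (\<integral>\<^sup>+x. f x \<partial>M)"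
    using le by (intro nn_integral_mono) (auto simp: le_fun_def ennreal_minus_le_iff add.commute)
  finally show "integral\<^sup>S M h \<le> (\<integral>\<^sup>+x. f x \<partial>M) + (\<integral>\<^sup>+x. g x \<partial>M)" by (simp add: add_right_mono)
qed

lemma nn_integral_cmult_le:
  assumes c: "(0::real) < c"
  shows "(\<integral>\<^sup>+x. ennreal c * f x \<partial>M) \<le> ennreal c * (\<integral>\<^sup>+x. f x \<partial>M)"
  unfolding nn_integral_def[of M "\<lambda>x. ennreal c * f x"]
proof (rule SUP_least, clarify)
  fix h assume h: "simple_function M h" and le: "h \<le> (\<lambda>x. ennreal c * f x)"
  have hm [measurable]: "h \<in> borel_measurable M" using h by (rule borel_measurable_simple_function)
  have cc: "ennreal c * ennreal (1 / c) = 1"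
    using c by (simp add: ennreal_mult[symmetric] del: ennreal_1 flip: ennreal_1)
  have "integral\<^sup>S M h = (\<integral>\<^sup>+x. h x \<partial>M)" using h by (simp add: nn_integral_eq_simple_integral)
  also have "\<dots> = (\<integral>\<^sup>+x. ennreal c * (ennreal (1 / c) * h x) \<partial>M)"
    by (simp add: cc mult.assoc[symmetric])
  also have "\<dots> = ennreal c * (\<integral>\<^sup>+x. ennreal (1 / c) * h x \<partial>M)"
    by (rule nn_integral_cmult) measurable
  also have "\<dots> \<le> ennreal c * (\<integral>\<^sup>+x. f x \<partial>M)"
  proof (intro mult_left_mono nn_integral_mono)
    fix x
    have "ennreal (1 / c) * h x \<le> ennreal (1 / c) * (ennreal c * f x)"
      using le by (intro mult_left_mono) (auto simp: le_fun_def)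
    also have "\<dots> = f x" using cc by (simp add: mult.assoc[symmetric] mult.commute[of "ennreal (1/c)"])
    finally show "ennreal (1 / c) * h x \<le> f x" .
  qed simp
  finally show "integral\<^sup>S M h \<le> ennreal c * (\<integral>\<^sup>+x. f x \<partial>M)" .
qed

section \<open>Calculus of matrix-valued functions\<close>

lemma bounded_bilinear_matrix_vector_mult:
  "bounded_bilinear ((*v) :: real^'n^'m \<Rightarrow> real^'n \<Rightarrow> real^'m)"
  unfolding bilinear_conv_bounded_bilinear[symmetric] bilinear_def
  by (auto intro!: linearI simp: matrix_vector_right_distrib matrix_vector_mult_add_rdistrib
      matrix_vector_mult_scaleR scaleR_matrix_vector_assoc[symmetric])

lemma bounded_bilinear_matrix_matrix_mult:
  "bounded_bilinear ((**) :: real^'n^'m \<Rightarrow> real^'k^'n \<Rightarrow> real^'k^'m)"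
  unfolding bilinear_conv_bounded_bilinear[symmetric] bilinear_def
  by (auto intro!: linearI simp: matrix_matrix_mult_def vec_eq_iff sum.distrib sum_distrib_left
      algebra_simps)

lemmas continuous_on_matrix_vector_mult [continuous_intros] =
  bounded_bilinear.continuous_on[OF bounded_bilinear_matrix_vector_mult]
lemmas continuous_on_matrix_matrix_mult [continuous_intros] =
  bounded_bilinear.continuous_on[OF bounded_bilinear_matrix_matrix_mult]

lemma continuous_on_transpose [continuous_intros]:
  fixes f :: "'a::topological_space \<Rightarrow> real^'n^'m"
  assumes "continuous_on S f"
  shows "continuous_on S (\<lambda>x. transpose (f x))"
  unfolding transpose_def by (intro continuous_intros assms)

lemma continuous_on_det [continuous_intros]:
  fixes f :: "'a::topological_space \<Rightarrow> real^'n^'n"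
  assumes "continuous_on S f"
  shows "continuous_on S (\<lambda>x. det (f x))"
  unfolding det_def by (intro continuous_intros assms)

text \<open>Cramer's rule writes every entry of the inverse as a quotient of determinants, and these
  are polynomials in the entries of \<open>f x\<close>. The inverse is an arbitrary right inverse
  \<open>g\<close>, so that the lemma applies to \<open>K 0 t\<close>, which inverts
  \<open>K t 0\<close> by the flow identity of the kernel, as well as to
  \<open>matrix_inv (Rt t)\<close>.\<close>

lemma continuous_on_matrix_inverse:
  fixes f g :: "'a::topological_space \<Rightarrow> real^'n^'n"
  assumes f: "continuous_on S f" and inv: "\<And>x. x \<in> S \<Longrightarrow> f x ** g x = mat 1"
  shows "continuous_on S g"
proof -
  have det: "det (f x) \<noteq> 0" if "x \<in> S" for x
    using inv[OF that] by (metis det_I det_mul mult_zero_left zero_neq_one)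
  have "g x $ i $ j = det (\<chi> i' j'. if j' = i then axis j 1 $ i' else f x $ i' $ j') / det (f x)"
    if "x \<in> S" for x i j
  proof -
    \<comment> \<open>Column \<open>j\<close> of \<open>g x\<close> solves the linear system whose
      right-hand side is the unit vector \<open>axis j 1\<close>.\<close>
    have "f x *v (g x *v axis j 1) = axis j 1"
      using inv[OF that] by (simp add: matrix_vector_mul_assoc)
    then have "g x *v axis j 1
        = (\<chi> k. det (\<chi> i' j'. if j' = k then axis j 1 $ i' else f x $ i' $ j') / det (f x))"
      using cramer[OF det[OF that]] by blast
    then have "(g x *v axis j 1) $ i
        = det (\<chi> i' j'. if j' = i then axis j 1 $ i' else f x $ i' $ j') / det (f x)"
      by simp
    then show ?thesis by (simp add: matrix_vector_mult_basis column_def)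
  qed
  then have eq: "g x = (\<chi> i j. det (\<chi> i' j'. if j' = i then axis j 1 $ i' else f x $ i' $ j')
      / det (f x))" if "x \<in> S" for x
    using that by (simp add: vec_eq_iff)
  have if_cont: "continuous_on S (\<lambda>x. if j' = i then axis j 1 $ i' else f x $ i' $ j')" for i j i' j' :: 'n
    by (cases "j' = i") (auto intro!: continuous_intros f)
  have "continuous_on S (\<lambda>x. \<chi> i j. det (\<chi> i' j'. if j' = i then axis j 1 $ i' else f x $ i' $ j')
      / det (f x))"
    by (intro continuous_intros if_cont f ballI det)
  then show ?thesis
    by (rule continuous_on_eq) (simp add: eq)
qed

lemma continuous_on_Icc_bounded:
  fixes f :: "real \<Rightarrow> 'a::real_normed_vector"
  assumes "continuous_on {a..b} f"
  obtains c where "c > 0" "\<And>t. t \<in> {a..b} \<Longrightarrow> norm (f t) \<le> c"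
proof -
  have "bounded (f ` {a..b})" using assms compact_continuous_image compact_imp_bounded compact_Icc by blast
  then show ?thesis using that unfolding bounded_pos by auto
qed

lemma matrix_vector_mult_bounded_on:
  fixes G :: "real \<Rightarrow> real^'n^'m"
  assumes "continuous_on {a..b} G"
  obtains c where "c > 0" "\<And>t x. t \<in> {a..b} \<Longrightarrow> norm (G t *v x) \<le> c * norm x"
proof -
  obtain c where c: "c > 0" "\<And>t. t \<in> {a..b} \<Longrightarrow> norm (G t) \<le> c"
    using continuous_on_Icc_bounded[OF assms] by metis
  obtain k where k: "k > 0" "\<And>(x :: real^'n^'m) y. norm (x *v y) \<le> norm x * norm y * k"
    using bounded_bilinear.pos_bounded[OF bounded_bilinear_matrix_vector_mult] by metis
  have "norm (G t *v x) \<le> c * k * norm x" if "t \<in> {a..b}" for t x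
  proof -
    have "norm (G t) * norm x * k \<le> c * norm x * k" using c(2)[OF that] k(1) by (intro mult_right_mono) auto
    then show ?thesis using k(2)[of "G t" x] by (simp add: mult_ac)
  qed
  then show ?thesis using that[of "c * k"] c(1) k(1) by simp
qed

text \<open>Banach's fixed point theorem for the Picard operator. The unknown is divided by
  \<open>exp (L * t)\<close>; in this weighted supremum norm the operator contracts on all of [0,T]
  at once, so no local solutions have to be glued.\<close>

lemma picard_lindelof_global:
  fixes h :: "real \<Rightarrow> 'a::banach \<Rightarrow> 'a"
  assumes T: "0 \<le> T"
    and cont: "\<And>f. continuous_on {0..T} f \<Longrightarrow> continuous_on {0..T} (\<lambda>t. h t (f t))"
    and lip: "\<And>t x y. t \<in> {0..T} \<Longrightarrow> norm (h t x - h t y) \<le> M * norm (x - y)"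
  obtains f where "f 0 = x0"
    "\<And>t. t \<in> {0..T} \<Longrightarrow> (f has_vector_derivative h t (f t)) (at t within {0..T})"
proof -
  \<comment> \<open>The choice gives \<open>\<bar>M\<bar> / L \<le> 1 / 2\<close>, hence the
    contraction factor 1/2; the summand 1 keeps \<open>L\<close> positive when
    \<open>M = 0\<close>.\<close>
  define L where "L = 2 * \<bar>M\<bar> + 1"
  have L: "L > 0" "\<bar>M\<bar> / L \<le> 1 / 2" by (auto simp: L_def field_simps)
  \<comment> \<open>Bounded continuous functions are taken on the whole line, so times are clamped
    to [0,T]; the images under \<open>\<Phi>\<close> are constant on either side of it.\<close>
  define cl where "cl t = max 0 (min t T)" for t
  have cl: "cl t \<in> {0..T}" for t using T by (auto simp: cl_def)
  have cl_id: "cl t = t" if "t \<in> {0..T}" for t using that by (auto simp: cl_def)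
  have cl_cont: "continuous_on S cl" for S unfolding cl_def by (intro continuous_intros)
  define I where "I g t = integral {0..t} (\<lambda>s. h s (exp (L * s) *\<^sub>R g s))" for g t
  define \<Phi> where "\<Phi> g t = exp (- L * cl t) *\<^sub>R (x0 + I g (cl t))" for g t
  have hc: "continuous_on {0..T} (\<lambda>s. h s (exp (L * s) *\<^sub>R apply_bcontfun g s))" for g
    by (intro cont continuous_on_scaleR continuous_on_apply_bcontfun continuous_intros)
  have I_cont: "continuous_on {0..T} (I (apply_bcontfun g))" for g
    unfolding I_def by (intro indefinite_integral_continuous_1 integrable_continuous_real hc)
  have \<Phi>_cont: "continuous_on UNIV (\<Phi> (apply_bcontfun g))" for g
  proof -
    have "continuous_on UNIV (\<lambda>t. I (apply_bcontfun g) (cl t))"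
      by (rule continuous_on_compose2[OF I_cont cl_cont]) (use cl in auto)
    then show ?thesis unfolding \<Phi>_def by (intro continuous_intros cl_cont)
  qed
  have bc: "\<Phi> (apply_bcontfun g) \<in> bcontfun" for g
  proof -
    have "continuous_on {0..T} (\<Phi> (apply_bcontfun g))"
      using \<Phi>_cont continuous_on_subset by blast
    then obtain c where c: "\<And>t. t \<in> {0..T} \<Longrightarrow> norm (\<Phi> (apply_bcontfun g) t) \<le> c"
      using continuous_on_Icc_bounded by blast
    have "norm (\<Phi> (apply_bcontfun g) t) \<le> c" for t
      using c[OF cl[of t]] cl_id[OF cl[of t]] by (simp add: \<Phi>_def)
    then show ?thesis using \<Phi>_cont bcontfun_normI by blast
  qed
  have ap: "apply_bcontfun (Bcontfun (\<Phi> (apply_bcontfun g))) = \<Phi> (apply_bcontfun g)" for g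
    using bc by (simp add: Bcontfun_inverse)
  have contr: "dist (Bcontfun (\<Phi> (apply_bcontfun g))) (Bcontfun (\<Phi> (apply_bcontfun g'))) \<le> 1/2 * dist g g'" for g g'
  proof (rule dist_bound)
    fix t
    define r where "r = cl t"
    have r: "r \<in> {0..T}" unfolding r_def by (rule cl)
    have sub: "{0..r} \<subseteq> {0..T}" using r by auto
    have expi: "((\<lambda>s. exp (L * s)) has_integral (exp (L * r) / L - exp (L * 0) / L)) {0..r}"
      using r L by (intro fundamental_theorem_of_calculus)
        (auto intro!: derivative_eq_intros simp: has_real_derivative_iff_has_vector_derivative[symmetric])
    have int: "(\<lambda>s. h s (exp (L * s) *\<^sub>R apply_bcontfun g s)) integrable_on {0..r}" for g
      by (intro integrable_continuous_real continuous_on_subset[OF hc sub])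
    have "norm (I (apply_bcontfun g) r - I (apply_bcontfun g') r)
        = norm (integral {0..r} (\<lambda>s. h s (exp (L * s) *\<^sub>R apply_bcontfun g s) - h s (exp (L * s) *\<^sub>R apply_bcontfun g' s)))"
      unfolding I_def by (simp add: integral_diff[OF int int])
    also have "\<dots> \<le> integral {0..r} (\<lambda>s. \<bar>M\<bar> * dist g g' * exp (L * s))"
    proof (rule integral_norm_bound_integral)
      show "(\<lambda>s. h s (exp (L * s) *\<^sub>R apply_bcontfun g s) - h s (exp (L * s) *\<^sub>R apply_bcontfun g' s)) integrable_on {0..r}"
        by (intro integrable_diff int)
      show "(\<lambda>s. \<bar>M\<bar> * dist g g' * exp (L * s)) integrable_on {0..r}"
        by (intro integrable_continuous_real continuous_intros)
    next
      fix s assume s: "s \<in> {0..r}"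
      have "norm (h s (exp (L * s) *\<^sub>R apply_bcontfun g s) - h s (exp (L * s) *\<^sub>R apply_bcontfun g' s))
        \<le> M * norm (exp (L * s) *\<^sub>R apply_bcontfun g s - exp (L * s) *\<^sub>R apply_bcontfun g' s)"
        using s sub by (intro lip) auto
      also have "\<dots> = M * (exp (L * s) * dist (apply_bcontfun g s) (apply_bcontfun g' s))"
        by (simp add: scaleR_diff_right[symmetric] dist_norm)
      also have "\<dots> \<le> \<bar>M\<bar> * (exp (L * s) * dist g g')"
        by (intro mult_mono dist_bounded) auto
      finally show "norm (h s (exp (L * s) *\<^sub>R apply_bcontfun g s) - h s (exp (L * s) *\<^sub>R apply_bcontfun g' s))
          \<le> \<bar>M\<bar> * dist g g' * exp (L * s)" by (simp add: mult_ac)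
    qed
    also have "\<dots> = \<bar>M\<bar> * dist g g' * (exp (L * r) / L - 1 / L)"
      using expi by (simp add: integral_unique)
    also have "\<dots> \<le> \<bar>M\<bar> * dist g g' * (exp (L * r) / L)"
      using L by (intro mult_left_mono) auto
    also have "\<dots> = exp (L * r) * (\<bar>M\<bar> / L * dist g g')" by simp
    also have "\<dots> \<le> exp (L * r) * (1 / 2 * dist g g')"
      using L by (intro mult_left_mono mult_right_mono) auto
    finally have le: "norm (I (apply_bcontfun g) r - I (apply_bcontfun g') r) \<le> exp (L * r) * (1 / 2 * dist g g')" .
    have "dist (\<Phi> (apply_bcontfun g) t) (\<Phi> (apply_bcontfun g') t)
       = exp (- L * r) * norm (I (apply_bcontfun g) r - I (apply_bcontfun g') r)"
      unfolding \<Phi>_def r_def[symmetric] dist_norm scaleR_diff_right[symmetric] by simp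
    also have "\<dots> \<le> exp (- L * r) * (exp (L * r) * (1 / 2 * dist g g'))"
      using le by (intro mult_left_mono) auto
    also have "\<dots> = 1 / 2 * dist g g'" by (simp add: mult.assoc[symmetric] exp_add[symmetric])
    finally show "dist (apply_bcontfun (Bcontfun (\<Phi> (apply_bcontfun g))) t) (apply_bcontfun (Bcontfun (\<Phi> (apply_bcontfun g'))) t)
        \<le> 1/2 * dist g g'" unfolding ap .
  qed
  have "\<exists>!g. Bcontfun (\<Phi> (apply_bcontfun g)) = g"
    by (rule banach_fix_type[of "1/2"]) (use contr in auto)
  then obtain g where g: "Bcontfun (\<Phi> (apply_bcontfun g)) = g" by blast
  have g_eq: "apply_bcontfun g t = \<Phi> (apply_bcontfun g) t" for t using ap[of g] g by simp
  \<comment> \<open>Undoing the weight turns the fixed point into a solution of the integral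
    equation.\<close>
  define f where "f t = exp (L * t) *\<^sub>R apply_bcontfun g t" for t
  have f_eq: "f t = x0 + integral {0..t} (\<lambda>s. h s (f s))" if "t \<in> {0..T}" for t
  proof -
    have "f t = exp (L * t) *\<^sub>R (exp (- L * t) *\<^sub>R (x0 + I (apply_bcontfun g) t))"
      using g_eq[of t] cl_id[OF that] unfolding f_def \<Phi>_def by simp
    also have "\<dots> = x0 + I (apply_bcontfun g) t" by (simp add: exp_add[symmetric])
    finally show ?thesis by (simp add: I_def f_def[abs_def])
  qed
  have hfc: "continuous_on {0..T} (\<lambda>s. h s (f s))" using hc[of g] by (simp add: f_def)
  show ?thesis
  proof
    show "f 0 = x0" using f_eq[of 0] T by simp
    fix t assume t: "t \<in> {0..T}"
    have "((\<lambda>t. x0 + integral {0..t} (\<lambda>s. h s (f s))) has_vector_derivative h t (f t)) (at t within {0..T})"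
      using integral_has_vector_derivative[OF hfc t] by (auto intro!: derivative_eq_intros)
    then show "(f has_vector_derivative h t (f t)) (at t within {0..T})"
      by (rule has_vector_derivative_transform[OF t, rotated]) (use f_eq in auto)
  qed
qed

text \<open>\<open>\<Theta>\<close> is built as a solution of the adjoint equation
  \<open>\<Theta>' = - \<Theta> a\<close>, for which \<open>\<Theta> \<Psi>\<close> has derivative
  zero. This yields the inverse of the fundamental matrix together with its continuity, without
  Liouville's formula for the determinant.\<close>

lemma linear_ode_fundamental_matrix:
  fixes a :: "real \<Rightarrow> real^'d^'d"
  assumes T: "0 \<le> T" and a: "continuous_on {0..T} a"
  obtains \<Psi> \<Theta> :: "real \<Rightarrow> real^'d^'d"
  where "continuous_on {0..T} \<Psi>" "continuous_on {0..T} \<Theta>"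
    "\<And>t. t \<in> {0..T} \<Longrightarrow> \<Psi> t ** \<Theta> t = mat 1"
    "\<And>t. t \<in> {0..T} \<Longrightarrow> (\<Psi> has_vector_derivative a t ** \<Psi> t) (at t within {0..T})"
proof -
  interpret mm: bounded_bilinear "(**) :: real^'d^'d \<Rightarrow> real^'d^'d \<Rightarrow> real^'d^'d"
    by (rule bounded_bilinear_matrix_matrix_mult)
  obtain c where c: "c > 0" "\<And>t. t \<in> {0..T} \<Longrightarrow> norm (a t) \<le> c"
    using continuous_on_Icc_bounded[OF a] by metis
  obtain k where k: "k > 0" "\<And>(x::real^'d^'d) (y::real^'d^'d). norm (x ** y) \<le> norm x * norm y * k"
    using mm.pos_bounded by metis
  have bnd: "norm (a t ** x) \<le> c * k * norm x" "norm (x ** a t) \<le> c * k * norm x"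
    if "t \<in> {0..T}" for t x
  proof -
    have "norm (a t) * norm x * k \<le> c * norm x * k"
      using c(2)[OF that] k(1) by (intro mult_right_mono) auto
    then show "norm (a t ** x) \<le> c * k * norm x" "norm (x ** a t) \<le> c * k * norm x"
      using k(2)[of "a t" x] k(2)[of x "a t"] by (auto simp: mult_ac)
  qed
  obtain \<Psi> where \<Psi>: "\<Psi> 0 = mat 1"
    "\<And>t. t \<in> {0..T} \<Longrightarrow> (\<Psi> has_vector_derivative a t ** \<Psi> t) (at t within {0..T})"
    by (rule picard_lindelof_global[OF T, where h = "\<lambda>t x. a t ** x" and M = "c * k" and ?x0.0 = "mat 1"])
       (auto intro!: continuous_intros a bnd(1) simp: mm.diff_right[symmetric])
  obtain \<Theta> where \<Theta>: "\<Theta> 0 = mat 1"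
    "\<And>t. t \<in> {0..T} \<Longrightarrow> (\<Theta> has_vector_derivative - (\<Theta> t ** a t)) (at t within {0..T})"
  proof (rule picard_lindelof_global[OF T, where h = "\<lambda>t x. - (x ** a t)" and M = "c * k" and ?x0.0 = "mat 1"])
    fix t and x y :: "real^'d^'d" assume "t \<in> {0..T}"
    have "- (x ** a t) - - (y ** a t) = (y - x) ** a t" by (simp add: mm.diff_left)
    then show "norm (- (x ** a t) - - (y ** a t)) \<le> c * k * norm (x - y)"
      using bnd(2)[OF \<open>t \<in> {0..T}\<close>, of "y - x"] by (simp add: norm_minus_commute)
  qed (auto intro!: continuous_intros a)
  have "((\<lambda>t. \<Theta> t ** \<Psi> t) has_vector_derivative 0) (at t within {0..T})" if "t \<in> {0..T}" for t
  proof -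
    have "((\<lambda>t. \<Theta> t ** \<Psi> t) has_vector_derivative (\<Theta> t ** (a t ** \<Psi> t) + (- (\<Theta> t ** a t)) ** \<Psi> t)) (at t within {0..T})"
      by (rule mm.has_vector_derivative[OF \<Theta>(2)[OF that] \<Psi>(2)[OF that]])
    then show ?thesis by (simp add: mm.minus_left matrix_mul_assoc)
  qed
  then obtain e where e: "\<And>t. t \<in> {0..T} \<Longrightarrow> \<Theta> t ** \<Psi> t = e"
    using has_vector_derivative_zero_constant[of "{0..T}" "\<lambda>t. \<Theta> t ** \<Psi> t"] by auto
  have "e = mat 1" using e[of 0] T \<Psi>(1) \<Theta>(1) by simp
  \<comment> \<open>The constant product exhibits \<open>\<Theta> t\<close> as a left inverse; for
    square matrices it is also a right inverse.\<close>
  then have inv: "\<Psi> t ** \<Theta> t = mat 1" if "t \<in> {0..T}" for t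
    using e[OF that] matrix_left_right_inverse by metis
  show ?thesis
  proof
    show "continuous_on {0..T} \<Psi>" "continuous_on {0..T} \<Theta>"
      unfolding continuous_on_eq_continuous_within
      by (meson \<Psi>(2) \<Theta>(2) has_vector_derivative_continuous)+
  qed (use inv \<Psi>(2) in auto)
qed

section \<open>Deterministic linear Volterra equations\<close>

text \<open>Both sides are the integral of \<open>prod (b s) (w r)\<close> over the triangle 0 \<le>
  r \<le> s \<le> t. The product is left general: with matrix times vector this verifies the
  variation of constants formula, with the inner product it serves the duality of the forward and
  the backward equation.\<close>

lemma set_integral_fubini_triangle:
  fixes b :: "real \<Rightarrow> 'a::euclidean_space" and w :: "real \<Rightarrow> 'b::euclidean_space"
    and prod :: "'a \<Rightarrow> 'b \<Rightarrow> 'c::euclidean_space"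
  assumes prod: "bounded_bilinear prod"
    and b: "set_integrable lborel {0..t} b" and w: "set_integrable lborel {0..t} w"
  shows "(LINT s:{0..t}|lborel. prod (b s) (LINT r:{0..s}|lborel. w r))
    = (LINT r:{0..t}|lborel. prod (LINT s:{r..t}|lborel. b s) (w r))"
proof -
  interpret bounded_bilinear prod by (rule prod)
  define B where "B s = indicator {0..t} s *\<^sub>R b s" for s
  define V where "V s = indicator {0..t} s *\<^sub>R w s" for s
  have B: "integrable lborel B" and V: "integrable lborel V"
    using b w by (auto simp: set_integrable_def B_def[abs_def] V_def[abs_def])
  have Bm [measurable]: "B \<in> borel_measurable borel" and Vm [measurable]: "V \<in> borel_measurable borel"
    using borel_measurable_integrable[OF B] borel_measurable_integrable[OF V] by auto
  \<comment> \<open>Since \<open>B\<close> and \<open>V\<close> vanish outside [0,t], the condition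
    \<open>r \<le> s\<close> alone cuts out the triangle; the integrand is dominated by a multiple
    of the product of two integrable norms.\<close>
  define \<phi> where "\<phi> s r = (if r \<le> s then prod (B s) (V r) else 0)" for s r
  have prodm: "(\<lambda>x. prod (B (fst x)) (V (snd x))) \<in> borel_measurable (lborel \<Otimes>\<^sub>M lborel)"
    by (rule borel_measurable_continuous_Pair)
       (auto intro!: continuous_on continuous_intros)
  have \<phi>m: "case_prod \<phi> \<in> borel_measurable (lborel \<Otimes>\<^sub>M lborel)"
    unfolding \<phi>_def case_prod_unfold using prodm by measurable
  have majorant: "integrable (lborel \<Otimes>\<^sub>M lborel) (\<lambda>x. norm (B (fst x)) * norm (V (snd x)))"
  proof (rule lborel_pair.Fubini_integrable)
    show "integrable lborel (\<lambda>x. \<integral>y. norm (norm (B (fst (x, y))) * norm (V (snd (x, y)))) \<partial>lborel)"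
      using B V by (simp add: abs_mult)
    show "AE x in lborel. integrable lborel (\<lambda>y. norm (B (fst (x, y))) * norm (V (snd (x, y))))"
      using V by simp
  qed measurable
  obtain k where k: "\<And>x y. norm (prod x y) \<le> norm x * norm y * k" using bounded by blast
  have int: "integrable (lborel \<Otimes>\<^sub>M lborel) (case_prod \<phi>)"
  proof (rule Bochner_Integration.integrable_bound[OF integrable_mult_right[OF majorant, of "\<bar>k\<bar>"] \<phi>m])
    have "norm (\<phi> s r) \<le> \<bar>k\<bar> * (norm (B s) * norm (V r))" for s r
    proof -
      have "norm (\<phi> s r) \<le> norm (prod (B s) (V r))" by (simp add: \<phi>_def)
      also have "\<dots> \<le> norm (B s) * norm (V r) * k" by (rule k)
      also have "\<dots> \<le> norm (B s) * norm (V r) * \<bar>k\<bar>" by (intro mult_left_mono) auto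
      finally show ?thesis by (simp add: mult_ac)
    qed
    then show "AE x in lborel \<Otimes>\<^sub>M lborel. norm (case_prod \<phi> x)
        \<le> norm (\<bar>k\<bar> * (norm (B (fst x)) * norm (V (snd x))))"
      by (auto simp: case_prod_unfold)
  qed
  have "(LINT s:{0..t}|lborel. prod (b s) (LINT r:{0..s}|lborel. w r)) = (\<integral>s. \<integral>r. \<phi> s r \<partial>lborel \<partial>lborel)"
    unfolding set_lebesgue_integral_def
  proof (intro Bochner_Integration.integral_cong refl)
    fix s
    have "integrable lborel (\<lambda>r. indicator {..s} r *\<^sub>R V r)"
      using V by (intro integrable_mult_indicator) auto
    then have "prod (B s) (\<integral>r. indicator {..s} r *\<^sub>R V r \<partial>lborel) = (\<integral>r. prod (B s) (indicator {..s} r *\<^sub>R V r) \<partial>lborel)"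
      by (rule integral_bounded_linear[OF bounded_linear_right, symmetric])
    also have "\<dots> = (\<integral>r. \<phi> s r \<partial>lborel)"
      by (intro Bochner_Integration.integral_cong refl) (auto simp: \<phi>_def indicator_def zero_right)
    also have "prod (B s) (\<integral>r. indicator {..s} r *\<^sub>R V r \<partial>lborel)
        = indicator {0..t} s *\<^sub>R prod (b s) (\<integral>r. indicator {0..s} r *\<^sub>R w r \<partial>lborel)"
    proof (cases "s \<in> {0..t}")
      case True
      then have "indicator {..s} r *\<^sub>R V r = indicator {0..s} r *\<^sub>R w r" for r
        by (auto simp: V_def indicator_def)
      then show ?thesis using True by (simp add: B_def)
    next
      case False
      then show ?thesis by (simp add: B_def zero_left)
    qed
    finally show "indicator {0..t} s *\<^sub>R prod (b s) (\<integral>r. indicator {0..s} r *\<^sub>R w r \<partial>lborel) = (\<integral>r. \<phi> s r \<partial>lborel)" .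
  qed
  also have "\<dots> = (\<integral>r. \<integral>s. \<phi> s r \<partial>lborel \<partial>lborel)"
    using lborel_pair.Fubini_integral[OF int] by simp
  also have "\<dots> = (LINT r:{0..t}|lborel. prod (LINT s:{r..t}|lborel. b s) (w r))"
    unfolding set_lebesgue_integral_def
  proof (intro Bochner_Integration.integral_cong refl)
    fix r
    have "integrable lborel (\<lambda>s. indicator {r..} s *\<^sub>R B s)"
      using B by (intro integrable_mult_indicator) auto
    then have "prod (\<integral>s. indicator {r..} s *\<^sub>R B s \<partial>lborel) (V r) = (\<integral>s. prod (indicator {r..} s *\<^sub>R B s) (V r) \<partial>lborel)"
      by (rule integral_bounded_linear[OF bounded_linear_left, symmetric])
    also have "\<dots> = (\<integral>s. \<phi> s r \<partial>lborel)"
      by (intro Bochner_Integration.integral_cong refl) (auto simp: \<phi>_def indicator_def zero_left)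
    also have "prod (\<integral>s. indicator {r..} s *\<^sub>R B s \<partial>lborel) (V r)
        = indicator {0..t} r *\<^sub>R prod (\<integral>s. indicator {r..t} s *\<^sub>R b s \<partial>lborel) (w r)"
    proof (cases "r \<in> {0..t}")
      case True
      then have "indicator {r..} s *\<^sub>R B s = indicator {r..t} s *\<^sub>R b s" for s
        by (auto simp: B_def indicator_def)
      then show ?thesis using True by (simp add: V_def)
    next
      case False
      then show ?thesis by (simp add: V_def zero_right)
    qed
    finally show "(\<integral>s. \<phi> s r \<partial>lborel) = indicator {0..t} r *\<^sub>R prod (\<integral>s. indicator {r..t} s *\<^sub>R b s \<partial>lborel) (w r)"
      by simp
  qed
  finally show ?thesis .
qed

lemma set_integrable_matrix_vector_mult:
  fixes f :: "real \<Rightarrow> real^'n" and G :: "real \<Rightarrow> real^'n^'m"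
  assumes G: "continuous_on {a..b} G" and f: "set_integrable lborel {a..b} f"
  shows "set_integrable lborel {a..b} (\<lambda>s. G s *v f s)"
proof -
  interpret bounded_bilinear "(*v) :: real^'n^'m \<Rightarrow> real^'n \<Rightarrow> real^'m"
    by (rule bounded_bilinear_matrix_vector_mult)
  obtain c where c: "c > 0" "\<And>t x. t \<in> {a..b} \<Longrightarrow> norm (G t *v x) \<le> c * norm x"
    using matrix_vector_mult_bounded_on[OF G] by metis
  define g where "g s = indicator {a..b} s *\<^sub>R f s" for s
  have g: "integrable lborel g" using f by (simp add: set_integrable_def g_def[abs_def])
  have Gm: "(\<lambda>s. indicator {a..b} s *\<^sub>R G s) \<in> borel_measurable lborel"
    using borel_measurable_continuous_on_indicator[OF _ G] by simp
  have eq: "indicator {a..b} s *\<^sub>R (G s *v f s) = (indicator {a..b} s *\<^sub>R G s) *v g s" for s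
    by (simp add: g_def indicator_def zero_left zero_right)
  show ?thesis
    unfolding set_integrable_def eq
  proof (rule Bochner_Integration.integrable_bound[OF integrable_mult_right[OF integrable_norm[OF g], of c]])
    show "(\<lambda>s. (indicator {a..b} s *\<^sub>R G s) *v g s) \<in> borel_measurable lborel"
      by (rule borel_measurable_continuous_Pair[OF Gm borel_measurable_integrable[OF g]])
         (auto intro!: continuous_on continuous_intros)
    show "AE s in lborel. norm ((indicator {a..b} s *\<^sub>R G s) *v g s) \<le> norm (c * norm (g s))"
      using c by (auto simp: abs_mult indicator_def zero_left)
  qed
qed

lemma set_integral_matrix_vector_mult:
  fixes f :: "real \<Rightarrow> real^'n" and G :: "real^'n^'m"
  assumes "set_integrable lborel A f"
  shows "(LINT s:A|lborel. G *v f s) = G *v (LINT s:A|lborel. f s)"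
  using integral_bounded_linear[OF bounded_bilinear.bounded_linear_right[OF bounded_bilinear_matrix_vector_mult, of G]
    assms[unfolded set_integrable_def]]
  by (simp add: set_lebesgue_integral_def matrix_vector_mult_scaleR)

lemma set_integrable_continuous_Icc:
  fixes f :: "real \<Rightarrow> 'a::euclidean_space"
  assumes "continuous_on {a..b} f"
  shows "set_integrable lborel {a..b} f"
  using borel_integrable_atLeastAtMost'[OF assms] .

text \<open>Variation of constants. As \<open>g\<close> is merely integrable, \<open>E\<close> is
  not differentiated: only \<open>\<Psi>\<close> is, through the fundamental theorem of calculus,
  after an exchange of the order of integration.\<close>

lemma linear_volterra_solution:
  fixes a :: "real \<Rightarrow> real^'d^'d" and g :: "real \<Rightarrow> real^'d"
  assumes a: "continuous_on {0..T} a" and \<Psi>: "continuous_on {0..T} \<Psi>" and \<Theta>: "continuous_on {0..T} \<Theta>"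
    and inv: "\<And>t. t \<in> {0..T} \<Longrightarrow> \<Psi> t ** \<Theta> t = mat 1"
    and deriv: "\<And>t. t \<in> {0..T} \<Longrightarrow> (\<Psi> has_vector_derivative a t ** \<Psi> t) (at t within {0..T})"
    and g: "set_integrable lborel {0..T} g"
    and E: "\<And>t. t \<in> {0..T} \<Longrightarrow> E t = \<Psi> t *v (LINT s:{0..t}|lborel. \<Theta> s *v g s)"
    and t: "t \<in> {0..T}"
  shows "set_integrable lborel {0..t} (\<lambda>s. a s *v E s)"
    and "E t = (LINT s:{0..t}|lborel. a s *v E s + g s)"
proof -
  interpret bounded_bilinear "(*v) :: real^'d^'d \<Rightarrow> real^'d \<Rightarrow> real^'d"
    by (rule bounded_bilinear_matrix_vector_mult)
  have sub: "{0..t} \<subseteq> {0..T}" "\<And>r. r \<in> {0..t} \<Longrightarrow> {r..t} \<subseteq> {0..T}" using t by auto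
  have \<Theta>g: "set_integrable lborel {0..T} (\<lambda>s. \<Theta> s *v g s)"
    by (rule set_integrable_matrix_vector_mult[OF \<Theta> g])
  then have \<Theta>gt: "set_integrable lborel {0..t} (\<lambda>s. \<Theta> s *v g s)"
    using sub by (intro set_integrable_subset[OF \<Theta>g]) auto
  have cont: "continuous_on {0..t} (\<lambda>s. LINT r:{0..s}|lborel. \<Theta> r *v g r)"
  proof -
    have "continuous_on {0..t} (\<lambda>s. integral {0..s} (\<lambda>r. \<Theta> r *v g r))"
      using set_borel_integral_eq_integral(1)[OF \<Theta>gt] by (rule indefinite_integral_continuous_1)
    moreover have "integral {0..s} (\<lambda>r. \<Theta> r *v g r) = (LINT r:{0..s}|lborel. \<Theta> r *v g r)" if "s \<in> {0..t}" for s
      using that by (intro set_borel_integral_eq_integral(2)[symmetric] set_integrable_subset[OF \<Theta>gt]) auto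
    ultimately show ?thesis by (rule continuous_on_eq)
  qed
  have E_cont: "continuous_on {0..t} E"
  proof -
    have "continuous_on {0..t} (\<lambda>s. \<Psi> s *v (LINT r:{0..s}|lborel. \<Theta> r *v g r))"
      by (intro continuous_intros cont continuous_on_subset[OF \<Psi> sub(1)])
    then show ?thesis by (rule continuous_on_eq) (use E sub in auto)
  qed
  have a_t: "continuous_on {0..t} a" using a sub continuous_on_subset by blast
  show aE: "set_integrable lborel {0..t} (\<lambda>s. a s *v E s)"
    by (intro set_integrable_continuous_Icc continuous_intros a_t E_cont)
  have gt: "set_integrable lborel {0..t} g" using sub by (intro set_integrable_subset[OF g]) auto
  have a\<Psi>: "continuous_on {0..t} (\<lambda>s. a s ** \<Psi> s)"
    by (intro continuous_intros a_t continuous_on_subset[OF \<Psi> sub(1)])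
  have a\<Psi>_int: "(LINT s:{r..t}|lborel. a s ** \<Psi> s) = \<Psi> t - \<Psi> r" if r: "r \<in> {0..t}" for r
  proof -
    have "set_integrable lborel {r..t} (\<lambda>s. a s ** \<Psi> s)"
      using r by (intro set_integrable_continuous_Icc continuous_on_subset[OF a\<Psi>]) auto
    then have "(LINT s:{r..t}|lborel. a s ** \<Psi> s) = integral {r..t} (\<lambda>s. a s ** \<Psi> s)"
      by (rule set_borel_integral_eq_integral)
    also have "\<dots> = \<Psi> t - \<Psi> r"
      using r t by (intro integral_unique fundamental_theorem_of_calculus has_vector_derivative_within_subset[OF deriv]) auto
    finally show ?thesis .
  qed
  have "(LINT s:{0..t}|lborel. a s *v E s) = (LINT s:{0..t}|lborel. (a s ** \<Psi> s) *v (LINT r:{0..s}|lborel. \<Theta> r *v g r))"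
    using E sub by (intro set_lebesgue_integral_cong) (auto simp: matrix_vector_mul_assoc[symmetric])
  also have "\<dots> = (LINT r:{0..t}|lborel. (LINT s:{r..t}|lborel. a s ** \<Psi> s) *v (\<Theta> r *v g r))"
    by (rule set_integral_fubini_triangle[OF bounded_bilinear_matrix_vector_mult set_integrable_continuous_Icc[OF a\<Psi>] \<Theta>gt])
  \<comment> \<open>The inner integral is \<open>\<Psi> t - \<Psi> r\<close>, and
    \<open>\<Psi> r ** \<Theta> r = mat 1\<close> collapses the second part to
    \<open>g r\<close>.\<close>
  also have "\<dots> = (LINT r:{0..t}|lborel. \<Psi> t *v (\<Theta> r *v g r) - g r)"
  proof (intro set_lebesgue_integral_cong ballI allI impI)
    fix r assume r: "r \<in> {0..t}"
    then have "\<Psi> r *v (\<Theta> r *v g r) = g r" using inv[of r] sub(1) by (auto simp: matrix_vector_mul_assoc)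
    then show "(LINT s:{r..t}|lborel. a s ** \<Psi> s) *v (\<Theta> r *v g r) = \<Psi> t *v (\<Theta> r *v g r) - g r"
      by (simp only: a\<Psi>_int[OF r] matrix_vector_mult_diff_rdistrib)
  qed simp
  also have "\<dots> = (LINT r:{0..t}|lborel. \<Psi> t *v (\<Theta> r *v g r)) - (LINT r:{0..t}|lborel. g r)"
    by (intro set_integral_diff gt set_integrable_matrix_vector_mult continuous_intros \<Theta>gt)
  also have "(LINT r:{0..t}|lborel. \<Psi> t *v (\<Theta> r *v g r)) = E t"
    using E[OF t] by (simp add: set_integral_matrix_vector_mult[OF \<Theta>gt])
  finally show "E t = (LINT s:{0..t}|lborel. a s *v E s + g s)"
    using set_integral_add(2)[OF aE gt] by simp
qed

text \<open>Gronwall's lemma by iteration. A bound \<open>d * exp (2 * M * s)\<close> inserted into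
  the equation comes back with \<open>d / 2\<close>, because integrating the weight divides by
  \<open>2 * M\<close> while the coefficient contributes only \<open>M\<close>.\<close>

lemma linear_volterra_zero:
  fixes a :: "real \<Rightarrow> real^'d^'d" and e :: "real \<Rightarrow> real^'d"
  assumes a: "continuous_on {0..T} a" and int: "set_integrable lborel {0..T} (\<lambda>s. a s *v e s)"
    and e: "\<And>t. t \<in> {0..T} \<Longrightarrow> e t = (LINT s:{0..t}|lborel. a s *v e s)"
    and t: "t \<in> {0..T}"
  shows "e t = 0"
proof -
  obtain M where M: "M > 0" and bnd: "\<And>s x. s \<in> {0..T} \<Longrightarrow> norm (a s *v x) \<le> M * norm x"
    using matrix_vector_mult_bounded_on[OF a] by metis
  \<comment> \<open>By the equation itself this number bounds \<open>e\<close> uniformly, which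
    starts the iteration.\<close>
  define c0 where "c0 = (LINT s:{0..T}|lborel. norm (a s *v e s))"
  have norm_int: "set_integrable lborel {0..T} (\<lambda>s. norm (a s *v e s))"
    using integrable_norm[OF int[unfolded set_integrable_def]] by (simp add: set_integrable_def)
  have le: "norm (e t) \<le> (LINT s:{0..t}|lborel. norm (a s *v e s))" if "t \<in> {0..T}" for t
  proof -
    have "set_integrable lborel {0..t} (\<lambda>s. a s *v e s)" using that by (intro set_integrable_subset[OF int]) auto
    then show ?thesis using e[OF that] integral_norm_bound[of lborel "\<lambda>s. indicator {0..t} s *\<^sub>R (a s *v e s)"]
      by (simp add: set_lebesgue_integral_def)
  qed
  have le0: "norm (e t) \<le> c0" if "t \<in> {0..T}" for t
  proof -
    have "(LINT s:{0..t}|lborel. norm (a s *v e s)) \<le> c0"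
      unfolding c0_def set_lebesgue_integral_def
      using that norm_int set_integrable_subset[OF norm_int, of "{0..t}"]
      by (intro integral_mono) (auto simp: set_integrable_def indicator_def)
    then show ?thesis using le[OF that] by simp
  qed
  then have c0: "0 \<le> c0" using t norm_ge_zero order_trans by blast
  have iter: "norm (e t) \<le> c0 / 2 ^ n * exp (2 * M * t)" if "t \<in> {0..T}" for n t
    using that
  proof (induction n arbitrary: t)
    case 0
    have "c0 * 1 \<le> c0 * exp (2 * M * t)" using c0 M 0 by (intro mult_left_mono) auto
    then show ?case using le0[OF 0] by simp
  next
    case (Suc n)
    define d where "d = c0 / 2 ^ n"
    have d: "0 \<le> d" using c0 by (simp add: d_def)
    have cont: "continuous_on {0..t} (\<lambda>s. M * (d * exp (2 * M * s)))" by (intro continuous_intros)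
    have exp_int: "((\<lambda>s. M * (d * exp (2 * M * s))) has_integral (d / 2 * exp (2 * M * t) - d / 2 * exp (2 * M * 0))) {0..t}"
      using Suc.prems M by (intro fundamental_theorem_of_calculus)
        (auto intro!: derivative_eq_intros simp: has_real_derivative_iff_has_vector_derivative[symmetric])
    have "(LINT s:{0..t}|lborel. M * (d * exp (2 * M * s))) = integral {0..t} (\<lambda>s. M * (d * exp (2 * M * s)))"
      by (rule set_borel_integral_eq_integral(2)[OF set_integrable_continuous_Icc[OF cont]])
    also have "\<dots> = d / 2 * exp (2 * M * t) - d / 2 * exp (2 * M * 0)"
      by (rule integral_unique[OF exp_int])
    also have "\<dots> \<le> d / 2 * exp (2 * M * t)" using d by simp
    finally have int_exp: "(LINT s:{0..t}|lborel. M * (d * exp (2 * M * s))) \<le> d / 2 * exp (2 * M * t)" .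
    have "norm (e t) \<le> (LINT s:{0..t}|lborel. norm (a s *v e s))" by (rule le[OF Suc.prems])
    also have "\<dots> \<le> (LINT s:{0..t}|lborel. M * (d * exp (2 * M * s)))"
    proof (rule set_integral_mono)
      show "set_integrable lborel {0..t} (\<lambda>s. norm (a s *v e s))"
        using Suc.prems by (intro set_integrable_subset[OF norm_int]) auto
      show "set_integrable lborel {0..t} (\<lambda>s. M * (d * exp (2 * M * s)))"
        by (rule set_integrable_continuous_Icc[OF cont])
      fix s assume "s \<in> {0..t}"
      then have s: "s \<in> {0..T}" using Suc.prems by auto
      have "M * norm (e s) \<le> M * (d * exp (2 * M * s))"
        using Suc.IH[OF s] M by (intro mult_left_mono) (auto simp: d_def)
      then show "norm (a s *v e s) \<le> M * (d * exp (2 * M * s))" using bnd[OF s, of "e s"] by simp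
    qed
    also have "\<dots> \<le> d / 2 * exp (2 * M * t)" by (rule int_exp)
    finally show ?case by (simp add: d_def)
  qed
  have "(\<lambda>n. c0 * exp (2 * M * t) * (1 / 2) ^ n) \<longlonglongrightarrow> c0 * exp (2 * M * t) * 0"
    by (intro tendsto_intros LIMSEQ_power_zero) auto
  moreover have "norm (e t) \<le> c0 * exp (2 * M * t) * (1 / 2) ^ n" for n
    using iter[OF t, of n] by (simp add: power_divide)
  ultimately have "norm (e t) \<le> c0 * exp (2 * M * t) * 0"
    by (intro LIMSEQ_le_const) auto
  then show ?thesis by simp
qed

section \<open>Square-integrable functions and the filtration\<close>

lemma L2_space_iff: "f \<in> L2_space M G \<longleftrightarrow> f \<in> borel_measurable G \<and> integrable M (\<lambda>x. (norm (f x))\<^sup>2)"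
  by (simp add: L2_space_def)

lemma L2_spaceI_bound:
  fixes f :: "'a \<Rightarrow> 'v::euclidean_space"
  assumes "f \<in> borel_measurable M" "integrable M g" "AE x in M. (norm (f x))\<^sup>2 \<le> g x"
  shows "f \<in> L2_space M M"
  unfolding L2_space_iff using assms
  by (auto intro!: Bochner_Integration.integrable_bound[OF assms(2)])

lemma L2_space_iff_nn_integral:
  fixes f :: "'a \<Rightarrow> 'v::euclidean_space"
  assumes [measurable]: "f \<in> borel_measurable M"
  shows "f \<in> L2_space M M \<longleftrightarrow> (\<integral>\<^sup>+x. ennreal ((norm (f x))\<^sup>2) \<partial>M) < \<infinity>"
  unfolding L2_space_iff integrable_iff_bounded using assms by simp

lemma norm_add_sq_le: "(norm (x + y))\<^sup>2 \<le> 2 * (norm x)\<^sup>2 + 2 * (norm (y::'v::real_normed_vector))\<^sup>2"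
proof -
  have "(norm (x + y))\<^sup>2 \<le> (norm x + norm y)\<^sup>2" by (intro power_mono norm_triangle_ineq) auto
  also have "\<dots> \<le> 2 * (norm x)\<^sup>2 + 2 * (norm y)\<^sup>2"
    using zero_le_power2[of "norm x - norm y"] by (simp add: power2_eq_square algebra_simps)
  finally show ?thesis .
qed

lemma ennreal_norm_add_sq_le:
  "ennreal ((norm (x + y))\<^sup>2) \<le> 2 * ennreal ((norm x)\<^sup>2) + 2 * ennreal ((norm (y::'v::real_normed_vector))\<^sup>2)"
proof -
  have "ennreal ((norm (x + y))\<^sup>2) \<le> ennreal (2 * (norm x)\<^sup>2 + 2 * (norm y)\<^sup>2)"
    by (intro ennreal_leI norm_add_sq_le)
  then show ?thesis by (simp add: ennreal_plus ennreal_mult)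
qed

lemma L2_space_add:
  fixes f g :: "'a \<Rightarrow> 'v::euclidean_space"
  assumes "f \<in> L2_space M M" "g \<in> L2_space M M"
  shows "(\<lambda>x. f x + g x) \<in> L2_space M M"
  using assms unfolding L2_space_iff[of f] L2_space_iff[of g]
  by (intro L2_spaceI_bound[where g = "\<lambda>x. 2 * (norm (f x))\<^sup>2 + 2 * (norm (g x))\<^sup>2"])
     (auto simp: norm_add_sq_le)

lemma L2_space_uminus:
  fixes f :: "'a \<Rightarrow> 'v::euclidean_space"
  shows "f \<in> L2_space M M \<Longrightarrow> (\<lambda>x. - f x) \<in> L2_space M M"
  unfolding L2_space_iff by auto

lemma L2_space_diff:
  fixes f g :: "'a \<Rightarrow> 'v::euclidean_space"
  assumes "f \<in> L2_space M M" "g \<in> L2_space M M"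
  shows "(\<lambda>x. f x - g x) \<in> L2_space M M"
  using L2_space_add[OF assms(1) L2_space_uminus[OF assms(2)]] by simp

lemma L2_space_scaleR_bounded:
  fixes f :: "'a \<Rightarrow> 'v::euclidean_space" and h :: "'a \<Rightarrow> real"
  assumes "f \<in> L2_space M M" and h [measurable]: "h \<in> borel_measurable M"
    and "\<And>x. x \<in> space M \<Longrightarrow> \<bar>h x\<bar> \<le> c"
  shows "(\<lambda>x. h x *\<^sub>R f x) \<in> L2_space M M"
proof (rule L2_spaceI_bound[where g = "\<lambda>x. c\<^sup>2 * (norm (f x))\<^sup>2"])
  have [measurable]: "f \<in> borel_measurable M" using assms by (simp add: L2_space_iff)
  show "(\<lambda>x. h x *\<^sub>R f x) \<in> borel_measurable M" by measurable
  show "integrable M (\<lambda>x. c\<^sup>2 * (norm (f x))\<^sup>2)" using assms by (simp add: L2_space_iff)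
  show "AE x in M. (norm (h x *\<^sub>R f x))\<^sup>2 \<le> c\<^sup>2 * (norm (f x))\<^sup>2"
    using assms(3) by (auto simp: power_mult_distrib power2_le_iff_abs_le intro!: mult_right_mono AE_I2)
      (metis abs_ge_zero order_trans abs_le_square_iff abs_of_nonneg)
qed

lemma L2_space_matrix_vector_mult:
  fixes G :: "real^'n^'m"
  assumes "f \<in> L2_space M M"
  shows "(\<lambda>x. G *v f x) \<in> L2_space M M"
proof -
  have bnd: "norm (G *v y) \<le> onorm ((*v) G) * norm y" for y
    by (rule onorm) (rule matrix_vector_mul_bounded_linear)
  show ?thesis
  proof (rule L2_spaceI_bound[where g = "\<lambda>x. (onorm ((*v) G))\<^sup>2 * (norm (f x))\<^sup>2"])
    have "((*v) G) \<in> borel_measurable borel"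
      by (intro borel_measurable_continuous_onI matrix_vector_mult_linear_continuous_on)
    then show "(\<lambda>x. G *v f x) \<in> borel_measurable M"
      using assms measurable_compose[of f M borel "(*v) G"] by (simp add: L2_space_iff)
    show "integrable M (\<lambda>x. (onorm ((*v) G))\<^sup>2 * (norm (f x))\<^sup>2)" using assms by (simp add: L2_space_iff)
    have "(norm (G *v f x))\<^sup>2 \<le> (onorm ((*v) G) * norm (f x))\<^sup>2" for x
      by (intro power_mono bnd) auto
    then show "AE x in M. (norm (G *v f x))\<^sup>2 \<le> (onorm ((*v) G))\<^sup>2 * (norm (f x))\<^sup>2"
      by (auto simp: power_mult_distrib)
  qed
qed

lemma L2_space_inner_integrable:
  fixes f g :: "'a \<Rightarrow> 'v::euclidean_space"
  assumes "f \<in> L2_space M M" "g \<in> L2_space M M"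
  shows "integrable M (\<lambda>x. f x \<bullet> g x)"
proof (rule Bochner_Integration.integrable_bound[where f = "\<lambda>x. (norm (f x))\<^sup>2 + (norm (g x))\<^sup>2"])
  have [measurable]: "f \<in> borel_measurable M" "g \<in> borel_measurable M"
    using assms by (auto simp: L2_space_iff)
  show "(\<lambda>x. f x \<bullet> g x) \<in> borel_measurable M" by measurable
  show "integrable M (\<lambda>x. (norm (f x))\<^sup>2 + (norm (g x))\<^sup>2)"
    using assms by (auto simp: L2_space_iff)
  have "\<bar>f x \<bullet> g x\<bar> \<le> (norm (f x))\<^sup>2 + (norm (g x))\<^sup>2" for x
  proof -
    have "\<bar>f x \<bullet> g x\<bar> \<le> norm (f x) * norm (g x)" by (rule Cauchy_Schwarz_ineq2)
    also have "\<dots> \<le> (norm (f x))\<^sup>2 + (norm (g x))\<^sup>2"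
      using zero_le_power2[of "norm (f x) - norm (g x)"]
      by (simp add: power2_eq_square algebra_simps) (smt (verit) mult_nonneg_nonneg norm_ge_zero)
    finally show ?thesis .
  qed
  then show "AE x in M. norm (f x \<bullet> g x) \<le> norm ((norm (f x))\<^sup>2 + (norm (g x))\<^sup>2)"
    by (intro AE_I2) auto
qed

lemma L2_space_mult_integrable:
  fixes f g :: "'a \<Rightarrow> real"
  assumes "f \<in> L2_space M M" "g \<in> L2_space M M"
  shows "integrable M (\<lambda>x. f x * g x)"
  using L2_space_inner_integrable[OF assms] by simp

lemma (in finite_measure) L2_space_const: "(\<lambda>\<omega>. c :: 'v::euclidean_space) \<in> L2_space M M"
  by (simp add: L2_space_iff)

lemma (in finite_measure) L2_space_integrable:
  fixes f :: "'a \<Rightarrow> 'v::euclidean_space"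
  assumes "f \<in> L2_space M M"
  shows "integrable M f"
proof -
  have [measurable]: "f \<in> borel_measurable M" using assms by (auto simp: L2_space_iff)
  have "(\<lambda>x. norm (f x)) \<in> L2_space M M" "(\<lambda>x. 1::real) \<in> L2_space M M"
    using assms by (auto simp: L2_space_iff)
  then have "integrable M (\<lambda>x. norm (f x))" using L2_space_mult_integrable by fastforce
  then show ?thesis by (rule integrable_norm_cancel) measurable
qed

text \<open>The squared norm of \<open>r *\<^sub>R f + g\<close> is a nonnegative polynomial of
  degree at most two in \<open>r\<close>; for \<open>A \<noteq> 0\<close> it is evaluated at its
  minimiser \<open>- C / A\<close>.\<close>

lemma L2_space_cauchy_schwarz:
  fixes f g :: "'a \<Rightarrow> 'v::euclidean_space"
  assumes f: "f \<in> L2_space M M" and g: "g \<in> L2_space M M"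
  shows "\<bar>\<integral>x. f x \<bullet> g x \<partial>M\<bar> \<le> sqrt (\<integral>x. (norm (f x))\<^sup>2 \<partial>M) * sqrt (\<integral>x. (norm (g x))\<^sup>2 \<partial>M)"
proof -
  define A where "A = (\<integral>x. (norm (f x))\<^sup>2 \<partial>M)"
  define B where "B = (\<integral>x. (norm (g x))\<^sup>2 \<partial>M)"
  define C where "C = (\<integral>x. f x \<bullet> g x \<partial>M)"
  have A: "A \<ge> 0" and B: "B \<ge> 0" unfolding A_def B_def by simp_all
  have q: "0 \<le> r\<^sup>2 * A + 2 * r * C + B" for r
  proof -
    have "0 \<le> (\<integral>x. (norm (r *\<^sub>R f x + g x))\<^sup>2 \<partial>M)" by simp
    also have "\<dots> = (\<integral>x. r\<^sup>2 * (norm (f x))\<^sup>2 + 2 * r * (f x \<bullet> g x) + (norm (g x))\<^sup>2 \<partial>M)"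
      by (intro Bochner_Integration.integral_cong refl)
         (simp only: power2_norm_eq_inner, simp add: inner_simps inner_commute power2_eq_square[of r] algebra_simps)
    also have "\<dots> = r\<^sup>2 * A + 2 * r * C + B"
      using f g L2_space_inner_integrable[OF f g] by (simp add: A_def B_def C_def L2_space_iff)
    finally show ?thesis .
  qed
  have "C\<^sup>2 \<le> A * B"
  proof (cases "A = 0")
    case True
    have "C = 0"
    proof (rule ccontr)
      assume "C \<noteq> 0"
      \<comment> \<open>With \<open>A = 0\<close> the polynomial is affine in \<open>r\<close>, and
        at this point its value is -1.\<close>
      then show False using q[of "- (B + 1) / (2 * C)"] True B by (simp add: field_simps)
    qed
    then show ?thesis using True by simp
  next
    case False
    then show ?thesis using q[of "- C / A"] A by (simp add: power2_eq_square field_simps)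
  qed
  then have "\<bar>C\<bar> \<le> sqrt (A * B)" using real_le_rsqrt[of "\<bar>C\<bar>"] by simp
  then show ?thesis by (simp add: A_def B_def C_def real_sqrt_mult)
qed

text \<open>The hypothesis on indicators says that the conditional expectation of \<open>f\<close>
  given \<open>G\<close> is the constant \<open>c\<close>, so a \<open>G\<close>-measurable factor
  can be pulled out. Of \<open>\<psi>\<close> only integrability of the product is asked, which
  admits unbounded multipliers.\<close>

lemma (in finite_measure) integral_mult_eq_const:
  assumes G: "subalgebra M G" and f: "integrable M f" and fm: "integrable M (\<lambda>x. \<psi> x * f x)"
    and \<psi>: "\<psi> \<in> borel_measurable G"
    and eq: "\<And>A. A \<in> sets G \<Longrightarrow> (\<integral>x. indicator A x * f x \<partial>M) = c * measure M A"
  shows "(\<integral>x. \<psi> x * f x \<partial>M) = c * (\<integral>x. \<psi> x \<partial>M)"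
proof -
  interpret sigma_finite_subalgebra M G
    by (intro finite_measure_subalgebra_is_sigma_finite finite_measure_subalgebra.intro
        finite_measure_subalgebra_axioms.intro G finite_measure_axioms)
  have A_sets: "A \<in> sets M" if "A \<in> sets G" for A using that G by (auto simp: subalgebra_def)
  have "AE x in M. real_cond_exp M G f x = c"
  proof (rule real_cond_exp_charact)
    fix A assume "A \<in> sets G"
    then show "(\<integral>x\<in>A. f x \<partial>M) = (\<integral>x\<in>A. c \<partial>M)"
      using eq A_sets by (simp add: set_lebesgue_integral_def mult.commute)
  qed (use f in auto)
  then have "(\<integral>x. \<psi> x * real_cond_exp M G f x \<partial>M) = (\<integral>x. c * \<psi> x \<partial>M)"
    using measurable_from_subalg[OF G \<psi>] by (intro integral_cong_AE) auto
  then show ?thesis using real_cond_exp_intg(2)[OF fm \<psi>] f by simp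
qed

section \<open>Generated sigma-algebras and the augmented filtration\<close>

lemma generated_sigma_subset:
  assumes "\<And>i. i \<in> I \<Longrightarrow> X i \<in> borel_measurable P"
  shows "generated_sigma P X I \<subseteq> sets P"
  unfolding generated_sigma_def by (rule sets.sigma_sets_subset) (use assms in \<open>auto intro: measurable_sets\<close>)

lemma sigma_algebra_generated_sigma: "sigma_algebra (space P) (generated_sigma P X I)"
  unfolding generated_sigma_def by (rule sigma_algebra_sigma_sets) auto

lemma generated_sigma_mono: "I \<subseteq> J \<Longrightarrow> generated_sigma P X I \<subseteq> generated_sigma P X J"
  unfolding generated_sigma_def by (intro sigma_sets_mono') blast

locale stochastic_basis = prob_space P
  for P :: "'w measure" +
  fixes F :: "real \<Rightarrow> 'w measure" and F00 :: "'w set set" and W :: "real \<Rightarrow> 'w \<Rightarrow> real^'q"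
  assumes brownian: "brownian_motion P W"
    and F00: "sigma_algebra (space P) F00" "F00 \<subseteq> sets P"
    and F00_indep: "indep_set F00 (generated_sigma P W {0..})"
    and filtration: "\<And>t. 0 \<le> t \<Longrightarrow> F t = usual_augmentation P (\<lambda>u. F00 \<union> generated_sigma P W {0..u}) t"
begin

lemma W_measurable [measurable]: "0 \<le> t \<Longrightarrow> W t \<in> borel_measurable P"
  using brownian by (auto simp: brownian_motion_def)

text \<open>The history up to time \<open>u\<close> with null sets adjoined, before the passage to
  the limit from the right: \<open>sets_F\<close> identifies \<open>F t\<close> with the
  intersection of all \<open>augmented u\<close> with \<open>u > t\<close>.\<close>

definition augmented where
  "augmented u = sigma_sets (space P) (F00 \<union> generated_sigma P W {0..u} \<union> null_sets P)"

lemma augmented_generators: "F00 \<union> generated_sigma P W {0..u} \<union> null_sets P \<subseteq> sets P"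
  using F00 generated_sigma_subset[of "{0..u}" W P] by auto

lemma augmented_sets: "augmented u \<subseteq> sets P"
  unfolding augmented_def by (rule sets.sigma_sets_subset[OF augmented_generators])

lemma sigma_algebra_augmented: "sigma_algebra (space P) (augmented u)"
  unfolding augmented_def using augmented_generators sets.space_closed by (intro sigma_algebra_sigma_sets) blast

lemma sets_F: assumes "0 \<le> t" shows "sets (F t) = (\<Inter>u\<in>{t<..}. augmented u)" and space_F: "space (F t) = space P"
proof -
  have alg: "sigma_algebra (space P) (\<Inter>u\<in>{t<..}. augmented u)"
  proof -
    have "(\<Inter>u\<in>{t<..}. augmented u) \<subseteq> Pow (space P)"
      using augmented_sets[of "t + 1"] sets.space_closed[of P] by force
    moreover have "{} \<in> augmented u" "A \<in> augmented u \<Longrightarrow> space P - A \<in> augmented u"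
      "range B \<subseteq> augmented u \<Longrightarrow> (\<Union>i::nat. B i) \<in> augmented u" for u A B
      using sigma_algebra_augmented[of u] by (auto simp: sigma_algebra_iff2)
    ultimately show ?thesis unfolding sigma_algebra_iff2 by (simp add: subset_iff)
  qed
  then have pow: "(\<Inter>u\<in>{t<..}. augmented u) \<subseteq> Pow (space P)"
    by (simp add: sigma_algebra_iff algebra_iff_Un)
  have "F t = sigma (space P) (\<Inter>u\<in>{t<..}. augmented u)"
    using assms by (simp add: filtration usual_augmentation_def augmented_def)
  then show "sets (F t) = (\<Inter>u\<in>{t<..}. augmented u)" "space (F t) = space P"
    using sets_measure_of[OF pow] sigma_algebra.sigma_sets_eq[OF alg] space_measure_of[OF pow] by auto
qed

lemma subalgebra_F: "0 \<le> t \<Longrightarrow> subalgebra P (F t)"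
  unfolding subalgebra_def using sets_F[of t] space_F[of t] augmented_sets[of "t + 1"] by force

lemma sets_F_mono: "0 \<le> s \<Longrightarrow> s \<le> t \<Longrightarrow> sets (F s) \<subseteq> sets (F t)"
  by (auto simp: sets_F)

lemma measurable_F_mono: "0 \<le> s \<Longrightarrow> s \<le> t \<Longrightarrow> f \<in> borel_measurable (F s) \<Longrightarrow> f \<in> borel_measurable (F t)"
  using sets_F_mono[of s t] space_F[of s] space_F[of t]
  by (auto simp: measurable_def)

lemma measurable_F_P: "0 \<le> s \<Longrightarrow> f \<in> borel_measurable (F s) \<Longrightarrow> f \<in> borel_measurable P"
  by (rule measurable_from_subalg[OF subalgebra_F])

lemma W_adapted: "0 \<le> t \<Longrightarrow> W t \<in> borel_measurable (F t)"
proof (rule measurableI)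
  fix U :: "(real^'q) set" assume t: "0 \<le> t" and U: "U \<in> sets borel"
  have "W t -` U \<inter> space P \<in> augmented u" if "t < u" for u
  proof -
    have "W t -` U \<inter> space P \<in> generated_sigma P W {0..u}"
      unfolding generated_sigma_def by (rule sigma_sets.Basic) (use t that U in force)
    then show ?thesis unfolding augmented_def by blast
  qed
  then show "W t -` U \<inter> space (F t) \<in> sets (F t)" using t by (auto simp: sets_F space_F)
qed simp

text \<open>The history has three sources: the initial sigma-algebra, the past of \<open>W\<close>
  and the null sets. The product formula is tested on a generator that is stable under intersection,
  and Dynkin's theorem extends it to the generated sigma-algebra.\<close>

lemma increment_indep_augmented:
  assumes uv: "0 \<le> u" "u < v"
  shows "indep_set (augmented u) (generated_sigma P (\<lambda>r \<omega>. W r \<omega> - W u \<omega>) {v})"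
proof -
  let ?I = "generated_sigma P (\<lambda>r \<omega>. W r \<omega> - W u \<omega>) {v}"
  let ?G = "generated_sigma P W {0..u}"
  have inc: "indep_set ?G ?I"
    using brownian uv by (auto simp: brownian_motion_def)
  have I_sets: "?I \<subseteq> sets P" and I_alg: "sigma_algebra (space P) ?I"
    using uv by (auto intro!: generated_sigma_subset sigma_algebra_generated_sigma)
  have G_sets: "?G \<subseteq> sets P" and G_alg: "sigma_algebra (space P) ?G"
    by (auto intro!: generated_sigma_subset sigma_algebra_generated_sigma)
  have G_W: "?G \<subseteq> generated_sigma P W {0..}" by (rule generated_sigma_mono) auto
  \<comment> \<open>\<open>F00_indep\<close> speaks of the sigma-algebra of the whole Brownian path,
    so events of the increment have to be exhibited as path events.\<close>
  have I_W: "?I \<subseteq> generated_sigma P W {0..}"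
  proof -
    let ?S = "sigma (space P) (generated_sigma P W {0..})"
    have "generated_sigma P W {0..} \<subseteq> Pow (space P)"
      using generated_sigma_subset[of "{0..}" W P] sets.space_closed[of P] by auto
    then have S: "sets ?S = generated_sigma P W {0..}" "space ?S = space P"
      using sigma_algebra.sigma_sets_eq[OF sigma_algebra_generated_sigma[of P W "{0..}"]] by auto
    have W_S: "W r \<in> borel_measurable ?S" if "0 \<le> r" for r
    proof (rule measurableI)
      fix U :: "(real^'q) set" assume "U \<in> sets borel"
      then have "W r -` U \<inter> space P \<in> generated_sigma P W {0..}"
        unfolding generated_sigma_def by (intro sigma_sets.Basic) (use that in force)
      then show "W r -` U \<inter> space ?S \<in> sets ?S" by (simp only: S)
    qed simp
    have "W u \<in> borel_measurable ?S" "W v \<in> borel_measurable ?S"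
      using W_S uv by auto
    then have "(\<lambda>\<omega>. W v \<omega> - W u \<omega>) \<in> borel_measurable ?S"
      by (rule borel_measurable_diff[rotated])
    then have "generated_sigma ?S (\<lambda>r \<omega>. W r \<omega> - W u \<omega>) {v} \<subseteq> sets ?S"
      by (intro generated_sigma_subset) auto
    then have "generated_sigma ?S (\<lambda>r \<omega>. W r \<omega> - W u \<omega>) {v} \<subseteq> generated_sigma P W {0..}"
      unfolding S(1) .
    then show ?thesis unfolding generated_sigma_def[of ?S] generated_sigma_def[of P "\<lambda>r \<omega>. W r \<omega> - W u \<omega>"] S(2) .
  qed
  \<comment> \<open>Intersections of an initial and a Brownian event are closed under intersection;
    the null sets can be added because intersecting with a null set gives a null set again.\<close>
  let ?E = "{a \<inter> b | a b. a \<in> F00 \<and> b \<in> ?G} \<union> null_sets P"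
  have E_sets: "?E \<subseteq> sets P" using F00 G_sets by auto
  have stable: "Int_stable ?E"
  proof (rule Int_stableI)
    fix x y assume x: "x \<in> ?E" and y: "y \<in> ?E"
    show "x \<inter> y \<in> ?E"
    proof (cases "x \<in> null_sets P \<or> y \<in> null_sets P")
      case True
      then have "x \<inter> y \<in> null_sets P"
      proof -
        have "x \<in> sets P" "y \<in> sets P" using x y subsetD[OF E_sets] by auto
        then show ?thesis using True null_set_Int1[of y P x] null_set_Int2[of x P y] by auto
      qed
      then show ?thesis by simp
    next
      case False
      then obtain a b a' b' where ab: "x = a \<inter> b" "y = a' \<inter> b'" "a \<in> F00" "b \<in> ?G" "a' \<in> F00" "b' \<in> ?G"
        using x y by auto
      have "a \<inter> a' \<in> F00" "b \<inter> b' \<in> ?G"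
        using ab F00(1) G_alg by (auto simp: sigma_algebra_iff algebra_iff_Int)
      moreover have "x \<inter> y = (a \<inter> a') \<inter> (b \<inter> b')" using ab by auto
      ultimately show ?thesis by blast
    qed
  qed
  have "indep_set ?E ?I"
  proof (rule indep_setI[OF E_sets I_sets])
    fix e c assume e: "e \<in> ?E" and c: "c \<in> ?I"
    show "prob (e \<inter> c) = prob e * prob c"
    proof (cases "e \<in> null_sets P")
      case True
      then have "e \<inter> c \<in> null_sets P" by (rule null_set_Int2) (use c I_sets in auto)
      then show ?thesis using True by (simp add: measure_eq_0_null_sets)
    next
      case False
      then obtain a b where ab: "e = a \<inter> b" "a \<in> F00" "b \<in> ?G" using e by auto
      have bc: "b \<inter> c \<in> generated_sigma P W {0..}"
      proof -
        have "b \<in> generated_sigma P W {0..}" "c \<in> generated_sigma P W {0..}"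
          using ab c G_W I_W by auto
        then show ?thesis
          using sigma_algebra_generated_sigma[of P W "{0..}"] unfolding sigma_algebra_iff algebra_iff_Int by blast
      qed
      have "prob (e \<inter> c) = prob (a \<inter> (b \<inter> c))" using ab by (simp add: Int_assoc)
      \<comment> \<open>The initial event splits off from the whole path before the past and the
        increment are separated.\<close>
      also have "\<dots> = prob a * prob (b \<inter> c)" by (rule indep_setD[OF F00_indep ab(2) bc])
      also have "\<dots> = prob a * (prob b * prob c)" using indep_setD[OF inc ab(3) c] by simp
      also have "\<dots> = prob e * prob c" using indep_setD[OF F00_indep ab(2)] ab(3) G_W ab(1) by auto
      finally show ?thesis .
    qed
  qed
  moreover have "Int_stable ?I"
    using I_alg by (auto simp: Int_stable_def sigma_algebra_iff algebra_iff_Int)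
  ultimately have *: "indep_set (sigma_sets (space P) ?E) (sigma_sets (space P) ?I)"
    using stable by (intro indep_set_sigma_sets)
  have "F00 \<union> ?G \<union> null_sets P \<subseteq> sigma_sets (space P) ?E"
  proof -
    have top: "space P \<in> F00" "space P \<in> ?G"
      using F00(1) G_alg algebra.top unfolding sigma_algebra_def by blast+
    have "x \<in> ?E" if x: "x \<in> F00 \<union> ?G \<union> null_sets P" for x
    proof -
      have "x = x \<inter> space P" "x = space P \<inter> x"
        using sets.sets_into_space[of x P] x F00(2) G_sets by auto
      with x top show ?thesis by blast
    qed
    then show ?thesis by auto
  qed
  then have "augmented u \<subseteq> sigma_sets (space P) ?E"
    unfolding augmented_def by (rule sigma_sets_mono)
  moreover have "?I \<subseteq> sigma_sets (space P) ?I" by blast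
  ultimately show ?thesis using * unfolding indep_sets2_eq by blast
qed

end

section \<open>Moments of Brownian increments\<close>

lemma borel_measurable_vec_nth [measurable]: "(\<lambda>x :: real^'n. x $ i) \<in> borel_measurable borel"
  by (intro borel_measurable_continuous_onI continuous_intros)

lemma approach_right:
  fixes s t :: real
  assumes "s < t"
  obtains u where "\<And>n. s < u n" "\<And>n. u n < t" "u \<longlonglongrightarrow> s"
proof
  show "s < s + (t - s) / 2 * inverse (real (Suc n))" for n
    using assms by simp
  have "(t - s) / 2 * inverse (real (Suc n)) \<le> (t - s) / 2 * 1" for n
    using assms by (intro mult_left_mono) (auto simp: field_simps)
  moreover have "(t - s) / 2 * 1 < t - s" using assms by simp
  ultimately have "(t - s) / 2 * inverse (real (Suc n)) < t - s" for n
    by (rule order.strict_trans1)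
  then show "s + (t - s) / 2 * inverse (real (Suc n)) < t" for n
    by (simp only: less_diff_eq add.commute)
  have "(\<lambda>n. s + (t - s) / 2 * inverse (real (Suc n))) \<longlonglongrightarrow> s + (t - s) / 2 * 0"
    by (intro tendsto_intros LIMSEQ_inverse_real_of_nat)
  then show "(\<lambda>n. s + (t - s) / 2 * inverse (real (Suc n))) \<longlonglongrightarrow> s" by simp
qed

context stochastic_basis
begin

definition dW where "dW b s t \<omega> = (W t \<omega> - W s \<omega>) $ b"

lemma dW_self [simp]: "dW b s s \<omega> = 0"
  by (simp add: dW_def)

lemma dW_add: "dW b s u \<omega> + dW b u t \<omega> = dW b s t \<omega>"
  by (simp add: dW_def)

lemma dW_measurable_F: assumes "0 \<le> s" "s \<le> t" shows "dW b s t \<in> borel_measurable (F t)"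
proof -
  have [measurable]: "W t \<in> borel_measurable (F t)" "W s \<in> borel_measurable (F t)"
    using assms W_adapted[of t] measurable_F_mono[OF _ _ W_adapted[of s]] by auto
  show ?thesis unfolding dW_def[abs_def] by measurable
qed

lemma dW_distributed:
  "0 \<le> s \<Longrightarrow> s < t \<Longrightarrow> distributed P lborel (dW b s t) (normal_density 0 (sqrt (t - s)))"
  using brownian unfolding brownian_motion_def dW_def[abs_def] by blast

lemma dW_L2: assumes "0 \<le> s" "s \<le> t" shows "dW b s t \<in> L2_space P P"
proof (cases "s = t")
  case True
  then show ?thesis by (simp add: L2_space_iff dW_def[abs_def])
next
  case False
  then have "distributed P lborel (dW b s t) (normal_density 0 (sqrt (t - s)))"
    using assms dW_distributed by auto
  from distributed_integrable[OF this, of "\<lambda>x. x\<^sup>2"] integrable_normal_moment[of "sqrt (t - s)" 0 2] False assms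
  have "integrable P (\<lambda>\<omega>. (dW b s t \<omega>)\<^sup>2)" by simp
  then show ?thesis
    using measurable_F_P[OF _ dW_measurable_F] assms by (auto simp: L2_space_iff)
qed

lemma dW_expectation: assumes "0 \<le> s" "s < t" shows "expectation (dW b s t) = 0"
  using normal_distributed_expectation[OF _ dW_distributed[OF assms]] assms by simp

lemma dW_second_moment: assumes "0 \<le> s" "s \<le> t" shows "expectation (\<lambda>\<omega>. (dW b s t \<omega>)\<^sup>2) = t - s"
proof (cases "s = t")
  case False
  then have st: "s < t" using assms by simp
  show ?thesis
    using normal_distributed_variance[OF _ dW_distributed[OF assms(1) st]] st
      normal_distributed_expectation[OF _ dW_distributed[OF assms(1) st]] by simp
qed simp

lemma dW_covariance:
  assumes "0 \<le> s" "s < t"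
  shows "expectation (\<lambda>\<omega>. dW a s t \<omega> * dW b s t \<omega>) = (if a = b then t - s else 0)"
proof (cases "a = b")
  case True
  then show ?thesis using dW_second_moment[of s t b] assms by (simp add: power2_eq_square)
next
  case False
  have "indep_vars (\<lambda>_. borel) (\<lambda>i. dW i s t) UNIV"
    using brownian assms unfolding brownian_motion_def dW_def[abs_def] by blast
  then have "indep_vars (\<lambda>_. borel) (\<lambda>i. dW i s t) {a, b}"
    by (rule indep_vars_subset) simp
  then have "(\<integral>\<omega>. (\<Prod>i\<in>{a, b}. dW i s t \<omega>) \<partial>P) = (\<Prod>i\<in>{a, b}. expectation (dW i s t))"
    using assms by (intro indep_vars_lebesgue_integral L2_space_integrable[OF dW_L2]) auto
  then show ?thesis using False assms by (simp add: dW_expectation)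
qed

text \<open>The indicator of \<open>A\<close> and a function of the increment generate
  sigma-algebras inside two independent ones, so the expectation factorises. The function
  \<open>g\<close> is later a coordinate or a product of two coordinates.\<close>

lemma integral_indicator_augmented:
  fixes g :: "real^'q \<Rightarrow> real"
  assumes A: "A \<in> augmented u" and uv: "0 \<le> u" "u < v" and g [measurable]: "g \<in> borel_measurable borel"
    and int: "integrable P (\<lambda>\<omega>. g (W v \<omega> - W u \<omega>))"
  shows "(\<integral>\<omega>. indicator A \<omega> * g (W v \<omega> - W u \<omega>) \<partial>P) = prob A * (\<integral>\<omega>. g (W v \<omega> - W u \<omega>) \<partial>P)"
proof -
  have AP: "A \<in> sets P" using A augmented_sets by blast
  have Wm: "W v \<in> borel_measurable P" "W u \<in> borel_measurable P" using uv by auto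
  note [measurable] = AP Wm
  have "indep_var borel (indicator A :: 'w \<Rightarrow> real) borel (\<lambda>\<omega>. g (W v \<omega> - W u \<omega>))"
    unfolding indep_var_eq
  proof (intro conjI)
    let ?S = "generated_sigma P (\<lambda>r \<omega>. W r \<omega> - W u \<omega>) {v}"
    have "indicator A -` U \<inter> space P \<in> augmented u" for U :: "real set"
    proof -
      have eq: "indicator A -` U \<inter> space P = (if 1 \<in> U then A else {}) \<union> (if 0 \<in> U then space P - A else {})"
        using sets.sets_into_space[OF AP] by (auto simp: indicator_def of_bool_def split: if_splits)
      have "{} \<in> augmented u" "space P - A \<in> augmented u" "\<And>a b. a \<in> augmented u \<Longrightarrow> b \<in> augmented u \<Longrightarrow> a \<union> b \<in> augmented u"
        using A sigma_algebra_augmented[of u] unfolding sigma_algebra_iff algebra_iff_Un by auto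
      then show ?thesis unfolding eq using A by simp
    qed
    then have 1: "sigma_sets (space P) {indicator A -` U \<inter> space P |U. U \<in> sets (borel :: real measure)} \<subseteq> augmented u"
      by (intro sigma_algebra.sigma_sets_subset[OF sigma_algebra_augmented]) auto
    have "(\<lambda>\<omega>. g (W v \<omega> - W u \<omega>)) -` U \<inter> space P \<in> ?S" if U: "U \<in> sets borel" for U
    proof -
      have "(\<lambda>\<omega>. g (W v \<omega> - W u \<omega>)) -` U \<inter> space P = (\<lambda>\<omega>. W v \<omega> - W u \<omega>) -` (g -` U) \<inter> space P"
        by auto
      moreover have "g -` U \<in> sets borel" using measurable_sets[OF g U] by simp
      ultimately show ?thesis unfolding generated_sigma_def by (intro sigma_sets.Basic) blast
    qed
    then have 2: "sigma_sets (space P) {(\<lambda>\<omega>. g (W v \<omega> - W u \<omega>)) -` U \<inter> space P |U. U \<in> sets borel} \<subseteq> ?S"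
      by (intro sigma_algebra.sigma_sets_subset[OF sigma_algebra_generated_sigma]) auto
    show "indep_set (sigma_sets (space P) {indicator A -` U \<inter> space P |U. U \<in> sets (borel :: real measure)})
       (sigma_sets (space P) {(\<lambda>\<omega>. g (W v \<omega> - W u \<omega>)) -` U \<inter> space P |U. U \<in> sets borel})"
      using increment_indep_augmented[OF uv] 1 2 unfolding indep_sets2_eq by blast
  qed measurable
  then have "(\<integral>\<omega>. indicator A \<omega> * g (W v \<omega> - W u \<omega>) \<partial>P)
      = expectation (indicator A) * (\<integral>\<omega>. g (W v \<omega> - W u \<omega>) \<partial>P)"
    using int AP by (intro indep_var_lebesgue_integral) (auto simp: integrable_indicator_iff emeasure_eq_measure)
  then show ?thesis using AP by simp
qed

lemma integrable_indicator_mult: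
  fixes f :: "'w \<Rightarrow> real"
  assumes "A \<in> sets P" "integrable P f"
  shows "integrable P (\<lambda>\<omega>. indicator A \<omega> * f \<omega>)"
  using integrable_mult_indicator[OF assms] by simp

lemma abs_integral_indicator_mult_le:
  fixes f :: "'w \<Rightarrow> real"
  assumes "A \<in> sets P" "integrable P f"
  shows "\<bar>\<integral>\<omega>. indicator A \<omega> * f \<omega> \<partial>P\<bar> \<le> (\<integral>\<omega>. \<bar>f \<omega>\<bar> \<partial>P)"
proof -
  have "\<bar>\<integral>\<omega>. indicator A \<omega> * f \<omega> \<partial>P\<bar> \<le> (\<integral>\<omega>. \<bar>indicator A \<omega> * f \<omega>\<bar> \<partial>P)"
    by (rule integral_abs_bound)
  also have "\<dots> \<le> (\<integral>\<omega>. \<bar>f \<omega>\<bar> \<partial>P)"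
    using assms integrable_indicator_mult[OF assms]
    by (intro integral_mono integrable_abs) (auto simp: indicator_def)
  finally show ?thesis .
qed

lemma dW_mult_integrable:
  "0 \<le> s \<Longrightarrow> s \<le> t \<Longrightarrow> 0 \<le> u \<Longrightarrow> u \<le> v \<Longrightarrow> integrable P (\<lambda>\<omega>. dW a s t \<omega> * dW b u v \<omega>)"
  by (intro L2_space_mult_integrable dW_L2)

lemma dW_mult_abs_le:
  assumes "0 \<le> s" "s \<le> t" "0 \<le> u" "u \<le> v"
  shows "(\<integral>\<omega>. \<bar>dW a s t \<omega> * dW b u v \<omega>\<bar> \<partial>P) \<le> sqrt (t - s) * sqrt (v - u)"
proof -
  have "(\<lambda>\<omega>. \<bar>dW a s t \<omega>\<bar>) \<in> L2_space P P" "(\<lambda>\<omega>. \<bar>dW b u v \<omega>\<bar>) \<in> L2_space P P"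
    using dW_L2[of s t a] dW_L2[of u v b] assms by (auto simp: L2_space_iff)
  from L2_space_cauchy_schwarz[OF this] show ?thesis
    using assms by (simp add: abs_mult dW_second_moment)
qed

lemma dW_abs_le:
  assumes "0 \<le> s" "s \<le> t"
  shows "(\<integral>\<omega>. \<bar>dW a s t \<omega>\<bar> \<partial>P) \<le> sqrt (t - s)"
proof -
  have "(\<lambda>\<omega>. \<bar>dW a s t \<omega>\<bar>) \<in> L2_space P P" "(\<lambda>\<omega>. 1::real) \<in> L2_space P P"
    using dW_L2[of s t a] assms by (auto simp: L2_space_iff)
  from L2_space_cauchy_schwarz[OF this] show ?thesis
    using assms by (simp add: dW_second_moment prob_space)
qed

text \<open>\<open>F s\<close> looks infinitesimally beyond \<open>s\<close>, so \<open>increment_indep_augmented\<close> only applies to increments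
  starting at some \<open>u > s\<close>; the moments follow by letting \<open>u\<close> decrease to \<open>s\<close>.\<close>


lemma integral_indicator_dW:
  assumes A: "A \<in> sets (F s)" and st: "0 \<le> s" "s \<le> t"
  shows "(\<integral>\<omega>. indicator A \<omega> * dW a s t \<omega> \<partial>P) = 0"
proof (cases "s = t")
  case False
  then have lt: "s < t" using st by simp
  obtain u where u: "\<And>n. s < u n" "\<And>n. u n < t" "u \<longlonglongrightarrow> s" using approach_right[OF lt] by metis
  have AP: "A \<in> sets P" using A subalgebra_F[OF st(1)] by (auto simp: subalgebra_def)
  have int: "integrable P (dW a s t)" if "0 \<le> s" "s \<le> t" for s t
    using dW_L2[OF that] by (rule L2_space_integrable)
  have "\<bar>\<integral>\<omega>. indicator A \<omega> * dW a s t \<omega> \<partial>P\<bar> \<le> sqrt (u n - s)" for n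
  proof -
    have "A \<in> augmented (u n)" using A u(1)[of n] st by (auto simp: sets_F)
    from integral_indicator_augmented[OF this _ u(2), of "\<lambda>x. x $ a"] st u(1)[of n] u(2)[of n] int[of "u n" t]
    have 0: "(\<integral>\<omega>. indicator A \<omega> * dW a (u n) t \<omega> \<partial>P) = 0"
      using dW_expectation[of "u n" t a] by (simp add: dW_def[abs_def])
    have "(\<integral>\<omega>. indicator A \<omega> * dW a s t \<omega> \<partial>P)
        = (\<integral>\<omega>. indicator A \<omega> * dW a s (u n) \<omega> + indicator A \<omega> * dW a (u n) t \<omega> \<partial>P)"
      by (simp add: distrib_left[symmetric] dW_add)
    also have "\<dots> = (\<integral>\<omega>. indicator A \<omega> * dW a s (u n) \<omega> \<partial>P)"
      using AP st u(1)[of n] u(2)[of n] 0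
      by (subst Bochner_Integration.integral_add) (auto intro!: integrable_indicator_mult int)
    also have "\<bar>\<dots>\<bar> \<le> (\<integral>\<omega>. \<bar>dW a s (u n) \<omega>\<bar> \<partial>P)"
      using AP st u(1)[of n] by (intro abs_integral_indicator_mult_le int) auto
    also have "\<dots> \<le> sqrt (u n - s)" using st u(1)[of n] by (intro dW_abs_le) auto
    finally show ?thesis .
  qed
  moreover have "(\<lambda>n. sqrt (u n - s)) \<longlonglongrightarrow> sqrt (s - s)" by (intro tendsto_intros u)
  ultimately have "\<bar>\<integral>\<omega>. indicator A \<omega> * dW a s t \<omega> \<partial>P\<bar> \<le> sqrt (s - s)"
    by (intro LIMSEQ_le_const) auto
  then show ?thesis by simp
qed simp

text \<open>Splitting both increments at an intermediate time u leaves three products. The one over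
  (u,t] is evaluated by independence and the covariance of the coordinates; the other two contain an
  increment over (s,u] and are of order sqrt(u - s) by Cauchy-Schwarz, which disappears in the
  limit.\<close>

lemma integral_indicator_dW_mult:
  assumes A: "A \<in> sets (F s)" and st: "0 \<le> s" "s \<le> t"
  shows "(\<integral>\<omega>. indicator A \<omega> * (dW a s t \<omega> * dW b s t \<omega>) \<partial>P) = (if a = b then t - s else 0) * prob A"
proof (cases "s = t")
  case False
  then have lt: "s < t" using st by simp
  obtain u where u: "\<And>n. s < u n" "\<And>n. u n < t" "u \<longlonglongrightarrow> s" using approach_right[OF lt] by metis
  have AP: "A \<in> sets P" using A subalgebra_F[OF st(1)] by (auto simp: subalgebra_def)
  let ?L = "\<lambda>s. (if a = b then t - s else 0) * prob A"
  have "\<bar>(\<integral>\<omega>. indicator A \<omega> * (dW a s t \<omega> * dW b s t \<omega>) \<partial>P) - ?L (u n)\<bar>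
      \<le> sqrt (u n - s) * sqrt (t - s) + sqrt (t - u n) * sqrt (u n - s)" for n
  proof -
    have un: "0 \<le> u n" "s \<le> u n" "u n \<le> t" using u(1)[of n] u(2)[of n] st by auto
    have "A \<in> augmented (u n)" using A u(1)[of n] st by (auto simp: sets_F)
    from integral_indicator_augmented[OF this _ u(2), of "\<lambda>x. x $ a * x $ b"] un dW_mult_integrable[of "u n" t "u n" t a b]
    have eq: "(\<integral>\<omega>. indicator A \<omega> * (dW a (u n) t \<omega> * dW b (u n) t \<omega>) \<partial>P) = ?L (u n)"
      using dW_covariance[of "u n" t a b] u(2)[of n] by (simp add: dW_def[abs_def])
    have i: "integrable P (\<lambda>\<omega>. dW a s (u n) \<omega> * dW b s t \<omega>)" "integrable P (\<lambda>\<omega>. dW a (u n) t \<omega> * dW b s (u n) \<omega>)"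
       "integrable P (\<lambda>\<omega>. dW a (u n) t \<omega> * dW b (u n) t \<omega>)"
      using un st by (auto intro!: dW_mult_integrable)
    have split: "dW a s t \<omega> * dW b s t \<omega> = dW a s (u n) \<omega> * dW b s t \<omega> + dW a (u n) t \<omega> * dW b s (u n) \<omega>
        + dW a (u n) t \<omega> * dW b (u n) t \<omega>" for \<omega>
      unfolding dW_add[of a s "u n" \<omega> t, symmetric] dW_add[of b s "u n" \<omega> t, symmetric]
      by (simp add: algebra_simps)
    have "(\<integral>\<omega>. indicator A \<omega> * (dW a s t \<omega> * dW b s t \<omega>) \<partial>P)
        = (\<integral>\<omega>. indicator A \<omega> * (dW a s (u n) \<omega> * dW b s t \<omega>) + indicator A \<omega> * (dW a (u n) t \<omega> * dW b s (u n) \<omega>)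
        + indicator A \<omega> * (dW a (u n) t \<omega> * dW b (u n) t \<omega>) \<partial>P)"
      by (simp only: split distrib_left)
    also have "\<dots> = (\<integral>\<omega>. indicator A \<omega> * (dW a s (u n) \<omega> * dW b s t \<omega>) \<partial>P)
        + (\<integral>\<omega>. indicator A \<omega> * (dW a (u n) t \<omega> * dW b s (u n) \<omega>) \<partial>P) + ?L (u n)"
      using integrable_indicator_mult[OF AP i(1)] integrable_indicator_mult[OF AP i(2)]
        integrable_indicator_mult[OF AP i(3)] eq by simp
    finally have "\<bar>(\<integral>\<omega>. indicator A \<omega> * (dW a s t \<omega> * dW b s t \<omega>) \<partial>P) - ?L (u n)\<bar>
      \<le> \<bar>\<integral>\<omega>. indicator A \<omega> * (dW a s (u n) \<omega> * dW b s t \<omega>) \<partial>P\<bar>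
        + \<bar>\<integral>\<omega>. indicator A \<omega> * (dW a (u n) t \<omega> * dW b s (u n) \<omega>) \<partial>P\<bar>" by linarith
    also have "\<dots> \<le> sqrt (u n - s) * sqrt (t - s) + sqrt (t - u n) * sqrt (u n - s)"
      using un st
      by (intro add_mono order_trans[OF abs_integral_indicator_mult_le[OF AP i(1)]]
          order_trans[OF abs_integral_indicator_mult_le[OF AP i(2)]] dW_mult_abs_le) auto
    finally show ?thesis .
  qed
  moreover have "(\<lambda>n. sqrt (u n - s) * sqrt (t - s) + sqrt (t - u n) * sqrt (u n - s))
      \<longlonglongrightarrow> sqrt (s - s) * sqrt (t - s) + sqrt (t - s) * sqrt (s - s)"
    by (intro tendsto_intros u)
  moreover have "(\<lambda>n. \<bar>(\<integral>\<omega>. indicator A \<omega> * (dW a s t \<omega> * dW b s t \<omega>) \<partial>P) - ?L (u n)\<bar>)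
      \<longlonglongrightarrow> \<bar>(\<integral>\<omega>. indicator A \<omega> * (dW a s t \<omega> * dW b s t \<omega>) \<partial>P) - ?L s\<bar>"
    by (cases "a = b") (auto intro!: tendsto_intros u)
  ultimately have "\<bar>(\<integral>\<omega>. indicator A \<omega> * (dW a s t \<omega> * dW b s t \<omega>) \<partial>P) - ?L s\<bar>
      \<le> sqrt (s - s) * sqrt (t - s) + sqrt (t - s) * sqrt (s - s)"
    by (intro LIMSEQ_le) auto
  then show ?thesis by simp
qed simp

lemma integral_mult_dW:
  assumes st: "0 \<le> s" "s \<le> t" and \<psi>: "\<psi> \<in> borel_measurable (F s)" "\<psi> \<in> L2_space P P"
  shows "(\<integral>\<omega>. \<psi> \<omega> * dW a s t \<omega> \<partial>P) = 0"
proof -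
  have "(\<integral>\<omega>. \<psi> \<omega> * dW a s t \<omega> \<partial>P) = 0 * (\<integral>\<omega>. \<psi> \<omega> \<partial>P)"
    using st \<psi> by (intro integral_mult_eq_const[OF subalgebra_F] L2_space_integrable dW_L2
        L2_space_mult_integrable) (auto simp: integral_indicator_dW)
  then show ?thesis by simp
qed

text \<open>The product of two increments is controlled only in L^1 here, so the multiplier is
  bounded instead of square-integrable: attached to one of the increments it leaves a
  square-integrable factor.\<close>

lemma integral_mult_dW_dW:
  assumes st: "0 \<le> s" "s \<le> t" and \<psi>: "\<psi> \<in> borel_measurable (F s)" "\<And>\<omega>. \<omega> \<in> space P \<Longrightarrow> \<bar>\<psi> \<omega>\<bar> \<le> c"
  shows "(\<integral>\<omega>. \<psi> \<omega> * (dW a s t \<omega> * dW b s t \<omega>) \<partial>P) = (if a = b then t - s else 0) * (\<integral>\<omega>. \<psi> \<omega> \<partial>P)"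
proof (rule integral_mult_eq_const[OF subalgebra_F])
  have [measurable]: "\<psi> \<in> borel_measurable P" using measurable_F_P st \<psi> by blast
  have "(\<lambda>\<omega>. \<psi> \<omega> *\<^sub>R dW a s t \<omega>) \<in> L2_space P P"
    using \<psi> dW_L2[OF st] by (intro L2_space_scaleR_bounded[where c = c]) auto
  from L2_space_mult_integrable[OF this dW_L2[OF st, of b]]
  show "integrable P (\<lambda>\<omega>. \<psi> \<omega> * (dW a s t \<omega> * dW b s t \<omega>))" by (simp add: mult.assoc)
qed (use st \<psi> dW_mult_integrable integral_indicator_dW_mult in auto)

end

section \<open>The isometry of the stochastic integral\<close>

context stochastic_basis
begin

text \<open>The entries of step coefficients. The class is closed under products and grows with
  time, so the product of two coefficients belongs to the later of their two times.\<close>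

definition bounded_F where
  "bounded_F s = {\<zeta> :: 'w \<Rightarrow> real. \<zeta> \<in> borel_measurable (F s) \<and> (\<exists>c. \<forall>\<omega>\<in>space P. \<bar>\<zeta> \<omega>\<bar> \<le> c)}"

lemma bounded_F_mono: "0 \<le> s \<Longrightarrow> s \<le> t \<Longrightarrow> \<zeta> \<in> bounded_F s \<Longrightarrow> \<zeta> \<in> bounded_F t"
  using measurable_F_mono by (auto simp: bounded_F_def)

lemma bounded_F_mult:
  assumes "\<zeta> \<in> bounded_F s" "\<zeta>' \<in> bounded_F s"
  shows "(\<lambda>\<omega>. \<zeta> \<omega> * \<zeta>' \<omega>) \<in> bounded_F s"
proof -
  from assms obtain c c' where c: "\<And>\<omega>. \<omega> \<in> space P \<Longrightarrow> \<bar>\<zeta> \<omega>\<bar> \<le> c" "\<And>\<omega>. \<omega> \<in> space P \<Longrightarrow> \<bar>\<zeta>' \<omega>\<bar> \<le> c'"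
    by (auto simp: bounded_F_def)
  have "\<bar>\<zeta> \<omega> * \<zeta>' \<omega>\<bar> \<le> c * c'" if "\<omega> \<in> space P" for \<omega>
    unfolding abs_mult using c[OF that] by (intro mult_mono) auto
  then show ?thesis using assms by (auto simp: bounded_F_def)
qed

lemma bounded_F_mult_L2:
  assumes s: "0 \<le> s" and "\<zeta> \<in> bounded_F s" and f: "f \<in> L2_space P P"
  shows "(\<lambda>\<omega>. \<zeta> \<omega> * f \<omega> :: real) \<in> L2_space P P"
proof -
  from assms obtain c where "\<And>\<omega>. \<omega> \<in> space P \<Longrightarrow> \<bar>\<zeta> \<omega>\<bar> \<le> c" by (auto simp: bounded_F_def)
  then have "(\<lambda>\<omega>. \<zeta> \<omega> *\<^sub>R f \<omega>) \<in> L2_space P P"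
    using assms measurable_F_P by (intro L2_space_scaleR_bounded) (auto simp: bounded_F_def)
  then show ?thesis by simp
qed

text \<open>The product of the coefficients is known at the later left endpoint \<open>u\<close>.
  The increments are cut at \<open>u\<close> and at the smaller right endpoint. A term in which one
  increment starts when all other factors are already known has mean zero, so only the common
  interval contributes, with its length.\<close>

lemma step_covariance_le:
  assumes st: "0 \<le> s" "s \<le> t" and uv: "0 \<le> u" "u \<le> v" and su: "s \<le> u"
    and \<zeta>: "\<zeta> \<in> bounded_F s" and \<zeta>': "\<zeta>' \<in> bounded_F u"
  shows "(\<integral>\<omega>. (\<zeta> \<omega> * dW a s t \<omega>) * (\<zeta>' \<omega> * dW b u v \<omega>) \<partial>P)
    = (if a = b then measure lborel ({s<..t} \<inter> {u<..v}) else 0) * (\<integral>\<omega>. \<zeta> \<omega> * \<zeta>' \<omega> \<partial>P)"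
proof -
  have \<zeta>u: "\<zeta> \<in> bounded_F u" using \<zeta> st su bounded_F_mono by blast
  define \<psi> where "\<psi> \<omega> = \<zeta> \<omega> * \<zeta>' \<omega>" for \<omega>
  have \<psi>: "\<psi> \<in> bounded_F u" unfolding \<psi>_def by (rule bounded_F_mult[OF \<zeta>u \<zeta>'])
  have early: "(\<integral>\<omega>. (\<psi> \<omega> * dW a' p r \<omega>) * dW b' r q \<omega> \<partial>P) = 0"
       "integrable P (\<lambda>\<omega>. (\<psi> \<omega> * dW a' p r \<omega>) * dW b' r q \<omega>)"
    if "0 \<le> p" "p \<le> r" "r \<le> q" "u \<le> r" for a' b' p r q
  proof -
    have r: "\<psi> \<in> bounded_F r" "0 \<le> r" using bounded_F_mono[OF _ _ \<psi>] that uv by auto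
    have L: "(\<lambda>\<omega>. \<psi> \<omega> * dW a' p r \<omega>) \<in> L2_space P P"
      using r that by (intro bounded_F_mult_L2[OF r(2)] dW_L2)
    moreover have "(\<lambda>\<omega>. \<psi> \<omega> * dW a' p r \<omega>) \<in> borel_measurable (F r)"
      using r that dW_measurable_F[of p r] by (auto simp: bounded_F_def)
    ultimately show "(\<integral>\<omega>. (\<psi> \<omega> * dW a' p r \<omega>) * dW b' r q \<omega> \<partial>P) = 0"
      using that r by (intro integral_mult_dW)
    show "integrable P (\<lambda>\<omega>. (\<psi> \<omega> * dW a' p r \<omega>) * dW b' r q \<omega>)"
      using L that r by (intro L2_space_mult_integrable dW_L2)
  qed
  show ?thesis
  proof (cases "t \<le> u")
    case True
    have m: "measure lborel ({s<..t} \<inter> {u<..v}) = 0" using True by (simp add: Int_greaterThanAtMost)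
    have "(\<lambda>\<omega>. \<psi> \<omega> * dW a s t \<omega>) \<in> L2_space P P"
      using \<psi> st uv by (intro bounded_F_mult_L2[OF uv(1)] dW_L2)
    moreover have "(\<lambda>\<omega>. \<psi> \<omega> * dW a s t \<omega>) \<in> borel_measurable (F u)"
      using \<psi> measurable_F_mono[OF _ True dW_measurable_F[OF st]] st by (auto simp: bounded_F_def)
    ultimately have "(\<integral>\<omega>. (\<psi> \<omega> * dW a s t \<omega>) * dW b u v \<omega> \<partial>P) = 0"
      using uv by (intro integral_mult_dW)
    then show ?thesis unfolding m by (simp add: \<psi>_def mult_ac)
  next
    case False
    define r where "r = min t v"
    have r: "u \<le> r" "0 \<le> r" "r \<le> t" "r \<le> v" "r = t \<or> r = v" using False uv by (auto simp: r_def)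
    have "{s<..t} \<inter> {u<..v} = {u<..r}" using su r by (auto simp: r_def)
    then have m: "measure lborel ({s<..t} \<inter> {u<..v}) = r - u" using r by simp
    from \<psi> obtain c where c: "\<And>\<omega>. \<omega> \<in> space P \<Longrightarrow> \<bar>\<psi> \<omega>\<bar> \<le> c" by (auto simp: bounded_F_def)
    have diag: "(\<integral>\<omega>. \<psi> \<omega> * (dW a u r \<omega> * dW b u r \<omega>) \<partial>P) = (if a = b then r - u else 0) * (\<integral>\<omega>. \<psi> \<omega> \<partial>P)"
      using uv r \<psi> c by (intro integral_mult_dW_dW) (auto simp: bounded_F_def)
    have diag_int: "integrable P (\<lambda>\<omega>. \<psi> \<omega> * (dW a u r \<omega> * dW b u r \<omega>))"
      using L2_space_mult_integrable[OF bounded_F_mult_L2[OF uv(1) \<psi> dW_L2[OF uv(1) r(1), of a]] dW_L2[OF uv(1) r(1), of b]]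
      by (simp add: mult.assoc)
    \<comment> \<open>\<open>r\<close> is one of the two right endpoints, so one of the two
      remaining increments runs over a degenerate interval.\<close>
    have zero: "dW a r t \<omega> * dW b r v \<omega> = 0" for \<omega> using r(5) by auto
    have split: "(\<zeta> \<omega> * dW a s t \<omega>) * (\<zeta>' \<omega> * dW b u v \<omega>) = (\<psi> \<omega> * dW a s u \<omega>) * dW b u v \<omega>
        + \<psi> \<omega> * (dW a u r \<omega> * dW b u r \<omega>) + (\<psi> \<omega> * dW a u r \<omega>) * dW b r v \<omega>
        + (\<psi> \<omega> * dW b u r \<omega>) * dW a r t \<omega>" for \<omega>
    proof -
      have 1: "dW a s t \<omega> = dW a s u \<omega> + dW a u r \<omega> + dW a r t \<omega>" "dW b u v \<omega> = dW b u r \<omega> + dW b r v \<omega>"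
        by (simp_all add: dW_add)
      have "(\<zeta> \<omega> * dW a s t \<omega>) * (\<zeta>' \<omega> * dW b u v \<omega>)
          = \<psi> \<omega> * dW a s u \<omega> * dW b u v \<omega> + \<psi> \<omega> * ((dW a u r \<omega> + dW a r t \<omega>) * (dW b u r \<omega> + dW b r v \<omega>))"
        by (simp add: \<psi>_def 1 algebra_simps)
      also have "(dW a u r \<omega> + dW a r t \<omega>) * (dW b u r \<omega> + dW b r v \<omega>)
         = dW a u r \<omega> * dW b u r \<omega> + dW a u r \<omega> * dW b r v \<omega> + dW b u r \<omega> * dW a r t \<omega> + dW a r t \<omega> * dW b r v \<omega>"
        by (simp add: algebra_simps)
      finally show ?thesis using zero[of \<omega>] by (simp add: algebra_simps)
    qed
    have "(\<integral>\<omega>. (\<zeta> \<omega> * dW a s t \<omega>) * (\<zeta>' \<omega> * dW b u v \<omega>) \<partial>P)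
       = (\<integral>\<omega>. (\<psi> \<omega> * dW a s u \<omega>) * dW b u v \<omega> \<partial>P) + (\<integral>\<omega>. \<psi> \<omega> * (dW a u r \<omega> * dW b u r \<omega>) \<partial>P)
       + (\<integral>\<omega>. (\<psi> \<omega> * dW a u r \<omega>) * dW b r v \<omega> \<partial>P) + (\<integral>\<omega>. (\<psi> \<omega> * dW b u r \<omega>) * dW a r t \<omega> \<partial>P)"
      unfolding split using early(2) diag_int st uv su r
      by (simp add: Bochner_Integration.integral_add)
    also have "\<dots> = (if a = b then r - u else 0) * (\<integral>\<omega>. \<psi> \<omega> \<partial>P)"
      using early(1) diag st uv su r by simp
    finally show ?thesis unfolding m \<psi>_def .
  qed
qed

lemma step_covariance:
  assumes st: "0 \<le> s" "s \<le> t" and uv: "0 \<le> u" "u \<le> v"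
    and \<zeta>: "\<zeta> \<in> bounded_F s" and \<zeta>': "\<zeta>' \<in> bounded_F u"
  shows "(\<integral>\<omega>. (\<zeta> \<omega> * dW a s t \<omega>) * (\<zeta>' \<omega> * dW b u v \<omega>) \<partial>P)
    = (if a = b then measure lborel ({s<..t} \<inter> {u<..v}) else 0) * (\<integral>\<omega>. \<zeta> \<omega> * \<zeta>' \<omega> \<partial>P)"
proof (cases "s \<le> u")
  case True
  then show ?thesis using assms by (intro step_covariance_le)
next
  case False
  then show ?thesis
    using step_covariance_le[OF uv st _ \<zeta>' \<zeta>, of b a] by (cases "a = b") (simp_all add: mult_ac Int_commute)
qed

lemma sq_sum_eq: "(\<Sum>i\<in>I. f i :: real)\<^sup>2 = (\<Sum>i\<in>I. \<Sum>j\<in>I. f i * f j)"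
  by (simp add: power2_eq_square sum_product)

lemma norm_sq_matrix: "(norm (x :: real^'m^'n))\<^sup>2 = (\<Sum>a\<in>UNIV. \<Sum>b\<in>UNIV. (x $ a $ b)\<^sup>2)"
  by (simp only: power2_norm_eq_inner inner_vec_def inner_real_def) (simp add: power2_eq_square)

lemma norm_sq_vec: "(norm (x :: real^'n))\<^sup>2 = (\<Sum>a\<in>UNIV. (x $ a)\<^sup>2)"
  by (simp only: power2_norm_eq_inner inner_vec_def inner_real_def) (simp add: power2_eq_square)

lemma borel_measurable_vecI:
  fixes f :: "'a \<Rightarrow> real^'n"
  assumes "\<And>i. (\<lambda>x. f x $ i) \<in> borel_measurable M"
  shows "f \<in> borel_measurable M"
  unfolding borel_measurable_euclidean_space[of f]
  using assms by (auto simp: Basis_vec_def inner_axis)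

text \<open>The family of intervals \<open>(s i, t i]\<close> need not be ordered or disjoint, so that the isometry
  applies to the difference of two step integrands without passing to a common refinement.\<close>

lemma ito_isometry_family:
  fixes \<eta> :: "'i \<Rightarrow> 'w \<Rightarrow> real^'q^'d"
  assumes I: "finite I" and st: "\<And>i. i \<in> I \<Longrightarrow> 0 \<le> s i \<and> s i \<le> t i"
    and \<eta>: "\<And>i a b. i \<in> I \<Longrightarrow> (\<lambda>\<omega>. \<eta> i \<omega> $ a $ b) \<in> bounded_F (s i)"
  shows "(\<integral>\<^sup>+\<omega>. ennreal ((norm (\<Sum>i\<in>I. \<eta> i \<omega> *v (W (t i) \<omega> - W (s i) \<omega>)))\<^sup>2) \<partial>P)
    = (\<integral>\<^sup>+\<omega>. (\<integral>\<^sup>+r. ennreal ((norm (\<Sum>i\<in>I. indicator {s i<..t i} r *\<^sub>R \<eta> i \<omega>))\<^sup>2) \<partial>lborel) \<partial>P)"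
    and "(\<lambda>\<omega>. \<Sum>i\<in>I. \<eta> i \<omega> *v (W (t i) \<omega> - W (s i) \<omega>)) \<in> L2_space P P"
proof -
  define \<mu> where "\<mu> i j = measure lborel ({s i<..t i} \<inter> {s j<..t j})" for i j
  let ?Z = "\<lambda>\<omega>. \<Sum>i\<in>I. \<eta> i \<omega> *v (W (t i) \<omega> - W (s i) \<omega>)"
  let ?J = "I \<times> (UNIV :: 'q set)"
  let ?z = "\<lambda>a p \<omega>. \<eta> (fst p) \<omega> $ a $ (snd p) * dW (snd p) (s (fst p)) (t (fst p)) \<omega>"
  have Z: "?Z \<omega> $ a = (\<Sum>p\<in>?J. ?z a p \<omega>)" for \<omega> a
    by (simp add: matrix_vector_mult_def dW_def sum.cartesian_product case_prod_unfold)
  have zL2: "?z a p \<in> L2_space P P" if "p \<in> ?J" for a p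
    using that st[of "fst p"] \<eta>[of "fst p"] by (intro bounded_F_mult_L2[of "s (fst p)"] dW_L2) auto
  have \<eta>_int: "integrable P (\<lambda>\<omega>. \<eta> i \<omega> $ a $ b * \<eta> j \<omega> $ a $ b)" if "i \<in> I" "j \<in> I" for i j a b
  proof -
    \<comment> \<open>The factor 1 is the square-integrable function to which
      \<open>bounded_F_mult_L2\<close> is applied.\<close>
    have "(\<lambda>\<omega>. \<eta> k \<omega> $ a $ b * 1) \<in> L2_space P P" if "k \<in> I" for k
      using that st \<eta> by (intro bounded_F_mult_L2[of "s k"]) (auto simp: L2_space_iff)
    then show ?thesis using that by (intro L2_space_mult_integrable) auto
  qed
  have normZ: "(norm (?Z \<omega>))\<^sup>2 = (\<Sum>a\<in>UNIV. \<Sum>p\<in>?J. \<Sum>p'\<in>?J. ?z a p \<omega> * ?z a p' \<omega>)" for \<omega>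
    unfolding norm_sq_vec Z sq_sum_eq ..
  have z_int: "integrable P (\<lambda>\<omega>. ?z a p \<omega> * ?z a p' \<omega>)" if "p \<in> ?J" "p' \<in> ?J" for a p p'
    using that by (intro L2_space_mult_integrable zL2)
  have Z_int: "integrable P (\<lambda>\<omega>. (norm (?Z \<omega>))\<^sup>2)"
    unfolding normZ using z_int by (intro Bochner_Integration.integrable_sum)
  have Zm: "?Z \<in> borel_measurable P"
  proof -
    have "(\<lambda>\<omega>. ?Z \<omega> $ a) \<in> borel_measurable P" for a
      unfolding Z using zL2 by (intro borel_measurable_sum) (auto simp: L2_space_iff)
    then show ?thesis by (rule borel_measurable_vecI)
  qed
  show "?Z \<in> L2_space P P" using Z_int Zm by (simp add: L2_space_iff)
  have "(\<integral>\<omega>. (norm (?Z \<omega>))\<^sup>2 \<partial>P)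
      = (\<Sum>a\<in>UNIV. \<Sum>p\<in>?J. \<Sum>p'\<in>?J. (\<integral>\<omega>. ?z a p \<omega> * ?z a p' \<omega> \<partial>P))"
    unfolding normZ using z_int
    by (simp add: Bochner_Integration.integral_sum)
  also have "\<dots> = (\<Sum>a\<in>UNIV. \<Sum>p\<in>?J. \<Sum>p'\<in>?J.
      (if snd p = snd p' then \<mu> (fst p) (fst p') else 0) * (\<integral>\<omega>. \<eta> (fst p) \<omega> $ a $ (snd p) * \<eta> (fst p') \<omega> $ a $ (snd p') \<partial>P))"
    unfolding \<mu>_def using st \<eta> by (intro sum.cong refl step_covariance) auto
  also have "\<dots> = (\<Sum>a\<in>UNIV. \<Sum>i\<in>I. \<Sum>b\<in>UNIV. \<Sum>j\<in>I. \<Sum>b'\<in>UNIV. if b = b' then \<mu> i j * (\<integral>\<omega>. \<eta> i \<omega> $ a $ b * \<eta> j \<omega> $ a $ b' \<partial>P) else 0)"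
    unfolding sum.cartesian_product' by (intro sum.cong refl) auto
  also have "\<dots> = (\<Sum>a\<in>UNIV. \<Sum>i\<in>I. \<Sum>b\<in>UNIV. \<Sum>j\<in>I. \<mu> i j * (\<integral>\<omega>. \<eta> i \<omega> $ a $ b * \<eta> j \<omega> $ a $ b \<partial>P))"
    by simp
  also have "\<dots> = (\<Sum>a\<in>UNIV. \<Sum>b\<in>UNIV. \<Sum>i\<in>I. \<Sum>j\<in>I. \<mu> i j * (\<integral>\<omega>. \<eta> i \<omega> $ a $ b * \<eta> j \<omega> $ a $ b \<partial>P))"
    by (intro sum.cong refl sum.swap)
  finally have lhs: "(\<integral>\<omega>. (norm (?Z \<omega>))\<^sup>2 \<partial>P) = \<dots>" .
  \<comment> \<open>For fixed \<omega> the time integral of the squared step process is this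
    quadratic form in the coefficients, weighted by the overlap lengths \<open>\<mu> i j\<close>;
    its expectation is the expression already found for the stochastic side.\<close>
  define q where "q \<omega> = (\<Sum>a\<in>UNIV. \<Sum>b\<in>UNIV. \<Sum>i\<in>I. \<Sum>j\<in>I. \<mu> i j * (\<eta> i \<omega> $ a $ b * \<eta> j \<omega> $ a $ b))" for \<omega>
  let ?f = "\<lambda>r \<omega>. \<Sum>i\<in>I. indicator {s i<..t i} r *\<^sub>R \<eta> i \<omega>"
  have inner: "(\<integral>\<^sup>+r. ennreal ((norm (?f r \<omega>))\<^sup>2) \<partial>lborel) = ennreal (q \<omega>)" and q0: "0 \<le> q \<omega>" for \<omega>
  proof -
    have f: "(norm (?f r \<omega>))\<^sup>2 = (\<Sum>a\<in>UNIV. \<Sum>b\<in>UNIV. \<Sum>i\<in>I. \<Sum>j\<in>I.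
        indicator ({s i<..t i} \<inter> {s j<..t j}) r * (\<eta> i \<omega> $ a $ b * \<eta> j \<omega> $ a $ b))" for r
      unfolding norm_sq_matrix sum_component vector_scaleR_component sq_sum_eq
      by (intro sum.cong refl) (auto simp: indicator_def)
    have fin: "emeasure lborel {p<..p'} < \<infinity>" for p p' :: real
      by (cases "p \<le> p'") auto
    have ind: "has_bochner_integral lborel (\<lambda>r. indicator ({s i<..t i} \<inter> {s j<..t j}) r * c) (\<mu> i j * c)"
      for i j and c :: real
      unfolding \<mu>_def using fin
      by (intro has_bochner_integral_mult_left has_bochner_integral_real_indicator)
         (auto simp: Int_greaterThanAtMost)
    have "has_bochner_integral lborel (\<lambda>r. (norm (?f r \<omega>))\<^sup>2) (q \<omega>)"
      unfolding f q_def by (intro has_bochner_integral_sum ind)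
    then have "integrable lborel (\<lambda>r. (norm (?f r \<omega>))\<^sup>2)"
      and eq: "(\<integral>r. (norm (?f r \<omega>))\<^sup>2 \<partial>lborel) = q \<omega>"
      by (auto simp: has_bochner_integral_iff)
    then show "(\<integral>\<^sup>+r. ennreal ((norm (?f r \<omega>))\<^sup>2) \<partial>lborel) = ennreal (q \<omega>)"
      by (subst nn_integral_eq_integral) auto
    show "0 \<le> q \<omega>" unfolding eq[symmetric] by simp
  qed
  have q_int: "integrable P q"
    unfolding q_def by (intro Bochner_Integration.integrable_sum integrable_mult_right \<eta>_int)
  have "(\<integral>\<omega>. q \<omega> \<partial>P) = (\<integral>\<omega>. (norm (?Z \<omega>))\<^sup>2 \<partial>P)"
    unfolding lhs q_def by (simp add: Bochner_Integration.integral_sum \<eta>_int)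
  then show "(\<integral>\<^sup>+\<omega>. ennreal ((norm (?Z \<omega>))\<^sup>2) \<partial>P) = (\<integral>\<^sup>+\<omega>. (\<integral>\<^sup>+r. ennreal ((norm (?f r \<omega>))\<^sup>2) \<partial>lborel) \<partial>P)"
    unfolding inner using nn_integral_eq_integral[OF Z_int] nn_integral_eq_integral[OF q_int] q0 by simp
qed

end

section \<open>From step integrands to the stochastic integral\<close>

lemma ennreal_norm_diff_sq_le:
  "ennreal ((norm (x - y))\<^sup>2) \<le> 2 * ennreal ((norm (x - z))\<^sup>2) + 2 * ennreal ((norm (y - z :: 'v::real_normed_vector))\<^sup>2)"
  using ennreal_norm_add_sq_le[of "x - z" "z - y"] by (simp add: norm_minus_commute)

context stochastic_basis
begin

abbreviation PT :: "real \<Rightarrow> real \<Rightarrow> (real \<times> 'w) measure" where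
  "PT a b \<equiv> restrict_space lborel {a..b} \<Otimes>\<^sub>M P"

lemma sigma_finite_Icc: "sigma_finite_measure (restrict_space lborel {a..b::real})"
  by (intro sigma_finite_measure_restrict_space sigma_finite_lborel) simp

lemma pair_PT: "pair_sigma_finite (restrict_space lborel {a..b::real}) P"
  unfolding pair_sigma_finite_def using sigma_finite_Icc sigma_finite_measure_axioms by blast

lemma progressive_measurable:
  assumes "progressive F a b Z" "0 \<le> a" "a \<le> b"
  shows "(\<lambda>(t, \<omega>). Z t \<omega>) \<in> borel_measurable (PT a b)"
proof -
  have Z: "(\<lambda>(t, \<omega>). Z t \<omega>) \<in> borel_measurable (restrict_space borel {a..b} \<Otimes>\<^sub>M F b)"
    using assms by (auto simp: progressive_def)
  have "(\<lambda>x. x) \<in> restrict_space lborel {a..b} \<rightarrow>\<^sub>M restrict_space borel {a..b}"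
    by (subst measurable_cong_sets[of _ "restrict_space borel {a..b}"]) (auto intro!: sets_restrict_space_cong)
  then have 1: "fst \<in> PT a b \<rightarrow>\<^sub>M restrict_space borel {a..b}"
    using measurable_compose[OF measurable_fst] by fastforce
  have "(\<lambda>x. x) \<in> P \<rightarrow>\<^sub>M F b"
    using subalgebra_F[of b] assms by (auto intro!: measurableI simp: subalgebra_def)
  then have 2: "snd \<in> PT a b \<rightarrow>\<^sub>M F b"
    using measurable_compose[OF measurable_snd] by fastforce
  have "(\<lambda>x. (fst x, snd x)) \<in> PT a b \<rightarrow>\<^sub>M (restrict_space borel {a..b} \<Otimes>\<^sub>M F b)"
    by (intro measurable_Pair 1 2)
  from measurable_compose[OF this Z] show ?thesis by (simp add: case_prod_unfold)
qed

lemma nn_integral_PT: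
  assumes f: "f \<in> borel_measurable (PT a b)"
  shows "(\<integral>\<^sup>+\<omega>. (\<integral>\<^sup>+t\<in>{a..b}. f (t, \<omega>) \<partial>lborel) \<partial>P) = integral\<^sup>N (PT a b) f"
  using pair_sigma_finite.nn_integral_snd[OF pair_PT f] by (simp add: nn_integral_restrict_space)

lemma adapted_step_entry:
  fixes \<eta> :: "nat \<Rightarrow> 'w \<Rightarrow> real^'m^'n"
  assumes "adapted_step P F a b n \<tau> \<eta>" "0 \<le> a" "i < n"
  shows "(\<lambda>\<omega>. \<eta> i \<omega> $ k $ l) \<in> bounded_F (\<tau> i)" "0 \<le> \<tau> i \<and> \<tau> i \<le> \<tau> (Suc i)" "a \<le> \<tau> i" "\<tau> (Suc i) \<le> b"
proof -
  have \<eta>: "\<eta> i \<in> borel_measurable (F (\<tau> i))" and "\<exists>c. \<forall>\<omega>\<in>space P. norm (\<eta> i \<omega>) \<le> c"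
    using assms by (auto simp: adapted_step_def)
  then obtain c where c: "\<And>\<omega>. \<omega> \<in> space P \<Longrightarrow> norm (\<eta> i \<omega>) \<le> c" by blast
  have "\<bar>\<eta> i \<omega> $ k $ l\<bar> \<le> c" if "\<omega> \<in> space P" for \<omega>
    using component_le_norm_cart[of "\<eta> i \<omega> $ k" l] Finite_Cartesian_Product.norm_nth_le[of "\<eta> i \<omega>" k] c[OF that] by linarith
  moreover have "(\<lambda>\<omega>. \<eta> i \<omega> $ k $ l) \<in> borel_measurable (F (\<tau> i))"
  proof -
    have "(\<lambda>x :: real^'m^'n. x $ k $ l) \<in> borel_measurable borel"
      by (intro borel_measurable_continuous_onI continuous_intros)
    from measurable_compose[OF \<eta> this] show ?thesis .
  qed
  ultimately show "(\<lambda>\<omega>. \<eta> i \<omega> $ k $ l) \<in> bounded_F (\<tau> i)" by (auto simp: bounded_F_def)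
  show "0 \<le> \<tau> i \<and> \<tau> i \<le> \<tau> (Suc i)" "a \<le> \<tau> i" "\<tau> (Suc i) \<le> b"
    using assms by (auto simp: adapted_step_def intro: order_trans)
qed

lemma step_process_measurable:
  fixes \<eta> :: "nat \<Rightarrow> 'w \<Rightarrow> real^'m^'n"
  assumes "adapted_step P F a b n \<tau> \<eta>" "0 \<le> a"
  shows "(\<lambda>(s, \<omega>). step_process n \<tau> \<eta> s \<omega>) \<in> borel_measurable (PT a b)"
proof -
  have [measurable]: "\<eta> i \<in> borel_measurable P" if "i < n" for i
    using assms that adapted_step_entry(2)[OF assms that] measurable_F_P[of "\<tau> i" "\<eta> i"] by (auto simp: adapted_step_def)
  have [measurable]: "(\<lambda>s. indicator A s :: real) \<in> borel_measurable (restrict_space lborel {a..b})"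
    if "A \<in> sets borel" for A
    using that by (intro measurable_restrict_space1) auto
  show ?thesis unfolding step_process_def by measurable
qed

text \<open>The two step processes are laid side by side as one family over the disjoint sum of
  their index sets, with a minus sign on the second.\<close>

lemma step_integral_isometry:
  fixes \<eta> \<eta>' :: "nat \<Rightarrow> 'w \<Rightarrow> real^'q^'d"
  assumes step: "adapted_step P F a b n \<tau> \<eta>" and step': "adapted_step P F a b n' \<tau>' \<eta>'" and a: "0 \<le> a"
  shows "(\<integral>\<^sup>+\<omega>. ennreal ((norm (step_integral W n \<tau> \<eta> \<omega> - step_integral W n' \<tau>' \<eta>' \<omega>))\<^sup>2) \<partial>P)
    = (\<integral>\<^sup>+\<omega>. (\<integral>\<^sup>+s\<in>{a..b}. ennreal ((norm (step_process n \<tau> \<eta> s \<omega> - step_process n' \<tau>' \<eta>' s \<omega>))\<^sup>2) \<partial>lborel) \<partial>P)"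
    and "step_integral W n \<tau> \<eta> \<in> L2_space P P"
proof -
  define I where "I = {..<n} <+> {..<n'}"
  define s where "s = case_sum \<tau> \<tau>'"
  define t where "t = case_sum (\<lambda>i. \<tau> (Suc i)) (\<lambda>i. \<tau>' (Suc i))"
  define z where "z = case_sum \<eta> (\<lambda>i \<omega>. - \<eta>' i \<omega>)"
  have I: "finite I" "\<And>i. i \<in> I \<Longrightarrow> 0 \<le> s i \<and> s i \<le> t i" "\<And>i. i \<in> I \<Longrightarrow> a \<le> s i \<and> t i \<le> b"
    using adapted_step_entry[OF step a] adapted_step_entry[OF step' a]
    by (auto simp: I_def s_def t_def)
  have z: "(\<lambda>\<omega>. z i \<omega> $ k $ l) \<in> bounded_F (s i)" if "i \<in> I" for i k l
    using that adapted_step_entry(1)[OF step a] adapted_step_entry(1)[OF step' a]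
    by (auto simp: I_def s_def z_def bounded_F_def)
  \<comment> \<open>All intervals lie in [a,b], so restricting the time integral to [a,b] loses
    nothing.\<close>
  have zero: "\<not> x \<in> {a..b} \<Longrightarrow> (\<Sum>i\<in>I. indicator {s i<..t i} x *\<^sub>R z i \<omega>) = 0" for x \<omega>
    using I(3) by (intro sum.neutral) (force simp: indicator_def)
  have int: "step_integral W n \<tau> \<eta> \<omega> - step_integral W n' \<tau>' \<eta>' \<omega> = (\<Sum>i\<in>I. z i \<omega> *v (W (t i) \<omega> - W (s i) \<omega>))" for \<omega>
    unfolding I_def by (subst sum.Plus)
      (auto simp: s_def t_def z_def step_integral_def sum_negf
        bounded_bilinear.minus_left[OF bounded_bilinear_matrix_vector_mult])
  have proc: "step_process n \<tau> \<eta> x \<omega> - step_process n' \<tau>' \<eta>' x \<omega> = (\<Sum>i\<in>I. indicator {s i<..t i} x *\<^sub>R z i \<omega>)" for x \<omega>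
    unfolding I_def by (subst sum.Plus) (auto simp: s_def t_def z_def step_process_def sum_negf)
  have "ennreal ((norm (\<Sum>i\<in>I. indicator {s i<..t i} x *\<^sub>R z i \<omega>))\<^sup>2) * indicator {a..b} x
     = ennreal ((norm (\<Sum>i\<in>I. indicator {s i<..t i} x *\<^sub>R z i \<omega>))\<^sup>2)" for x \<omega>
    using zero[of x \<omega>] by (cases "x \<in> {a..b}") auto
  then show "(\<integral>\<^sup>+\<omega>. ennreal ((norm (step_integral W n \<tau> \<eta> \<omega> - step_integral W n' \<tau>' \<eta>' \<omega>))\<^sup>2) \<partial>P)
    = (\<integral>\<^sup>+\<omega>. (\<integral>\<^sup>+s\<in>{a..b}. ennreal ((norm (step_process n \<tau> \<eta> s \<omega> - step_process n' \<tau>' \<eta>' s \<omega>))\<^sup>2) \<partial>lborel) \<partial>P)"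
    unfolding int proc using ito_isometry_family(1)[OF I(1,2) z] by simp
  have "(\<lambda>\<omega>. \<Sum>i\<in>{..<n}. \<eta> i \<omega> *v (W (\<tau> (Suc i)) \<omega> - W (\<tau> i) \<omega>)) \<in> L2_space P P"
    using adapted_step_entry[OF step a] by (intro ito_isometry_family(2)) auto
  then show "step_integral W n \<tau> \<eta> \<in> L2_space P P" by (simp add: step_integral_def[abs_def])
qed

lemma has_ito_integralE:
  assumes "has_ito_integral P F W a b H J"
  obtains n \<tau> \<eta> where "\<And>k. adapted_step P F a b (n k) (\<tau> k) (\<eta> k)"
    "(\<lambda>k. \<integral>\<^sup>+\<omega>. (\<integral>\<^sup>+s\<in>{a..b}. ennreal ((norm (step_process (n k) (\<tau> k) (\<eta> k) s \<omega> - H s \<omega>))\<^sup>2)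
      \<partial>lborel) \<partial>P) \<longlonglongrightarrow> 0"
    "(\<lambda>k. \<integral>\<^sup>+\<omega>. ennreal ((norm (step_integral W (n k) (\<tau> k) (\<eta> k) \<omega> - J \<omega>))\<^sup>2) \<partial>P) \<longlonglongrightarrow> 0"
  using assms unfolding has_ito_integral_def
  by (elim conjE exE) (rule that, erule spec, assumption, assumption)

text \<open>The two limits may come from different approximating sequences. The isometry compares
  the step integrals through the common integrand \<open>H\<close>, and every term of the resulting
  bound tends to zero.\<close>

lemma has_ito_integral_unique:
  fixes H :: "real \<Rightarrow> 'w \<Rightarrow> real^'q^'d"
  assumes ab: "0 \<le> a" "a \<le> b" and J: "has_ito_integral P F W a b H J" and J': "has_ito_integral P F W a b H J'"
  shows "AE \<omega> in P. J \<omega> = J' \<omega>"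
proof -
  have "progressive F a b H" using J by (auto simp: has_ito_integral_def H2_space_def)
  from progressive_measurable[OF this ab] have Hm: "(\<lambda>(t, \<omega>). H t \<omega>) \<in> borel_measurable (PT a b)" .
  have Jm [measurable]: "J \<in> borel_measurable P" "J' \<in> borel_measurable P"
    using J J' by (auto simp: has_ito_integral_def)
  let ?A = "\<lambda>n \<tau> \<eta> k. \<integral>\<^sup>+\<omega>. (\<integral>\<^sup>+s\<in>{a..b}. ennreal ((norm (step_process (n k) (\<tau> k) (\<eta> k) s \<omega> - H s \<omega>))\<^sup>2) \<partial>lborel) \<partial>P"
  let ?B = "\<lambda>n \<tau> \<eta> J k. \<integral>\<^sup>+\<omega>. ennreal ((norm (step_integral W (n k) (\<tau> k) (\<eta> k) \<omega> - J \<omega>))\<^sup>2) \<partial>P"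
  obtain n \<tau> \<eta> where 1: "\<And>k. adapted_step P F a b (n k) (\<tau> k) (\<eta> k)" "?A n \<tau> \<eta> \<longlonglongrightarrow> 0" "?B n \<tau> \<eta> J \<longlonglongrightarrow> 0"
    using J by (rule has_ito_integralE) (rule that, simp_all only:)
  obtain n' \<tau>' \<eta>' where 2: "\<And>k. adapted_step P F a b (n' k) (\<tau>' k) (\<eta>' k)" "?A n' \<tau>' \<eta>' \<longlonglongrightarrow> 0" "?B n' \<tau>' \<eta>' J' \<longlonglongrightarrow> 0"
    using J' by (rule has_ito_integralE) (rule that, simp_all only:)
  have "(\<integral>\<^sup>+\<omega>. ennreal ((norm (J \<omega> - J' \<omega>))\<^sup>2) \<partial>P)
      \<le> 2 * ?B n \<tau> \<eta> J k + 2 * (2 * (2 * ?A n \<tau> \<eta> k + 2 * ?A n' \<tau>' \<eta>' k) + 2 * ?B n' \<tau>' \<eta>' J' k)" for k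
  proof -
    let ?I = "step_integral W (n k) (\<tau> k) (\<eta> k)" and ?I' = "step_integral W (n' k) (\<tau>' k) (\<eta>' k)"
    let ?f = "step_process (n k) (\<tau> k) (\<eta> k)" and ?f' = "step_process (n' k) (\<tau>' k) (\<eta>' k)"
    have [measurable]: "?I \<in> borel_measurable P" "?I' \<in> borel_measurable P"
      using step_integral_isometry(2)[OF 1(1) 1(1) ab(1)] step_integral_isometry(2)[OF 2(1) 2(1) ab(1)]
      by (auto simp: L2_space_iff)
    note [measurable] = step_process_measurable[OF 1(1) ab(1), of k] step_process_measurable[OF 2(1) ab(1), of k] Hm
    have "(\<integral>\<^sup>+\<omega>. ennreal ((norm (?I \<omega> - ?I' \<omega>))\<^sup>2) \<partial>P)
        = (\<integral>\<^sup>+x. ennreal ((norm ((\<lambda>(s, \<omega>). ?f s \<omega>) x - (\<lambda>(s, \<omega>). ?f' s \<omega>) x))\<^sup>2) \<partial>PT a b)"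
      unfolding step_integral_isometry(1)[OF 1(1) 2(1) ab(1)]
      by (subst nn_integral_PT[symmetric]) (auto)
    also have "\<dots> \<le> (\<integral>\<^sup>+x. 2 * ennreal ((norm ((\<lambda>(s, \<omega>). ?f s \<omega>) x - (\<lambda>(s, \<omega>). H s \<omega>) x))\<^sup>2)
        + 2 * ennreal ((norm ((\<lambda>(s, \<omega>). ?f' s \<omega>) x - (\<lambda>(s, \<omega>). H s \<omega>) x))\<^sup>2) \<partial>PT a b)"
      by (intro nn_integral_mono ennreal_norm_diff_sq_le)
    also have "\<dots> = 2 * (\<integral>\<^sup>+x. ennreal ((norm ((\<lambda>(s, \<omega>). ?f s \<omega>) x - (\<lambda>(s, \<omega>). H s \<omega>) x))\<^sup>2) \<partial>PT a b)
        + 2 * (\<integral>\<^sup>+x. ennreal ((norm ((\<lambda>(s, \<omega>). ?f' s \<omega>) x - (\<lambda>(s, \<omega>). H s \<omega>) x))\<^sup>2) \<partial>PT a b)"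
      by (simp add: nn_integral_add nn_integral_cmult)
    also have "\<dots> = 2 * ?A n \<tau> \<eta> k + 2 * ?A n' \<tau>' \<eta>' k"
      by (subst (1 2) nn_integral_PT[symmetric]) auto
    finally have I: "(\<integral>\<^sup>+\<omega>. ennreal ((norm (?I \<omega> - ?I' \<omega>))\<^sup>2) \<partial>P) \<le> 2 * ?A n \<tau> \<eta> k + 2 * ?A n' \<tau>' \<eta>' k" .
    have "(\<integral>\<^sup>+\<omega>. ennreal ((norm (J \<omega> - J' \<omega>))\<^sup>2) \<partial>P)
      \<le> (\<integral>\<^sup>+\<omega>. 2 * ennreal ((norm (?I \<omega> - J \<omega>))\<^sup>2) + 2 * (2 * ennreal ((norm (?I \<omega> - ?I' \<omega>))\<^sup>2) + 2 * ennreal ((norm (?I' \<omega> - J' \<omega>))\<^sup>2)) \<partial>P)"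
    proof (intro nn_integral_mono)
      fix \<omega>
      have "ennreal ((norm (J \<omega> - J' \<omega>))\<^sup>2) = ennreal ((norm ((J \<omega> - ?I \<omega>) + (?I \<omega> - J' \<omega>)))\<^sup>2)" by simp
      also have "\<dots> \<le> 2 * ennreal ((norm (J \<omega> - ?I \<omega>))\<^sup>2) + 2 * ennreal ((norm (?I \<omega> - J' \<omega>))\<^sup>2)"
        by (rule ennreal_norm_add_sq_le)
      also have "ennreal ((norm (?I \<omega> - J' \<omega>))\<^sup>2) \<le> 2 * ennreal ((norm (?I \<omega> - ?I' \<omega>))\<^sup>2) + 2 * ennreal ((norm (?I' \<omega> - J' \<omega>))\<^sup>2)"
        using ennreal_norm_add_sq_le[of "?I \<omega> - ?I' \<omega>" "?I' \<omega> - J' \<omega>"] by simp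
      finally show "ennreal ((norm (J \<omega> - J' \<omega>))\<^sup>2) \<le> 2 * ennreal ((norm (?I \<omega> - J \<omega>))\<^sup>2) + 2 * (2 * ennreal ((norm (?I \<omega> - ?I' \<omega>))\<^sup>2) + 2 * ennreal ((norm (?I' \<omega> - J' \<omega>))\<^sup>2))"
        by (simp add: norm_minus_commute add_left_mono mult_left_mono)
    qed
    also have "\<dots> = 2 * ?B n \<tau> \<eta> J k + 2 * (2 * (\<integral>\<^sup>+\<omega>. ennreal ((norm (?I \<omega> - ?I' \<omega>))\<^sup>2) \<partial>P) + 2 * ?B n' \<tau>' \<eta>' J' k)"
      by (simp add: nn_integral_add nn_integral_cmult)
    also have "\<dots> \<le> 2 * ?B n \<tau> \<eta> J k + 2 * (2 * (2 * ?A n \<tau> \<eta> k + 2 * ?A n' \<tau>' \<eta>' k) + 2 * ?B n' \<tau>' \<eta>' J' k)"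
      by (intro add_left_mono mult_left_mono add_right_mono I) auto
    finally show ?thesis .
  qed
  moreover have "(\<lambda>k. 2 * ?B n \<tau> \<eta> J k + 2 * (2 * (2 * ?A n \<tau> \<eta> k + 2 * ?A n' \<tau>' \<eta>' k) + 2 * ?B n' \<tau>' \<eta>' J' k))
      \<longlonglongrightarrow> 2 * 0 + 2 * (2 * (2 * 0 + 2 * 0) + 2 * 0)"
    by (intro tendsto_add ennreal_tendsto_cmult 1 2) auto
  ultimately have "(\<integral>\<^sup>+\<omega>. ennreal ((norm (J \<omega> - J' \<omega>))\<^sup>2) \<partial>P) \<le> 2 * 0 + 2 * (2 * (2 * 0 + 2 * 0) + 2 * 0)"
    by (intro LIMSEQ_le_const) auto
  then have "AE \<omega> in P. ennreal ((norm (J \<omega> - J' \<omega>))\<^sup>2) = 0"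
    by (subst nn_integral_0_iff_AE[symmetric]) auto
  then show ?thesis by (auto elim!: eventually_mono)
qed

text \<open>Every coefficient is known at a time \<open>\<tau> i\<close> not before
  \<open>s\<close>, so \<open>\<phi>\<close> times a coefficient is still square-integrable and
  \<open>F (\<tau> i)\<close>-measurable, and the increment after \<open>\<tau> i\<close> is
  orthogonal to it.\<close>

lemma step_integral_orthogonal:
  fixes \<eta> :: "nat \<Rightarrow> 'w \<Rightarrow> real^'q^'d"
  assumes step: "adapted_step P F s t n \<tau> \<eta>" and s: "0 \<le> s"
    and \<phi>: "\<phi> \<in> L2_space P (F s)"
  shows "(\<integral>\<omega>. \<phi> \<omega> \<bullet> step_integral W n \<tau> \<eta> \<omega> \<partial>P) = 0"
proof -
  have \<phi>L: "(\<lambda>\<omega>. \<phi> \<omega> $ a) \<in> L2_space P P" and \<phi>m: "(\<lambda>\<omega>. \<phi> \<omega> $ a) \<in> borel_measurable (F s)" for a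
  proof -
    show m: "(\<lambda>\<omega>. \<phi> \<omega> $ a) \<in> borel_measurable (F s)"
      using \<phi> measurable_compose[OF _ borel_measurable_vec_nth] by (auto simp: L2_space_iff)
    have "(\<phi> \<omega> $ a)\<^sup>2 \<le> (norm (\<phi> \<omega>))\<^sup>2" for \<omega>
      using component_le_norm_cart[of "\<phi> \<omega>" a] by (metis abs_ge_zero power2_abs power_mono)
    then show "(\<lambda>\<omega>. \<phi> \<omega> $ a) \<in> L2_space P P"
      using \<phi> measurable_F_P[OF s m] by (intro L2_spaceI_bound[where g = "\<lambda>\<omega>. (norm (\<phi> \<omega>))\<^sup>2"]) (auto simp: L2_space_iff)
  qed
  have eq: "\<phi> \<omega> \<bullet> step_integral W n \<tau> \<eta> \<omega>
      = (\<Sum>a\<in>UNIV. \<Sum>i<n. \<Sum>b\<in>UNIV. (\<eta> i \<omega> $ a $ b * \<phi> \<omega> $ a) * dW b (\<tau> i) (\<tau> (Suc i)) \<omega>)" for \<omega>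
    by (simp add: inner_vec_def step_integral_def matrix_vector_mult_def dW_def sum_distrib_left mult_ac)
  have "(\<integral>\<omega>. (\<eta> i \<omega> $ a $ b * \<phi> \<omega> $ a) * dW b (\<tau> i) (\<tau> (Suc i)) \<omega> \<partial>P) = 0"
    "integrable P (\<lambda>\<omega>. (\<eta> i \<omega> $ a $ b * \<phi> \<omega> $ a) * dW b (\<tau> i) (\<tau> (Suc i)) \<omega>)" if "i < n" for i a b
  proof -
    note e = adapted_step_entry[OF step s that]
    have "(\<lambda>\<omega>. \<phi> \<omega> $ a) \<in> borel_measurable (F (\<tau> i))"
      by (rule measurable_F_mono[OF s e(3) \<phi>m])
    then have m: "(\<lambda>\<omega>. \<eta> i \<omega> $ a $ b * \<phi> \<omega> $ a) \<in> borel_measurable (F (\<tau> i))"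
      using e(1)[of a b] by (auto simp: bounded_F_def)
    have L: "(\<lambda>\<omega>. \<eta> i \<omega> $ a $ b * \<phi> \<omega> $ a) \<in> L2_space P P"
      using e by (intro bounded_F_mult_L2[OF _ _ \<phi>L]) auto
    show "(\<integral>\<omega>. (\<eta> i \<omega> $ a $ b * \<phi> \<omega> $ a) * dW b (\<tau> i) (\<tau> (Suc i)) \<omega> \<partial>P) = 0"
      using e m L by (intro integral_mult_dW) auto
    show "integrable P (\<lambda>\<omega>. (\<eta> i \<omega> $ a $ b * \<phi> \<omega> $ a) * dW b (\<tau> i) (\<tau> (Suc i)) \<omega>)"
      using e L by (intro L2_space_mult_integrable dW_L2) auto
  qed
  then have "has_bochner_integral P (\<lambda>\<omega>. (\<eta> i \<omega> $ a $ b * \<phi> \<omega> $ a) * dW b (\<tau> i) (\<tau> (Suc i)) \<omega>) 0"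
    if "i < n" for i a b using that by (simp add: has_bochner_integral_iff)
  then have "has_bochner_integral P (\<lambda>\<omega>. \<phi> \<omega> \<bullet> step_integral W n \<tau> \<eta> \<omega>)
      (\<Sum>a\<in>(UNIV :: 'd set). \<Sum>i<n. \<Sum>b\<in>(UNIV :: 'q set). 0)"
    unfolding eq by (intro has_bochner_integral_sum) auto
  then show ?thesis by (simp add: has_bochner_integral_iff)
qed

text \<open>Orthogonality survives the limit: by Cauchy-Schwarz the pairing of \<open>\<phi>\<close>
  with \<open>N\<close> is at most the norm of \<open>\<phi>\<close> times the distance from
  \<open>N\<close> to a step integral.\<close>

lemma has_ito_integral_orthogonal:
  assumes s: "0 \<le> s" and N: "has_ito_integral P F W s t H N" and \<phi>: "\<phi> \<in> L2_space P (F s)"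
  shows "N \<in> L2_space P P" "(\<integral>\<omega>. \<phi> \<omega> \<bullet> N \<omega> \<partial>P) = 0"
proof -
  have Nm [measurable]: "N \<in> borel_measurable P" using N by (auto simp: has_ito_integral_def)
  let ?B = "\<lambda>n \<tau> \<eta> k. \<integral>\<^sup>+\<omega>. ennreal ((norm (step_integral W (n k) (\<tau> k) (\<eta> k) \<omega> - N \<omega>))\<^sup>2) \<partial>P"
  obtain n \<tau> \<eta> where 1: "\<And>k. adapted_step P F s t (n k) (\<tau> k) (\<eta> k)" "?B n \<tau> \<eta> \<longlonglongrightarrow> 0"
    using N by (rule has_ito_integralE) (rule that, simp_all only:)
  have \<phi>L: "\<phi> \<in> L2_space P P" using \<phi> measurable_F_P[OF s] by (auto simp: L2_space_iff)
  define A where "A = sqrt (\<integral>\<omega>. (norm (\<phi> \<omega>))\<^sup>2 \<partial>P)"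
  have approx: "N \<in> L2_space P P \<and> \<bar>\<integral>\<omega>. \<phi> \<omega> \<bullet> N \<omega> \<partial>P\<bar> \<le> A * e" if e: "0 < e" for e
  proof -
    have "eventually (\<lambda>k. ?B n \<tau> \<eta> k < ennreal (e\<^sup>2)) sequentially"
      using 1(2) e by (intro order_tendstoD) auto
    then obtain k where k: "?B n \<tau> \<eta> k < ennreal (e\<^sup>2)" by (auto simp: eventually_sequentially)
    let ?I = "step_integral W (n k) (\<tau> k) (\<eta> k)"
    have IL: "?I \<in> L2_space P P" by (rule step_integral_isometry(2)[OF 1(1) 1(1) s])
    have [measurable]: "?I \<in> borel_measurable P" using IL by (auto simp: L2_space_iff)
    \<comment> \<open>A finite squared distance makes the difference square-integrable, and then
      \<open>N\<close> as well.\<close>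
    have DL: "(\<lambda>\<omega>. ?I \<omega> - N \<omega>) \<in> L2_space P P"
      using k by (subst L2_space_iff_nn_integral) (auto simp: top.not_eq_extremum intro: less_trans ennreal_less_top)
    have NL: "N \<in> L2_space P P" using L2_space_diff[OF IL DL] by simp
    have "ennreal (\<integral>\<omega>. (norm (?I \<omega> - N \<omega>))\<^sup>2 \<partial>P) < ennreal (e\<^sup>2)"
      using k DL by (subst nn_integral_eq_integral[symmetric]) (auto simp: L2_space_iff)
    then have "sqrt (\<integral>\<omega>. (norm (?I \<omega> - N \<omega>))\<^sup>2 \<partial>P) \<le> e"
      using e by (auto simp: ennreal_less_iff intro!: real_le_lsqrt)
    moreover have "0 \<le> A" unfolding A_def by simp
    ultimately have "A * sqrt (\<integral>\<omega>. (norm (?I \<omega> - N \<omega>))\<^sup>2 \<partial>P) \<le> A * e" by (intro mult_left_mono)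
    then have "\<bar>\<integral>\<omega>. \<phi> \<omega> \<bullet> (?I \<omega> - N \<omega>) \<partial>P\<bar> \<le> A * e"
      using L2_space_cauchy_schwarz[OF \<phi>L DL] unfolding A_def by linarith
    moreover have "(\<integral>\<omega>. \<phi> \<omega> \<bullet> (?I \<omega> - N \<omega>) \<partial>P) = - (\<integral>\<omega>. \<phi> \<omega> \<bullet> N \<omega> \<partial>P)"
      using L2_space_inner_integrable[OF \<phi>L IL] L2_space_inner_integrable[OF \<phi>L NL]
        step_integral_orthogonal[OF 1(1) s \<phi>] by (simp add: inner_diff_right)
    ultimately show ?thesis using NL by simp
  qed
  show "N \<in> L2_space P P" using approx[of 1] by simp
  have "((\<lambda>e. A * e) \<longlongrightarrow> A * 0) (at_right 0)" by (intro tendsto_intros)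
  moreover have "eventually (\<lambda>e. \<bar>\<integral>\<omega>. \<phi> \<omega> \<bullet> N \<omega> \<partial>P\<bar> \<le> A * e) (at_right 0)"
    using approx by (auto simp: eventually_at_filter intro!: always_eventually)
  ultimately have "\<bar>\<integral>\<omega>. \<phi> \<omega> \<bullet> N \<omega> \<partial>P\<bar> \<le> A * 0"
    by (intro tendsto_lowerbound) auto
  then show "(\<integral>\<omega>. \<phi> \<omega> \<bullet> N \<omega> \<partial>P) = 0" by simp
qed

end

section \<open>Processes on a finite horizon\<close>

locale finite_horizon = stochastic_basis P F F00 W
  for P :: "'w measure" and F F00 and W :: "real \<Rightarrow> 'w \<Rightarrow> real^'q" +
  fixes T :: real
  assumes T_pos: "0 < T"
begin

abbreviation S2 :: "(real \<Rightarrow> 'w \<Rightarrow> 'v::euclidean_space) set" where "S2 \<equiv> S2_space P F 0 T"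

abbreviation H2 :: "(real \<Rightarrow> 'w \<Rightarrow> 'v::euclidean_space) set" where "H2 \<equiv> H2_space P F 0 T"

abbreviation L2_PT :: "(real \<times> 'w \<Rightarrow> 'v::euclidean_space) set" where
  "L2_PT \<equiv> L2_space (PT 0 T) (PT 0 T)"

abbreviation R :: "real measure" where "R \<equiv> restrict_space lborel {0..T}"

lemma finite_measure_R: "finite_measure R"
  using T_pos by (intro finite_measureI) (simp add: emeasure_restrict_space)

lemma finite_measure_PT: "finite_measure (PT 0 T)"
  by (rule finite_measure_pair_measure[OF finite_measure_axioms finite_measure_R])

lemma integrable_R:
  fixes f :: "real \<Rightarrow> 'v::euclidean_space"
  shows "integrable R f \<longleftrightarrow> set_integrable lborel {0..T} f"
  by (simp add: integrable_restrict_space set_integrable_def)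

lemma integral_R:
  fixes f :: "real \<Rightarrow> 'v::euclidean_space"
  shows "integral\<^sup>L R f = (LINT s:{0..T}|lborel. f s)"
  by (simp add: integral_restrict_space set_lebesgue_integral_def)

lemma continuous_on_measurable_R:
  fixes g :: "real \<Rightarrow> 'v::euclidean_space"
  assumes "continuous_on {0..T} g"
  shows "g \<in> borel_measurable R"
proof -
  have "sets R = sets (restrict_space borel {0..T})" by (rule sets_restrict_space_cong) simp
  from measurable_cong_sets[OF this refl] show ?thesis
    using borel_measurable_continuous_on_restrict[OF assms] by blast
qed

lemma progressive_at:
  assumes "progressive F 0 T Z" "t \<in> {0..T}"
  shows "Z t \<in> borel_measurable (F t)"
proof -
  have Z: "(\<lambda>(s, \<omega>). Z s \<omega>) \<in> borel_measurable (restrict_space borel {0..t} \<Otimes>\<^sub>M F t)"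
    using assms by (auto simp: progressive_def)
  have "Pair t \<in> F t \<rightarrow>\<^sub>M (restrict_space borel {0..t} \<Otimes>\<^sub>M F t)"
    using assms by (intro measurable_Pair1') (auto simp: space_restrict_space)
  from measurable_compose[OF this Z] show ?thesis by simp
qed

lemma progressive_add:
  "progressive F 0 T Z \<Longrightarrow> progressive F 0 T Z' \<Longrightarrow> progressive F 0 T (\<lambda>t \<omega>. Z t \<omega> + Z' t \<omega>)"
  unfolding progressive_def case_prod_unfold by (auto intro!: borel_measurable_add)

lemma progressive_matrix_mult:
  fixes Z :: "real \<Rightarrow> 'w \<Rightarrow> real^'n" and G :: "real \<Rightarrow> real^'n^'m"
  assumes G: "continuous_on {0..T} G" and Z: "progressive F 0 T Z"
  shows "progressive F 0 T (\<lambda>t \<omega>. G t *v Z t \<omega>)"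
  unfolding progressive_def
proof
  fix t assume t: "t \<in> {0..T}"
  let ?M = "restrict_space borel {0..t} \<Otimes>\<^sub>M F t"
  have Zm: "(\<lambda>x. Z (fst x) (snd x)) \<in> borel_measurable ?M"
    using Z t by (auto simp: progressive_def case_prod_unfold)
  have "continuous_on {0..t} G" using G t continuous_on_subset by fastforce
  then have "G \<in> borel_measurable (restrict_space borel {0..t})"
    by (rule borel_measurable_continuous_on_restrict)
  then have Gm: "(\<lambda>x. G (fst x)) \<in> borel_measurable ?M" by measurable
  show "(\<lambda>(s, \<omega>). G s *v Z s \<omega>) \<in> borel_measurable ?M"
    unfolding case_prod_unfold
    by (rule borel_measurable_continuous_Pair[OF Gm Zm])
       (auto intro!: bounded_bilinear.continuous_on[OF bounded_bilinear_matrix_vector_mult] continuous_intros)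
qed

lemma progressive_uminus: "progressive F 0 T Z \<Longrightarrow> progressive F 0 T (\<lambda>t \<omega>. - Z t \<omega>)"
  unfolding progressive_def case_prod_unfold by auto

text \<open>Tonelli's theorem turns the iterated integral in \<open>H2_space\<close> into membership
  in L^2 of the product measure, where sums, matrix factors and inner products are easy to
  handle.\<close>

lemma H2_iff:
  "Z \<in> H2 \<longleftrightarrow> progressive F 0 T Z \<and> case_prod Z \<in> L2_PT"
proof -
  have "(\<integral>\<^sup>+\<omega>. (\<integral>\<^sup>+t\<in>{0..T}. ennreal ((norm (Z t \<omega>))\<^sup>2) \<partial>lborel) \<partial>P) < \<infinity>
      \<longleftrightarrow> case_prod Z \<in> L2_PT" if "progressive F 0 T Z"
  proof -
    have [measurable]: "case_prod Z \<in> borel_measurable (PT 0 T)"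
      using progressive_measurable[OF that] T_pos by simp
    show ?thesis
      by (subst L2_space_iff_nn_integral) (auto simp: nn_integral_PT[of "\<lambda>x. ennreal ((norm (case_prod Z x))\<^sup>2)", simplified])
  qed
  then show ?thesis by (auto simp: H2_space_def)
qed

lemma L2_PT_matrix_mult:
  fixes Z :: "real \<Rightarrow> 'w \<Rightarrow> real^'n" and G :: "real \<Rightarrow> real^'n^'m"
  assumes G: "continuous_on {0..T} G" and Z: "case_prod Z \<in> L2_PT"
  shows "case_prod (\<lambda>t \<omega>. G t *v Z t \<omega>) \<in> L2_PT"
proof -
  interpret bounded_bilinear "(*v) :: real^'n^'m \<Rightarrow> real^'n \<Rightarrow> real^'m"
    by (rule bounded_bilinear_matrix_vector_mult)
  obtain c where c: "c > 0" "\<And>t x. t \<in> {0..T} \<Longrightarrow> norm (G t *v x) \<le> c * norm x"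
    using matrix_vector_mult_bounded_on[OF G] by metis
  have Zm: "case_prod Z \<in> borel_measurable (PT 0 T)" using Z by (simp add: L2_space_iff)
  have "G \<in> borel_measurable R"
    by (rule continuous_on_measurable_R[OF G])
  then have Gm: "(\<lambda>x. G (fst x)) \<in> borel_measurable (PT 0 T)" by measurable
  show ?thesis
  proof (rule L2_spaceI_bound[where g = "\<lambda>x. c\<^sup>2 * (norm (case_prod Z x))\<^sup>2"])
    show "case_prod (\<lambda>t \<omega>. G t *v Z t \<omega>) \<in> borel_measurable (PT 0 T)"
      unfolding case_prod_unfold
      by (rule borel_measurable_continuous_Pair[OF Gm Zm[unfolded case_prod_unfold]])
         (auto intro!: continuous_on continuous_intros)
    show "integrable (PT 0 T) (\<lambda>x. c\<^sup>2 * (norm (case_prod Z x))\<^sup>2)"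
      using Z by (simp add: L2_space_iff)
    have "(norm (G t *v Z t \<omega>))\<^sup>2 \<le> c\<^sup>2 * (norm (Z t \<omega>))\<^sup>2" if "t \<in> {0..T}" for t \<omega>
      using power_mono[OF c(2)[OF that, of "Z t \<omega>"] norm_ge_zero, of 2] by (simp add: power_mult_distrib)
    then show "AE x in PT 0 T. (norm (case_prod (\<lambda>t \<omega>. G t *v Z t \<omega>) x))\<^sup>2 \<le> c\<^sup>2 * (norm (case_prod Z x))\<^sup>2"
      by (intro AE_I2) (auto simp: space_pair_measure space_restrict_space)
  qed
qed

lemma L2_PT_deterministic:
  fixes g :: "real \<Rightarrow> 'v::euclidean_space"
  assumes g: "continuous_on {0..T} g"
  shows "case_prod (\<lambda>t \<omega>. g t) \<in> L2_PT"
proof -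
  interpret PT: finite_measure "PT 0 T" by (rule finite_measure_PT)
  obtain c where c: "c > 0" "\<And>t. t \<in> {0..T} \<Longrightarrow> norm (g t) \<le> c"
    using continuous_on_Icc_bounded[OF g] by metis
  have "g \<in> borel_measurable R"
    by (rule continuous_on_measurable_R[OF g])
  then have gm: "(\<lambda>x. g (fst x)) \<in> borel_measurable (PT 0 T)" by measurable
  show ?thesis
    using c gm by (intro L2_spaceI_bound[where g = "\<lambda>_. c\<^sup>2"])
      (auto simp: case_prod_unfold space_pair_measure space_restrict_space intro!: AE_I2 power_mono)
qed

lemma H2_add:
  assumes "Z \<in> H2" "Z' \<in> H2"
  shows "(\<lambda>t \<omega>. Z t \<omega> + Z' t \<omega>) \<in> H2"
  using assms L2_space_add[of "case_prod Z" _ "case_prod Z'"]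
  by (auto simp: H2_iff progressive_add case_prod_unfold)

lemma H2_uminus: "Z \<in> H2 \<Longrightarrow> (\<lambda>t \<omega>. - Z t \<omega>) \<in> H2"
  using L2_space_uminus[of "case_prod Z"]
  by (auto simp: H2_iff progressive_uminus case_prod_unfold)

lemma H2_diff:
  assumes "Z \<in> H2" "Z' \<in> H2"
  shows "(\<lambda>t \<omega>. Z t \<omega> - Z' t \<omega>) \<in> H2"
  using H2_add[OF assms(1) H2_uminus[OF assms(2)]] by simp

lemma H2_matrix_mult:
  fixes Z :: "real \<Rightarrow> 'w \<Rightarrow> real^'n" and G :: "real \<Rightarrow> real^'n^'m"
  assumes "continuous_on {0..T} G" "Z \<in> H2"
  shows "(\<lambda>t \<omega>. G t *v Z t \<omega>) \<in> H2"
  using assms progressive_matrix_mult L2_PT_matrix_mult by (auto simp: H2_iff)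

lemma H2_deterministic:
  fixes f :: "real \<Rightarrow> 'v::euclidean_space"
  assumes f: "continuous_on {0..T} f"
  shows "(\<lambda>t \<omega>. f t) \<in> H2"
proof -
  have "f \<in> borel_measurable (restrict_space borel {0..t})" if "t \<in> {0..T}" for t
    using that by (intro borel_measurable_continuous_on_restrict continuous_on_subset[OF f]) auto
  then have "progressive F 0 T (\<lambda>t \<omega>. f t)"
    unfolding progressive_def case_prod_unfold by (auto intro!: measurable_compose[OF measurable_fst])
  then show ?thesis using L2_PT_deterministic[OF f] by (simp add: H2_iff)
qed

text \<open>The running supremum dominates the value at each single time, so every time is
  available, the terminal one included; for \<open>H2_space\<close> the corresponding fact
  \<open>H2_at\<close> holds at almost every time.\<close>

lemma S2_at:
  assumes Z: "Z \<in> S2" and t: "t \<in> {0..T}"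
  shows "Z t \<in> L2_space P (F t)" "Z t \<in> L2_space P P"
proof -
  have m: "Z t \<in> borel_measurable (F t)" using Z t by (auto simp: S2_space_def intro: progressive_at)
  have [measurable]: "Z t \<in> borel_measurable P" using measurable_F_P[OF _ m] t by simp
  have "(\<integral>\<^sup>+\<omega>. ennreal ((norm (Z t \<omega>))\<^sup>2) \<partial>P) \<le> (\<integral>\<^sup>+\<omega>. (SUP t\<in>{0..T}. ennreal ((norm (Z t \<omega>))\<^sup>2)) \<partial>P)"
    using t by (intro nn_integral_mono SUP_upper)
  also have "\<dots> < \<infinity>" using Z by (simp add: S2_space_def)
  finally show "Z t \<in> L2_space P P" by (subst L2_space_iff_nn_integral) auto
  then show "Z t \<in> L2_space P (F t)" using m by (simp add: L2_space_iff)
qed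

lemma S2_H2:
  assumes Z: "Z \<in> S2"
  shows "Z \<in> H2"
proof -
  let ?S = "\<lambda>\<omega>. SUP t\<in>{0..T}. ennreal ((norm (Z t \<omega>))\<^sup>2)"
  have "(\<integral>\<^sup>+\<omega>. (\<integral>\<^sup>+t\<in>{0..T}. ennreal ((norm (Z t \<omega>))\<^sup>2) \<partial>lborel) \<partial>P) \<le> (\<integral>\<^sup>+\<omega>. ennreal T * ?S \<omega> \<partial>P)"
  proof (rule nn_integral_mono)
    fix \<omega>
    have "(\<integral>\<^sup>+t\<in>{0..T}. ennreal ((norm (Z t \<omega>))\<^sup>2) \<partial>lborel) \<le> (\<integral>\<^sup>+t. ?S \<omega> * indicator {0..T} t \<partial>lborel)"
      by (intro nn_integral_mono) (auto simp: indicator_def intro: SUP_upper)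
    also have "\<dots> = ennreal T * ?S \<omega>" using T_pos by (subst nn_integral_cmult_indicator) (simp_all add: mult.commute)
    finally show "(\<integral>\<^sup>+t\<in>{0..T}. ennreal ((norm (Z t \<omega>))\<^sup>2) \<partial>lborel) \<le> ennreal T * ?S \<omega>" .
  qed
  also have "\<dots> \<le> ennreal T * (\<integral>\<^sup>+\<omega>. ?S \<omega> \<partial>P)" using T_pos by (rule nn_integral_cmult_le)
  also have "\<dots> < \<infinity>" using Z by (simp add: S2_space_def ennreal_mult_less_top)
  finally show ?thesis using Z by (simp add: S2_space_def H2_space_def)
qed

lemma L2_PT_path:
  fixes Z :: "real \<Rightarrow> 'w \<Rightarrow> 'v::euclidean_space"
  assumes Z: "case_prod Z \<in> L2_PT"
  shows "AE \<omega> in P. (\<lambda>t. Z t \<omega>) \<in> L2_space R R"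
proof -
  interpret pair_sigma_finite R P by (rule pair_PT)
  have "integrable (PT 0 T) (\<lambda>(t, \<omega>). (norm (Z t \<omega>))\<^sup>2)" and Zm: "case_prod Z \<in> borel_measurable (PT 0 T)"
    using Z by (auto simp: L2_space_iff case_prod_unfold)
  from AE_integrable_snd[OF this(1)] AE_space show ?thesis
  proof eventually_elim
    case (elim \<omega>)
    have "(\<lambda>t. (t, \<omega>)) \<in> R \<rightarrow>\<^sub>M PT 0 T" using elim by (intro measurable_Pair2')
    from measurable_compose[OF this Zm] show ?case using elim by (simp add: L2_space_iff)
  qed
qed

lemma L2_R_set_integrable:
  fixes f :: "real \<Rightarrow> 'v::euclidean_space"
  shows "f \<in> L2_space R R \<Longrightarrow> set_integrable lborel {0..T} f"
  using finite_measure.L2_space_integrable[OF finite_measure_R] integrable_R by blast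

lemma L2_PT_set_integrable:
  fixes Z :: "real \<Rightarrow> 'w \<Rightarrow> 'v::euclidean_space"
  assumes "case_prod Z \<in> L2_PT"
  shows "AE \<omega> in P. set_integrable lborel {0..T} (\<lambda>t. Z t \<omega>)"
  using L2_PT_path[OF assms] by eventually_elim (rule L2_R_set_integrable)

lemma L2_PT_at:
  fixes Z :: "real \<Rightarrow> 'w \<Rightarrow> 'v::euclidean_space"
  assumes Z: "case_prod Z \<in> L2_PT"
  shows "AE t in R. Z t \<in> L2_space P P"
proof -
  interpret pair_sigma_finite R P by (rule pair_PT)
  have "integrable (PT 0 T) (\<lambda>(t, \<omega>). (norm (Z t \<omega>))\<^sup>2)" and Zm: "case_prod Z \<in> borel_measurable (PT 0 T)"
    using Z by (auto simp: L2_space_iff case_prod_unfold)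
  from AE_integrable_fst[OF this(1)] AE_space show ?thesis
  proof eventually_elim
    case (elim t)
    have "Pair t \<in> P \<rightarrow>\<^sub>M PT 0 T" using elim by (intro measurable_Pair1')
    from measurable_compose[OF this Zm] show ?case using elim by (simp add: L2_space_iff)
  qed
qed

lemma H2_at:
  assumes Z: "Z \<in> H2"
  shows "AE t in R. Z t \<in> L2_space P (F t)"
proof -
  have "case_prod Z \<in> L2_PT" and p: "progressive F 0 T Z" using Z by (auto simp: H2_iff)
  from L2_PT_at[OF this(1)] AE_space show ?thesis
  proof eventually_elim
    case (elim t)
    then have "t \<in> {0..T}" by (simp add: space_restrict_space)
    then show ?case using elim progressive_at[OF p] by (simp add: L2_space_iff)
  qed
qed

text \<open>Fubini's theorem in the forms that are needed: the cost is an expectation of path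
  integrals, estimates are made on the product space, and orthogonality is applied time by
  time.\<close>

lemma expectation_path_integral:
  fixes f :: "real \<Rightarrow> 'w \<Rightarrow> real"
  assumes f: "integrable (PT 0 T) (case_prod f)"
  shows "integrable P (\<lambda>\<omega>. LINT t:{0..T}|lborel. f t \<omega>)"
    and "(\<integral>\<omega>. (LINT t:{0..T}|lborel. f t \<omega>) \<partial>P) = integral\<^sup>L (PT 0 T) (case_prod f)"
    and "(\<integral>\<omega>. (LINT t:{0..T}|lborel. f t \<omega>) \<partial>P) = (\<integral>t. (\<integral>\<omega>. f t \<omega> \<partial>P) \<partial>R)"
    and "AE \<omega> in P. set_integrable lborel {0..T} (\<lambda>t. f t \<omega>)"
proof -
  interpret pair_sigma_finite R P by (rule pair_PT)
  show "integrable P (\<lambda>\<omega>. LINT t:{0..T}|lborel. f t \<omega>)"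
    and "(\<integral>\<omega>. (LINT t:{0..T}|lborel. f t \<omega>) \<partial>P) = integral\<^sup>L (PT 0 T) (case_prod f)"
    and "(\<integral>\<omega>. (LINT t:{0..T}|lborel. f t \<omega>) \<partial>P) = (\<integral>t. (\<integral>\<omega>. f t \<omega> \<partial>P) \<partial>R)"
    unfolding integral_R[symmetric]
    using integrable_snd[OF f] integral_snd[OF f] integral_fst[OF f] by simp_all
  show "AE \<omega> in P. set_integrable lborel {0..T} (\<lambda>t. f t \<omega>)"
    using AE_integrable_snd[OF f] unfolding integrable_R .
qed

lemma L2_PT_inner_integrable:
  fixes Z Z' :: "real \<Rightarrow> 'w \<Rightarrow> 'v::euclidean_space"
  assumes "case_prod Z \<in> L2_PT" "case_prod Z' \<in> L2_PT"
  shows "integrable (PT 0 T) (case_prod (\<lambda>t \<omega>. Z t \<omega> \<bullet> Z' t \<omega>))"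
  using L2_space_inner_integrable[OF assms] by (simp add: case_prod_unfold)

end

section \<open>The state equation\<close>

context finite_horizon
begin

text \<open>The exceptional null set depends on the time. A countable dense set of times allows the
  null sets to be united, and path continuity fills in the other times.\<close>

lemma AE_eq_of_continuous:
  fixes N N' :: "real \<Rightarrow> 'w \<Rightarrow> 'v::real_normed_vector"
  assumes N: "AE \<omega> in P. continuous_on {0..T} (\<lambda>t. N t \<omega>)" and N': "AE \<omega> in P. continuous_on {0..T} (\<lambda>t. N' t \<omega>)"
    and eq: "\<And>t. t \<in> {0..T} \<Longrightarrow> AE \<omega> in P. N t \<omega> = N' t \<omega>"
  shows "AE \<omega> in P. \<forall>t\<in>{0..T}. N t \<omega> = N' t \<omega>"
proof -
  obtain D :: "real set" where D: "countable D" "\<And>X. open X \<Longrightarrow> X \<noteq> {} \<Longrightarrow> \<exists>d\<in>D. d \<in> X"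
    using countable_dense_exists by metis
  have "x \<in> closure D" for x
    unfolding closure_approachable
  proof (intro allI impI)
    fix e :: real assume "0 < e"
    then show "\<exists>y\<in>D. dist y x < e" using D(2)[of "ball x e"] by (auto simp: dist_commute)
  qed
  \<comment> \<open>A dense set stays dense in an open set, hence the open interval; its closure is
    all of [0,T] because \<open>0 < T\<close>.\<close>
  then have "closure ({0<..<T} \<inter> D) = closure {0<..<T}"
    by (intro closure_open_Int_superset) auto
  then have cl: "closure ({0<..<T} \<inter> D) = {0..T}"
    using T_pos by simp
  have "AE \<omega> in P. \<forall>t\<in>{0<..<T} \<inter> D. N t \<omega> = N' t \<omega>"
    using D(1) eq by (subst AE_ball_countable) auto
  with N N' show ?thesis
  proof eventually_elim
    case (elim \<omega>)
    show ?case
    proof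
      fix t assume t: "t \<in> {0..T}"
      have "N t \<omega> - N' t \<omega> = 0"
        by (rule continuous_constant_on_closure[of "{0<..<T} \<inter> D" "\<lambda>t. N t \<omega> - N' t \<omega>"])
           (use elim t in \<open>auto simp: cl intro!: continuous_on_diff\<close>)
      then show "N t \<omega> = N' t \<omega>" by simp
    qed
  qed
qed

text \<open>The moving upper limit is put into the integrand as a condition on \<open>s\<close> over
  the fixed interval [0,t], so that measurability of parameter integrals applies. Working over
  \<open>F t\<close> for each \<open>t\<close> gives progressive and not only joint
  measurability.\<close>

lemma progressive_integral:
  fixes g :: "real \<Rightarrow> 'w \<Rightarrow> 'v::euclidean_space"
  assumes g: "progressive F 0 T g"
  shows "progressive F 0 T (\<lambda>t \<omega>. LINT s:{0..t}|lborel. g s \<omega>)"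
  unfolding progressive_def
proof
  fix t assume t: "t \<in> {0..T}"
  let ?M = "restrict_space borel {0..t} \<Otimes>\<^sub>M F t" and ?L = "restrict_space lborel {0..t}"
  have gm: "(\<lambda>(s, \<omega>). g s \<omega>) \<in> borel_measurable ?M"
    using g t by (auto simp: progressive_def)
  have "(\<lambda>x. x) \<in> ?L \<rightarrow>\<^sub>M restrict_space borel {0..t}"
    by (subst measurable_cong_sets[of _ "restrict_space borel {0..t}"]) (auto intro!: sets_restrict_space_cong)
  then have id: "snd \<in> ?M \<Otimes>\<^sub>M ?L \<rightarrow>\<^sub>M restrict_space borel {0..t}"
    using measurable_compose[OF measurable_snd] by fastforce
  have real: "(\<lambda>x. x) \<in> borel_measurable (restrict_space borel {0..t})"
    by (rule measurable_restrict_space1) simp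
  have s: "snd \<in> borel_measurable (?M \<Otimes>\<^sub>M ?L)"
    using measurable_compose[OF id real] by simp
  have u: "(\<lambda>x. fst (fst x)) \<in> borel_measurable (?M \<Otimes>\<^sub>M ?L)"
    by (rule measurable_compose[OF measurable_compose[OF measurable_fst measurable_fst] real])
  have "(\<lambda>x. (snd x, snd (fst x))) \<in> ?M \<Otimes>\<^sub>M ?L \<rightarrow>\<^sub>M ?M"
    by (intro measurable_Pair id) measurable
  from measurable_compose[OF this gm]
  have gg: "(\<lambda>x. g (snd x) (snd (fst x))) \<in> borel_measurable (?M \<Otimes>\<^sub>M ?L)" by simp
  have "(\<lambda>(x, s). if s \<le> fst x then g s (snd x) else 0) \<in> borel_measurable (?M \<Otimes>\<^sub>M ?L)"
    unfolding case_prod_unfold using s u gg by measurable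
  from sigma_finite_measure.borel_measurable_lebesgue_integral[OF sigma_finite_Icc this]
  have "(\<lambda>x. \<integral>s. (if s \<le> fst x then g s (snd x) else 0) \<partial>?L) \<in> borel_measurable ?M" .
  moreover have "(\<integral>s. (if s \<le> fst x then g s (snd x) else 0) \<partial>?L) = (case x of (u, \<omega>) \<Rightarrow> LINT s:{0..u}|lborel. g s \<omega>)"
    if "x \<in> space ?M" for x
  proof -
    have "fst x \<in> {0..t}" using that by (auto simp: space_pair_measure space_restrict_space)
    then have "indicator {0..t} s *\<^sub>R (if s \<le> fst x then g s (snd x) else 0) = indicator {0..fst x} s *\<^sub>R g s (snd x)" for s
      by (auto simp: indicator_def)
    then show ?thesis
      by (simp add: integral_restrict_space set_lebesgue_integral_def case_prod_unfold)
  qed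
  ultimately show "(\<lambda>(u, \<omega>). LINT s:{0..u}|lborel. g s \<omega>) \<in> borel_measurable ?M"
    by (subst measurable_cong[symmetric]) auto
qed

text \<open>\<open>nn_integral_add_le\<close> asks for one measurable summand, but neither running
  supremum is known to be measurable. The perturbation \<open>D\<close> therefore comes with a
  measurable majorant \<open>Y\<close> of its squared norm.\<close>

lemma S2_add_dominated:
  assumes X: "X \<in> S2" and D: "progressive F 0 T D"
    and Y [measurable]: "Y \<in> borel_measurable P" and Y_fin: "(\<integral>\<^sup>+\<omega>. Y \<omega> \<partial>P) < \<infinity>"
    and le: "AE \<omega> in P. \<forall>t\<in>{0..T}. ennreal ((norm (D t \<omega>))\<^sup>2) \<le> Y \<omega>"
  shows "(\<lambda>t \<omega>. X t \<omega> + D t \<omega>) \<in> S2"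
proof -
  let ?S = "\<lambda>\<omega>. SUP t\<in>{0..T}. ennreal ((norm (X t \<omega>))\<^sup>2)"
  have "(\<integral>\<^sup>+\<omega>. (SUP t\<in>{0..T}. ennreal ((norm (X t \<omega> + D t \<omega>))\<^sup>2)) \<partial>P)
      \<le> (\<integral>\<^sup>+\<omega>. ennreal 2 * ?S \<omega> + 2 * Y \<omega> \<partial>P)"
  proof (rule nn_integral_mono_AE, use le in eventually_elim)
    case (elim \<omega>)
    show ?case
    proof (rule SUP_least)
      fix t assume t: "t \<in> {0..T}"
      have "ennreal ((norm (X t \<omega> + D t \<omega>))\<^sup>2) \<le> 2 * ennreal ((norm (X t \<omega>))\<^sup>2) + 2 * ennreal ((norm (D t \<omega>))\<^sup>2)"
        by (rule ennreal_norm_add_sq_le)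
      also have "\<dots> \<le> 2 * ?S \<omega> + 2 * Y \<omega>"
        using t elim by (intro add_mono mult_left_mono SUP_upper) auto
      finally show "ennreal ((norm (X t \<omega> + D t \<omega>))\<^sup>2) \<le> ennreal 2 * ?S \<omega> + 2 * Y \<omega>" by simp
    qed
  qed
  also have "\<dots> \<le> (\<integral>\<^sup>+\<omega>. ennreal 2 * ?S \<omega> \<partial>P) + (\<integral>\<^sup>+\<omega>. 2 * Y \<omega> \<partial>P)"
    by (rule nn_integral_add_le) simp
  also have "\<dots> \<le> ennreal 2 * (\<integral>\<^sup>+\<omega>. ?S \<omega> \<partial>P) + 2 * (\<integral>\<^sup>+\<omega>. Y \<omega> \<partial>P)"
    by (intro add_mono nn_integral_cmult_le) (auto simp: nn_integral_cmult)
  also have "\<dots> < \<infinity>"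
    using X Y_fin by (simp add: S2_space_def ennreal_mult_less_top)
  finally show ?thesis using progressive_add[OF _ D] X by (auto simp: S2_space_def)
qed

text \<open>Supplies the measurable majorant for \<open>S2_add_dominated\<close>: by Cauchy-Schwarz
  in time, the squared norm of the integral over [0,t] is at most \<open>T\<close> times the time
  integral of the squared norm, uniformly in \<open>t\<close>.\<close>

lemma path_integral_bound:
  fixes h :: "real \<Rightarrow> 'w \<Rightarrow> 'v::euclidean_space"
  assumes hL: "case_prod h \<in> L2_PT"
  shows "(\<lambda>\<omega>. \<integral>\<^sup>+t. ennreal ((norm (h t \<omega>))\<^sup>2) \<partial>R) \<in> borel_measurable P"
    and "(\<integral>\<^sup>+\<omega>. (\<integral>\<^sup>+t. ennreal ((norm (h t \<omega>))\<^sup>2) \<partial>R) \<partial>P) < \<infinity>"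
    and "AE \<omega> in P. \<forall>t\<in>{0..T}. ennreal ((norm (LINT s:{0..t}|lborel. h s \<omega>))\<^sup>2)
      \<le> ennreal T * (\<integral>\<^sup>+t. ennreal ((norm (h t \<omega>))\<^sup>2) \<partial>R)"
proof -
  have hm [measurable]: "case_prod h \<in> borel_measurable (PT 0 T)" using hL by (simp add: L2_space_iff)
  interpret RP: pair_sigma_finite R P by (rule pair_PT)
  show "(\<lambda>\<omega>. \<integral>\<^sup>+t. ennreal ((norm (h t \<omega>))\<^sup>2) \<partial>R) \<in> borel_measurable P" by measurable
  have "(\<lambda>x. ennreal ((norm (case_prod h x))\<^sup>2)) \<in> borel_measurable (PT 0 T)" using hm by measurable
  from RP.nn_integral_snd[OF this]
  have "(\<integral>\<^sup>+\<omega>. (\<integral>\<^sup>+t. ennreal ((norm (h t \<omega>))\<^sup>2) \<partial>R) \<partial>P) = (\<integral>\<^sup>+x. ennreal ((norm (case_prod h x))\<^sup>2) \<partial>PT 0 T)"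
    by simp
  also have "\<dots> < \<infinity>"
    using hL L2_space_iff_nn_integral[OF hm] by blast
  finally show "(\<integral>\<^sup>+\<omega>. (\<integral>\<^sup>+t. ennreal ((norm (h t \<omega>))\<^sup>2) \<partial>R) \<partial>P) < \<infinity>" .
  show "AE \<omega> in P. \<forall>t\<in>{0..T}. ennreal ((norm (LINT s:{0..t}|lborel. h s \<omega>))\<^sup>2)
      \<le> ennreal T * (\<integral>\<^sup>+t. ennreal ((norm (h t \<omega>))\<^sup>2) \<partial>R)"
    using L2_PT_path[OF hL]
  proof eventually_elim
    case (elim \<omega>)
    show ?case
    proof
      fix t assume t: "t \<in> {0..T}"
      interpret RR: finite_measure R by (rule finite_measure_R)
      have norm_L2: "(\<lambda>s. norm (h s \<omega>)) \<in> L2_space R R" and one: "(\<lambda>s. 1 :: real) \<in> L2_space R R"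
        using elim by (auto simp: L2_space_iff)
      define q where "q = (\<integral>s. (norm (h s \<omega>))\<^sup>2 \<partial>R)"
      have q: "0 \<le> q" unfolding q_def by simp
      have norm_int: "set_integrable lborel {0..T} (\<lambda>s. norm (h s \<omega>))" by (rule L2_R_set_integrable[OF norm_L2])
      have "norm (LINT s:{0..t}|lborel. h s \<omega>) \<le> (LINT s:{0..t}|lborel. norm (h s \<omega>))"
        using integral_norm_bound[of lborel "\<lambda>s. indicator {0..t} s *\<^sub>R h s \<omega>"]
        by (simp add: set_lebesgue_integral_def)
      also have "\<dots> \<le> (LINT s:{0..T}|lborel. norm (h s \<omega>))"
        unfolding set_lebesgue_integral_def
        using t norm_int set_integrable_subset[OF norm_int, of "{0..t}"]
        by (intro integral_mono) (auto simp: set_integrable_def indicator_def)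
      also have "\<dots> = (\<integral>s. norm (h s \<omega>) \<bullet> 1 \<partial>R)" by (simp add: integral_R)
      also have "\<dots> \<le> sqrt (\<integral>s. (norm (norm (h s \<omega>)))\<^sup>2 \<partial>R) * sqrt (\<integral>s. (norm (1 :: real))\<^sup>2 \<partial>R)"
        using L2_space_cauchy_schwarz[OF norm_L2 one] by (rule abs_le_D1)
      also have "\<dots> = sqrt (q * T)"
        using T_pos by (simp add: q_def real_sqrt_mult measure_restrict_space)
      finally have "(norm (LINT s:{0..t}|lborel. h s \<omega>))\<^sup>2 \<le> (sqrt (q * T))\<^sup>2" by (intro power_mono) auto
      then have "ennreal ((norm (LINT s:{0..t}|lborel. h s \<omega>))\<^sup>2) \<le> ennreal (T * q)"
        using q T_pos by (intro ennreal_leI) (simp add: mult.commute)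
      also have "\<dots> = ennreal T * ennreal q" using q T_pos by (simp add: ennreal_mult)
      also have "ennreal q = (\<integral>\<^sup>+s. ennreal ((norm (h s \<omega>))\<^sup>2) \<partial>R)"
        unfolding q_def using elim by (intro nn_integral_eq_integral[symmetric]) (auto simp: L2_space_iff)
      finally show "ennreal ((norm (LINT s:{0..t}|lborel. h s \<omega>))\<^sup>2)
        \<le> ennreal T * (\<integral>\<^sup>+t. ennreal ((norm (h t \<omega>))\<^sup>2) \<partial>R)" .
    qed
  qed
qed

lemma integral_S2:
  fixes h :: "real \<Rightarrow> 'w \<Rightarrow> 'v::euclidean_space"
  assumes h: "h \<in> H2"
  shows "(\<lambda>t \<omega>. LINT s:{0..t}|lborel. h s \<omega>) \<in> S2"
proof -
  have hL: "case_prod h \<in> L2_PT" using h by (simp add: H2_iff)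
  have "{0..T} \<noteq> {}" using T_pos by simp
  \<comment> \<open>The zero process is the starting point, to which the integral is added as a
    dominated perturbation.\<close>
  then have "(\<lambda>t \<omega>. 0 :: 'v) \<in> S2"
    by (simp add: S2_space_def progressive_def)
  from S2_add_dominated[OF this progressive_integral _ _ path_integral_bound(3)[OF hL]]
  show ?thesis
    using h path_integral_bound(1,2)[OF hL] by (auto simp: H2_iff nn_integral_cmult ennreal_mult_less_top)
qed

end

section \<open>The factorised kernel and the states of different controls\<close>

locale linear_volterra = finite_horizon P F F00 W T
  for P :: "'w measure" and F F00 and W :: "real \<Rightarrow> 'w \<Rightarrow> real^'q" and T +
  fixes K :: "real \<Rightarrow> real \<Rightarrow> real^'d^'d" and Mop :: "(real \<Rightarrow> real^'d) \<Rightarrow> real \<Rightarrow> real^'d"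
    and A C :: "real \<Rightarrow> real^'d^'d" and B :: "real \<Rightarrow> real^'k^'d" and Sig :: "real \<Rightarrow> 'w \<Rightarrow> real^'q^'d"
  assumes K_diag: "\<And>t. t \<in> {0..T} \<Longrightarrow> K t t = mat 1"
    and K_mult: "\<And>s u t. s \<in> {0..T} \<Longrightarrow> u \<in> {0..T} \<Longrightarrow> t \<in> {0..T} \<Longrightarrow> K t s = K t u ** K u s"
    and K_cont: "continuous_on {0..T} (\<lambda>t. K t 0)"
    and A_cont: "continuous_on {0..T} A" and B_cont: "continuous_on {0..T} B" and C_cont: "continuous_on {0..T} C"
begin

abbreviation state where "state \<equiv> is_controlled_state P F W T K Mop A B C Sig"

lemma K_inverse: "t \<in> {0..T} \<Longrightarrow> K t 0 ** K 0 t = mat 1" "t \<in> {0..T} \<Longrightarrow> K 0 t ** K t 0 = mat 1"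
  using K_mult[of t 0 t] K_mult[of 0 t 0] K_diag[of t] K_diag[of 0] T_pos by auto

text \<open>\<open>K 0 t\<close> inverts \<open>K t 0\<close>, so its continuity is that of matrix
  inversion along a continuous path.\<close>

lemma K_cont': "continuous_on {0..T} (\<lambda>t. K 0 t)"
  by (rule continuous_on_matrix_inverse[OF K_cont K_inverse(1)])

lemma K_split: "s \<in> {0..T} \<Longrightarrow> t \<in> {0..T} \<Longrightarrow> K t s = K t 0 ** K 0 s"
  using K_mult[of s 0 t] T_pos by auto

lemma K_cont_right: "t \<in> {0..T} \<Longrightarrow> continuous_on {0..T} (\<lambda>s. K t s)"
  by (rule continuous_on_eq[of _ "\<lambda>s. K t 0 ** K 0 s"]) (auto intro!: continuous_intros K_cont' simp: K_split[symmetric])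

lemma K_integrable:
  assumes t: "t \<in> {0..T}" and f: "set_integrable lborel {0..T} f"
  shows "set_integrable lborel {0..t} (\<lambda>s. K t s *v f s)"
  using t by (intro set_integrable_subset[OF set_integrable_matrix_vector_mult[OF K_cont_right[OF t] f]]) auto

text \<open>The dependence on the upper time is moved out of the integral as the factor
  \<open>K t 0\<close>; what remains is an indefinite integral of a fixed integrand.\<close>

lemma K_integral:
  assumes t: "t \<in> {0..T}" and f: "set_integrable lborel {0..T} f"
  shows "(LINT s:{0..t}|lborel. K t s *v f s) = K t 0 *v (LINT s:{0..t}|lborel. K 0 s *v f s)"
proof -
  have int: "set_integrable lborel {0..t} (\<lambda>s. K 0 s *v f s)"
    using t by (intro set_integrable_subset[OF set_integrable_matrix_vector_mult[OF K_cont' f]]) auto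
  have "(LINT s:{0..t}|lborel. K t s *v f s) = (LINT s:{0..t}|lborel. K t 0 *v (K 0 s *v f s))"
    using t by (intro set_lebesgue_integral_cong) (auto simp: K_split[OF _ t, symmetric] matrix_vector_mul_assoc)
  then show ?thesis by (simp add: set_integral_matrix_vector_mult[OF int])
qed

lemma drift_H2:
  assumes "X \<in> H2" "\<alpha> \<in> H2"
  shows "(\<lambda>s \<omega>. A s *v X s \<omega> + B s *v \<alpha> s \<omega>) \<in> H2"
  by (intro H2_add H2_matrix_mult A_cont B_cont assms)

lemma drift_path_integrable:
  assumes "X \<in> H2" "\<alpha> \<in> H2" and m: "continuous_on {0..T} m"
  shows "AE \<omega> in P. set_integrable lborel {0..T} (\<lambda>s. A s *v X s \<omega> + B s *v \<alpha> s \<omega> + C s *v m s)"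
proof -
  have Cm: "set_integrable lborel {0..T} (\<lambda>s. C s *v m s)"
    by (intro set_integrable_continuous_Icc continuous_intros C_cont m)
  have "AE \<omega> in P. set_integrable lborel {0..T} (\<lambda>s. A s *v X s \<omega> + B s *v \<alpha> s \<omega>)"
    using drift_H2[OF assms(1,2)] by (intro L2_PT_set_integrable) (simp add: H2_iff)
  then show ?thesis by eventually_elim (rule set_integral_add(1)[OF _ Cm])
qed

text \<open>The terms with \<open>\<xi>\<close>, \<open>Mop m\<close>, \<open>C\<close> and the
  noise are common to both equations and cancel. For the noise this takes
  \<open>has_ito_integral_unique\<close> and path continuity, because each state comes with its own
  version \<open>N\<close> or \<open>N'\<close> of the stochastic integral.\<close>

lemma state_difference:
  assumes X: "state m \<xi> \<alpha> X" and X': "state m \<xi> \<beta> X'"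
    and \<alpha>: "\<alpha> \<in> H2" and \<beta>: "\<beta> \<in> H2" and m: "continuous_on {0..T} m"
  shows "AE \<omega> in P. \<forall>t\<in>{0..T}. X' t \<omega> - X t \<omega>
    = (LINT s:{0..t}|lborel. K t s *v (A s *v (X' s \<omega> - X s \<omega>) + B s *v (\<beta> s \<omega> - \<alpha> s \<omega>)))"
proof -
  let ?V = "\<lambda>s \<omega>. A s *v X s \<omega> + B s *v \<alpha> s \<omega> + C s *v m s"
  let ?V' = "\<lambda>s \<omega>. A s *v X' s \<omega> + B s *v \<beta> s \<omega> + C s *v m s"
  obtain N where N: "AE \<omega> in P. continuous_on {0..T} (\<lambda>t. N t \<omega>)"
    "\<forall>t\<in>{0..T}. has_ito_integral P F W 0 t (\<lambda>s \<omega>. K t s ** Sig s \<omega>) (N t)"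
    "AE \<omega> in P. \<forall>t\<in>{0..T}. X t \<omega> = K t 0 *v \<xi> \<omega> + Mop m t + (LINT s:{0..t}|lborel. K t s *v ?V s \<omega>) + N t \<omega>"
    using X unfolding is_controlled_state_def by blast
  obtain N' where N': "AE \<omega> in P. continuous_on {0..T} (\<lambda>t. N' t \<omega>)"
    "\<forall>t\<in>{0..T}. has_ito_integral P F W 0 t (\<lambda>s \<omega>. K t s ** Sig s \<omega>) (N' t)"
    "AE \<omega> in P. \<forall>t\<in>{0..T}. X' t \<omega> = K t 0 *v \<xi> \<omega> + Mop m t + (LINT s:{0..t}|lborel. K t s *v ?V' s \<omega>) + N' t \<omega>"
    using X' unfolding is_controlled_state_def by blast
  have NN': "AE \<omega> in P. \<forall>t\<in>{0..T}. N t \<omega> = N' t \<omega>"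
  proof (rule AE_eq_of_continuous[OF N(1) N'(1)])
    fix t assume t: "t \<in> {0..T}"
    then show "AE \<omega> in P. N t \<omega> = N' t \<omega>"
      using has_ito_integral_unique[OF order_refl _ N(2)[rule_format, OF t] N'(2)[rule_format, OF t]] by simp
  qed
  have "X \<in> H2" "X' \<in> H2"
    using X X' S2_H2 by (auto simp: is_controlled_state_def)
  then have "AE \<omega> in P. set_integrable lborel {0..T} (\<lambda>s. ?V s \<omega>)" "AE \<omega> in P. set_integrable lborel {0..T} (\<lambda>s. ?V' s \<omega>)"
    by (auto intro: drift_path_integrable \<alpha> \<beta> m)
  with N(3) N'(3) NN' show ?thesis
  proof eventually_elim
    case (elim \<omega>)
    show ?case
    proof
      fix t assume t: "t \<in> {0..T}"
      have "X' t \<omega> - X t \<omega> = (LINT s:{0..t}|lborel. K t s *v ?V' s \<omega>) - (LINT s:{0..t}|lborel. K t s *v ?V s \<omega>)"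
        using elim(1,2,3) t by simp
      also have "\<dots> = (LINT s:{0..t}|lborel. K t s *v ?V' s \<omega> - K t s *v ?V s \<omega>)"
        by (intro set_integral_diff(2)[symmetric] K_integrable t elim)
      also have "\<dots> = (LINT s:{0..t}|lborel. K t s *v (A s *v (X' s \<omega> - X s \<omega>) + B s *v (\<beta> s \<omega> - \<alpha> s \<omega>)))"
        by (intro set_lebesgue_integral_cong) (auto simp: algebra_simps)
      finally show "X' t \<omega> - X t \<omega>
        = (LINT s:{0..t}|lborel. K t s *v (A s *v (X' s \<omega> - X s \<omega>) + B s *v (\<beta> s \<omega> - \<alpha> s \<omega>)))" .
    qed
  qed
qed

text \<open>Multiplication by \<open>K 0 t\<close> removes the kernel from the equation of a state
  difference \<open>D\<close>: the process \<open>E t = K 0 t *v D t\<close> is the integral over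
  [0,t] of \<open>a s *v E s\<close> plus \<open>K 0 s *v (B s *v \<gamma> s)\<close>, with \<gamma>
  the difference of the controls. This is a linear differential equation with coefficient
  \<open>a\<close>, in integrated form.\<close>

abbreviation a where "a s \<equiv> K 0 s ** A s ** K s 0"

lemma a_cont: "continuous_on {0..T} a"
  by (intro continuous_intros K_cont K_cont' A_cont)

lemma a_mult: "s \<in> {0..T} \<Longrightarrow> a s *v (K 0 s *v x) = K 0 s *v (A s *v x)"
  by (simp add: matrix_vector_mul_assoc matrix_mul_assoc[symmetric] K_inverse)

text \<open>In the coordinates \<open>K 0 t *v D t\<close> the difference of two states of the same
  control solves a homogeneous linear equation, and \<open>linear_volterra_zero\<close> applies on
  almost every path.\<close>

lemma state_unique:
  assumes X: "state m \<xi> \<alpha> X" and X': "state m \<xi> \<alpha> X'"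
    and \<alpha>: "\<alpha> \<in> H2" and m: "continuous_on {0..T} m"
  shows "indistinguishable P 0 T X' X"
proof -
  have "X \<in> H2" "X' \<in> H2"
    using X X' S2_H2 by (auto simp: is_controlled_state_def)
  then have "(\<lambda>s \<omega>. A s *v (X' s \<omega> - X s \<omega>)) \<in> H2"
    by (intro H2_matrix_mult H2_diff A_cont)
  then have "AE \<omega> in P. set_integrable lborel {0..T} (\<lambda>s. A s *v (X' s \<omega> - X s \<omega>))"
    by (intro L2_PT_set_integrable) (simp add: H2_iff)
  with state_difference[OF X X' \<alpha> \<alpha> m] show ?thesis
    unfolding indistinguishable_def
  proof eventually_elim
    case (elim \<omega>)
    define D where "D s = X' s \<omega> - X s \<omega>" for s
    have int: "set_integrable lborel {0..T} (\<lambda>s. K 0 s *v (A s *v D s))"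
      using set_integrable_matrix_vector_mult[OF K_cont' elim(2)] by (simp add: D_def)
    have "K 0 t *v D t = 0" if t: "t \<in> {0..T}" for t
    proof (rule linear_volterra_zero[OF a_cont _ _ t])
      show "set_integrable lborel {0..T} (\<lambda>s. a s *v (K 0 s *v D s))"
        using int by (subst set_integrable_cong[OF refl refl]) (auto simp: a_mult)
      fix u assume u: "u \<in> {0..T}"
      have "D u = (LINT s:{0..u}|lborel. K u s *v (A s *v D s))"
        using elim(1) u by (simp add: D_def)
      also have "\<dots> = K u 0 *v (LINT s:{0..u}|lborel. K 0 s *v (A s *v D s))"
        using elim(2) by (intro K_integral[OF u]) (simp add: D_def)
      also have "(LINT s:{0..u}|lborel. K 0 s *v (A s *v D s)) = (LINT s:{0..u}|lborel. a s *v (K 0 s *v D s))"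
        using u by (intro set_lebesgue_integral_cong) (auto simp: a_mult)
      finally show "K 0 u *v D u = (LINT s:{0..u}|lborel. a s *v (K 0 s *v D s))"
        using u by (simp add: matrix_vector_mul_assoc K_inverse)
    qed
    then have "K t 0 *v (K 0 t *v D t) = 0" if "t \<in> {0..T}" for t
      using that by simp
    then show ?case by (auto simp: matrix_vector_mul_assoc K_inverse D_def)
  qed
qed

text \<open>\<open>X\<close> already carries the noise and the data, so the version \<open>N\<close>
  of the stochastic integral is reused and only a pathwise correction \<open>D\<close> is added. Its
  closed formula makes \<open>D\<close> progressive and provides the majorant that keeps the sum in
  \<open>S2_space\<close>.\<close>

lemma state_exists:
  assumes X: "state m \<xi> \<alpha> X"
    and \<alpha>: "\<alpha> \<in> H2" and \<beta>: "\<beta> \<in> H2" and m: "continuous_on {0..T} m"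
  shows "\<exists>X'. state m \<xi> \<beta> X'"
proof -
  define \<gamma> where "\<gamma> s \<omega> = \<beta> s \<omega> - \<alpha> s \<omega>" for s \<omega>
  have \<gamma>: "\<gamma> \<in> H2" unfolding \<gamma>_def by (intro H2_diff \<alpha> \<beta>)
  obtain \<Psi> \<Theta> :: "real \<Rightarrow> real^'d^'d" where \<Psi>: "continuous_on {0..T} \<Psi>" and \<Theta>: "continuous_on {0..T} \<Theta>"
    and inv: "\<And>t. t \<in> {0..T} \<Longrightarrow> \<Psi> t ** \<Theta> t = mat 1"
    and deriv: "\<And>t. t \<in> {0..T} \<Longrightarrow> (\<Psi> has_vector_derivative a t ** \<Psi> t) (at t within {0..T})"
    using linear_ode_fundamental_matrix[OF less_imp_le[OF T_pos] a_cont] by metis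
  \<comment> \<open>Variation of constants for \<open>K 0 t *v D t\<close>, transformed back, gives
    D t = K t 0 \<Psi> t \<integral> \<Theta> s K 0 s B s \<gamma> s ds over [0,t]. The factors in
    front of the integral form \<open>L\<close>, the matrices inside form \<open>G\<close>.\<close>
  define G where "G s = \<Theta> s ** (K 0 s ** B s)" for s
  have G: "continuous_on {0..T} G" unfolding G_def by (intro continuous_intros \<Theta> K_cont' B_cont)
  define h where "h s \<omega> = G s *v \<gamma> s \<omega>" for s \<omega>
  have h: "h \<in> H2" unfolding h_def by (intro H2_matrix_mult G \<gamma>)
  then have hL: "case_prod h \<in> L2_PT" by (simp add: H2_iff)
  define L where "L t = K t 0 ** \<Psi> t" for t
  have L: "continuous_on {0..T} L" unfolding L_def by (intro continuous_intros K_cont \<Psi>)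
  define D where "D t \<omega> = L t *v (LINT s:{0..t}|lborel. h s \<omega>)" for t \<omega>
  have D_prog: "progressive F 0 T D"
    unfolding D_def using h by (intro progressive_matrix_mult L progressive_integral) (simp add: H2_iff)
  obtain c where c: "c > 0" "\<And>t x. t \<in> {0..T} \<Longrightarrow> norm (L t *v x) \<le> c * norm x"
    using matrix_vector_mult_bounded_on[OF L] by metis
  \<comment> \<open>The squared bound of \<open>L\<close> times the majorant that
    \<open>path_integral_bound\<close> gives for the integral of \<open>h\<close>.\<close>
  define Y where "Y \<omega> = ennreal (c\<^sup>2) * (ennreal T * (\<integral>\<^sup>+t. ennreal ((norm (h t \<omega>))\<^sup>2) \<partial>R))" for \<omega>
  have Y_meas: "Y \<in> borel_measurable P" and Y_fin: "(\<integral>\<^sup>+\<omega>. Y \<omega> \<partial>P) < \<infinity>"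
    unfolding Y_def using path_integral_bound(1,2)[OF hL]
    by (auto simp: nn_integral_cmult ennreal_mult_less_top)
  have D_le: "AE \<omega> in P. \<forall>t\<in>{0..T}. ennreal ((norm (D t \<omega>))\<^sup>2) \<le> Y \<omega>"
    using path_integral_bound(3)[OF hL]
  proof eventually_elim
    case (elim \<omega>)
    show ?case
    proof
      fix t assume t: "t \<in> {0..T}"
      let ?I = "LINT s:{0..t}|lborel. h s \<omega>"
      have "(norm (D t \<omega>))\<^sup>2 \<le> (c * norm ?I)\<^sup>2"
        unfolding D_def by (intro power_mono c(2) t) auto
      then have "ennreal ((norm (D t \<omega>))\<^sup>2) \<le> ennreal (c\<^sup>2 * (norm ?I)\<^sup>2)"
        by (intro ennreal_leI) (simp add: power_mult_distrib)
      also have "\<dots> = ennreal (c\<^sup>2) * ennreal ((norm ?I)\<^sup>2)" by (simp add: ennreal_mult)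
      also have "\<dots> \<le> Y \<omega>" unfolding Y_def using elim t by (intro mult_left_mono) auto
      finally show "ennreal ((norm (D t \<omega>))\<^sup>2) \<le> Y \<omega>" .
    qed
  qed
  define X' where "X' t \<omega> = X t \<omega> + D t \<omega>" for t \<omega>
  have XS: "X \<in> S2" using X by (simp add: is_controlled_state_def)
  have X'S: "X' \<in> S2"
    unfolding X'_def by (rule S2_add_dominated[OF XS D_prog Y_meas Y_fin D_le])
  have "AE \<omega> in P. set_integrable lborel {0..T} (\<lambda>s. \<gamma> s \<omega>)"
    using \<gamma> by (intro L2_PT_set_integrable) (simp add: H2_iff)
  then have D_eq: "AE \<omega> in P. (\<forall>t\<in>{0..T}. D t \<omega> = (LINT s:{0..t}|lborel. K t s *v (A s *v D s \<omega> + B s *v \<gamma> s \<omega>)))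
      \<and> set_integrable lborel {0..T} (\<lambda>s. A s *v D s \<omega> + B s *v \<gamma> s \<omega>)"
  proof eventually_elim
    case (elim \<omega>)
    define g where "g s = K 0 s *v (B s *v \<gamma> s \<omega>)" for s
    have B\<gamma>: "set_integrable lborel {0..T} (\<lambda>s. B s *v \<gamma> s \<omega>)" by (intro set_integrable_matrix_vector_mult B_cont elim)
    have g: "set_integrable lborel {0..T} g" unfolding g_def
      by (intro set_integrable_matrix_vector_mult K_cont' B\<gamma>)
    \<comment> \<open>On a fixed path and for \<open>t\<close> in [0,T] this is
      \<open>K 0 t *v D t \<omega>\<close>; it solves the transformed equation with inhomogeneity
      \<open>g\<close>.\<close>
    define E where "E t = \<Psi> t *v (LINT s:{0..t}|lborel. \<Theta> s *v g s)" for t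
    have DE: "D t \<omega> = K t 0 *v E t" for t
      unfolding D_def E_def L_def h_def G_def g_def by (simp add: matrix_vector_mul_assoc matrix_mul_assoc)
    note sol = linear_volterra_solution[OF a_cont \<Psi> \<Theta> inv deriv g E_def]
    have AD: "set_integrable lborel {0..T} (\<lambda>s. A s *v D s \<omega>)"
    proof -
      have "set_integrable lborel {0..T} (\<lambda>s. K s 0 *v (a s *v E s))"
        by (rule set_integrable_matrix_vector_mult[OF K_cont]) (use sol(1)[of T] T_pos in auto)
      then show ?thesis
        by (subst set_integrable_cong[OF refl refl, of _ _ "\<lambda>s. K s 0 *v (a s *v E s)"])
           (auto simp: DE matrix_vector_mul_assoc matrix_mul_assoc K_inverse)
    qed
    then have drift: "set_integrable lborel {0..T} (\<lambda>s. A s *v D s \<omega> + B s *v \<gamma> s \<omega>)"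
      by (intro set_integral_add(1) B\<gamma>)
    have "D t \<omega> = (LINT s:{0..t}|lborel. K t s *v (A s *v D s \<omega> + B s *v \<gamma> s \<omega>))" if t: "t \<in> {0..T}" for t
    proof -
      have "D t \<omega> = K t 0 *v (LINT s:{0..t}|lborel. a s *v E s + g s)"
        unfolding DE by (simp only: sol(2)[OF _ _ t])
      also have "(LINT s:{0..t}|lborel. a s *v E s + g s) = (LINT s:{0..t}|lborel. K 0 s *v (A s *v D s \<omega> + B s *v \<gamma> s \<omega>))"
        by (intro set_lebesgue_integral_cong)
           (auto simp: DE g_def matrix_vector_right_distrib matrix_vector_mul_assoc matrix_mul_assoc)
      finally show ?thesis using K_integral[OF t drift] by simp
    qed
    then show ?case using drift by blast
  qed
  obtain N where N: "AE \<omega> in P. continuous_on {0..T} (\<lambda>t. N t \<omega>)"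
    "\<forall>t\<in>{0..T}. has_ito_integral P F W 0 t (\<lambda>s \<omega>. K t s ** Sig s \<omega>) (N t)"
    "AE \<omega> in P. \<forall>t\<in>{0..T}. X t \<omega> = K t 0 *v \<xi> \<omega> + Mop m t
      + (LINT s:{0..t}|lborel. K t s *v (A s *v X s \<omega> + B s *v \<alpha> s \<omega> + C s *v m s)) + N t \<omega>"
    using X unfolding is_controlled_state_def by blast
  have "AE \<omega> in P. \<forall>t\<in>{0..T}. X' t \<omega> = K t 0 *v \<xi> \<omega> + Mop m t
      + (LINT s:{0..t}|lborel. K t s *v (A s *v X' s \<omega> + B s *v \<beta> s \<omega> + C s *v m s)) + N t \<omega>"
    using N(3) D_eq drift_path_integrable[OF S2_H2[OF XS] \<alpha> m]
  proof eventually_elim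
    case (elim \<omega>)
    show ?case
    proof
      fix t assume t: "t \<in> {0..T}"
      have "(LINT s:{0..t}|lborel. K t s *v (A s *v X' s \<omega> + B s *v \<beta> s \<omega> + C s *v m s))
         = (LINT s:{0..t}|lborel. K t s *v (A s *v X s \<omega> + B s *v \<alpha> s \<omega> + C s *v m s)
            + K t s *v (A s *v D s \<omega> + B s *v \<gamma> s \<omega>))"
        by (intro set_lebesgue_integral_cong) (auto simp: X'_def \<gamma>_def algebra_simps)
      also have "\<dots> = (LINT s:{0..t}|lborel. K t s *v (A s *v X s \<omega> + B s *v \<alpha> s \<omega> + C s *v m s))
            + (LINT s:{0..t}|lborel. K t s *v (A s *v D s \<omega> + B s *v \<gamma> s \<omega>))"
        using elim by (intro set_integral_add(2) K_integrable t) auto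
      finally show "X' t \<omega> = K t 0 *v \<xi> \<omega> + Mop m t
          + (LINT s:{0..t}|lborel. K t s *v (A s *v X' s \<omega> + B s *v \<beta> s \<omega> + C s *v m s)) + N t \<omega>"
        using elim(1,2) t by (simp add: X'_def)
    qed
  qed
  then have "state m \<xi> \<beta> X'" unfolding is_controlled_state_def using X'S N(1,2) by blast
  then show ?thesis by (rule exI[where x = X'])
qed

end

section \<open>Duality and optimality\<close>

lemma inner_transpose_mult:
  fixes M :: "real^'n^'m"
  shows "x \<bullet> (transpose M *v y) = (M *v x) \<bullet> y" "(transpose M *v y) \<bullet> x = y \<bullet> (M *v x)"
  by (simp_all add: inner_commute[of x] dot_lmul_matrix inner_commute[of "M *v x"])

context finite_horizon
begin

text \<open>Random vectors such as the terminal datum enter the duality as processes constant in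
  time. These are in general not adapted, hence membership in L^2 of the product measure instead of
  \<open>H2\<close>.\<close>

lemma L2_PT_static:
  fixes G :: "'w \<Rightarrow> 'v::euclidean_space"
  assumes G: "G \<in> L2_space P P"
  shows "case_prod (\<lambda>t \<omega>. G \<omega>) \<in> L2_PT"
proof -
  have Gm: "G \<in> borel_measurable P" using G by (simp add: L2_space_iff)
  have m: "case_prod (\<lambda>t \<omega>. G \<omega>) \<in> borel_measurable (PT 0 T)"
    using measurable_compose[OF measurable_snd Gm] by (simp add: case_prod_unfold)
  have "(\<lambda>x. ennreal ((norm (case_prod (\<lambda>t \<omega>. G \<omega>) x))\<^sup>2)) \<in> borel_measurable (PT 0 T)"
    using m by measurable
  note nn_integral_PT[OF this]
  moreover have "(\<integral>\<^sup>+t\<in>{0..T}. c \<partial>lborel) = ennreal T * c" for c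
    using T_pos by (subst nn_integral_cmult_indicator) (simp_all add: mult.commute)
  ultimately have "(\<integral>\<^sup>+x. ennreal ((norm (case_prod (\<lambda>t \<omega>. G \<omega>) x))\<^sup>2) \<partial>PT 0 T) = (\<integral>\<^sup>+\<omega>. ennreal T * ennreal ((norm (G \<omega>))\<^sup>2) \<partial>P)"
    by (simp only: prod.case)
  also have "\<dots> = ennreal T * (\<integral>\<^sup>+\<omega>. ennreal ((norm (G \<omega>))\<^sup>2) \<partial>P)"
    using Gm by (intro nn_integral_cmult) measurable
  also have "\<dots> < \<infinity>"
    using G L2_space_iff_nn_integral[OF Gm] by (simp add: ennreal_mult_less_top)
  finally show ?thesis using L2_space_iff_nn_integral[OF m] by blast
qed

lemma L2_PT_diff:
  fixes Z Z' :: "real \<Rightarrow> 'w \<Rightarrow> 'v::euclidean_space"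
  assumes "case_prod Z \<in> L2_PT" "case_prod Z' \<in> L2_PT"
  shows "case_prod (\<lambda>t \<omega>. Z t \<omega> - Z' t \<omega>) \<in> L2_PT"
  using L2_space_diff[OF assms] by (simp add: case_prod_unfold)

lemma set_integral_tail:
  fixes h :: "real \<Rightarrow> 'v::euclidean_space"
  assumes h: "set_integrable lborel {0..T} h" and t: "t \<in> {0..T}"
  shows "(LINT s:{t..T}|lborel. h s) = (LINT s:{0..T}|lborel. h s) - (LINT s:{0..t}|lborel. h s)"
proof -
  have eq: "(LINT s:{a..b}|lborel. h s) = integral {a..b} h" if "0 \<le> a" "b \<le> T" for a b
    using that by (intro set_borel_integral_eq_integral(2) set_integrable_subset[OF h]) auto
  have "integral {0..t} h + integral {t..T} h = integral {0..T} h"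
    using t set_borel_integral_eq_integral(1)[OF h] by (intro Henstock_Kurzweil_Integration.integral_combine) auto
  then show ?thesis using t by (simp add: eq algebra_simps)
qed

end

context linear_volterra
begin

text \<open>The stochastic product rule is replaced by Fubini's theorem: testing the backward equation
  against \<open>\<phi> s\<close> and integrating over \<open>s\<close>, the stochastic integral over \<open>[s,T]\<close> drops out because
  \<open>\<phi> s\<close> is \<open>F s\<close>-measurable.\<close>

lemma forward_backward_duality:
  assumes \<phi>: "\<phi> \<in> H2" and D: "D \<in> H2" and D_T: "D T \<in> L2_space P P"
    and D_eq: "AE \<omega> in P. \<forall>t\<in>{0..T}. D t \<omega> = (LINT s:{0..t}|lborel. K t s *v \<phi> s \<omega>)"
    and G: "G \<in> L2_space P P" and \<psi>: "\<psi> \<in> H2" and Y: "Y \<in> S2"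
    and N: "\<forall>t\<in>{0..T}. has_ito_integral P F W t T (\<lambda>s \<omega>. transpose (K s t) ** Z s \<omega>) (N t)"
    and Y_eq: "AE \<omega> in P. \<forall>t\<in>{0..T}. Y t \<omega> = transpose (K T t) *v G \<omega>
      + (LINT s:{t..T}|lborel. transpose (K s t) *v \<psi> s \<omega>) - N t \<omega>"
  shows "(\<integral>\<omega>. D T \<omega> \<bullet> G \<omega> \<partial>P) + (\<integral>\<omega>. (LINT t:{0..T}|lborel. D t \<omega> \<bullet> \<psi> t \<omega>) \<partial>P)
    = (\<integral>\<omega>. (LINT t:{0..T}|lborel. \<phi> t \<omega> \<bullet> Y t \<omega>) \<partial>P)"
proof -
  \<comment> \<open>\<open>transpose (K s t)\<close> factorises as
    \<open>transpose (K 0 t) ** transpose (K s 0)\<close>, so the drift integral of the backward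
    equation becomes a matrix outside the integral times a tail of the integral of
    \<open>h\<close>.\<close>
  define h where "h s \<omega> = transpose (K s 0) *v \<psi> s \<omega>" for s \<omega>
  define H where "H t \<omega> = (LINT s:{0..t}|lborel. h s \<omega>)" for t \<omega>
  have h: "h \<in> H2"
    unfolding h_def by (intro H2_matrix_mult continuous_intros K_cont \<psi>)
  have HS: "H \<in> S2" using integral_S2[OF h] by (simp add: H_def[abs_def])
  have T: "T \<in> {0..T}" using T_pos by simp
  define N1 where "N1 t \<omega> = transpose (K T t) *v G \<omega>" for t \<omega>
  \<comment> \<open>The drift part of the backward equation. \<open>H T - H t\<close> looks into the
    future, so it is used only through its joint square integrability; the adapted factor of the
    pairing is \<open>\<phi>\<close>.\<close>
  define N2 where "N2 t \<omega> = transpose (K 0 t) *v (H T \<omega> - H t \<omega>)" for t \<omega>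
  note L2_of_H2 = H2_iff[THEN iffD1, THEN conjunct2]
  have \<phi>L: "case_prod \<phi> \<in> L2_PT" using \<phi> by (rule L2_of_H2)
  have YL: "case_prod Y \<in> L2_PT" using S2_H2[OF Y] by (rule L2_of_H2)
  have N1L: "case_prod N1 \<in> L2_PT"
    unfolding N1_def by (intro L2_PT_matrix_mult L2_PT_static G continuous_intros K_cont_right T)
  have N2L: "case_prod N2 \<in> L2_PT"
    unfolding N2_def by (intro L2_PT_matrix_mult L2_PT_diff L2_PT_static S2_at(2)[OF HS T]
        L2_of_H2[OF S2_H2[OF HS]] continuous_intros K_cont')
  have int: "integrable (PT 0 T) (case_prod (\<lambda>t \<omega>. \<phi> t \<omega> \<bullet> N1 t \<omega>))"
    "integrable (PT 0 T) (case_prod (\<lambda>t \<omega>. \<phi> t \<omega> \<bullet> N2 t \<omega>))"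
    "integrable (PT 0 T) (case_prod (\<lambda>t \<omega>. \<phi> t \<omega> \<bullet> Y t \<omega>))"
    by (intro L2_PT_inner_integrable \<phi>L N1L N2L YL)+
  have h_path: "AE \<omega> in P. set_integrable lborel {0..T} (\<lambda>s. h s \<omega>)"
    by (rule L2_PT_set_integrable[OF L2_of_H2[OF h]])
  have \<phi>_path: "AE \<omega> in P. set_integrable lborel {0..T} (\<lambda>s. \<phi> s \<omega>)"
    by (rule L2_PT_set_integrable[OF \<phi>L])
  have N_eq: "AE \<omega> in P. \<forall>t\<in>{0..T}. N t \<omega> = N1 t \<omega> + N2 t \<omega> - Y t \<omega>"
    using Y_eq h_path
  proof eventually_elim
    case (elim \<omega>)
    show ?case
    proof
      fix t assume t: "t \<in> {0..T}"
      have ht: "set_integrable lborel {t..T} (\<lambda>s. h s \<omega>)"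
        using t by (intro set_integrable_subset[OF elim(2)]) auto
      have "(LINT s:{t..T}|lborel. transpose (K s t) *v \<psi> s \<omega>) = (LINT s:{t..T}|lborel. transpose (K 0 t) *v h s \<omega>)"
      proof (intro set_lebesgue_integral_cong allI impI)
        fix s assume "s \<in> {t..T}"
        then have "K s t = K s 0 ** K 0 t" using t by (intro K_split) auto
        then show "transpose (K s t) *v \<psi> s \<omega> = transpose (K 0 t) *v h s \<omega>"
          by (simp only: h_def matrix_transpose_mul matrix_vector_mul_assoc)
      qed simp
      also have "\<dots> = N2 t \<omega>"
        using set_integral_tail[OF elim(2) t]
        by (simp add: N2_def H_def set_integral_matrix_vector_mult[OF ht] del: transpose_matrix_vector)
      finally show "N t \<omega> = N1 t \<omega> + N2 t \<omega> - Y t \<omega>" using elim(1) t by (simp add: N1_def)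
    qed
  qed
  have zero: "AE t in R. (\<integral>\<omega>. \<phi> t \<omega> \<bullet> N1 t \<omega> + \<phi> t \<omega> \<bullet> N2 t \<omega> - \<phi> t \<omega> \<bullet> Y t \<omega> \<partial>P) = 0"
    using H2_at[OF \<phi>] L2_PT_at[OF N1L] L2_PT_at[OF N2L] L2_PT_at[OF YL] AE_space
  proof eventually_elim
    case (elim t)
    then have t: "t \<in> {0..T}" by (simp add: space_restrict_space)
    have [measurable]: "\<phi> t \<in> borel_measurable P" "N1 t \<in> borel_measurable P" "N2 t \<in> borel_measurable P"
       "Y t \<in> borel_measurable P" "N t \<in> borel_measurable P"
      using elim t measurable_F_P[of t "\<phi> t"] N by (auto simp: L2_space_iff has_ito_integral_def)
    have "AE \<omega> in P. N t \<omega> = N1 t \<omega> + N2 t \<omega> - Y t \<omega>" using N_eq t by (auto elim!: eventually_mono)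
    then have "AE \<omega> in P. \<phi> t \<omega> \<bullet> N1 t \<omega> + \<phi> t \<omega> \<bullet> N2 t \<omega> - \<phi> t \<omega> \<bullet> Y t \<omega> = \<phi> t \<omega> \<bullet> N t \<omega>"
      by eventually_elim (simp add: inner_simps)
    then have "(\<integral>\<omega>. \<phi> t \<omega> \<bullet> N1 t \<omega> + \<phi> t \<omega> \<bullet> N2 t \<omega> - \<phi> t \<omega> \<bullet> Y t \<omega> \<partial>P) = (\<integral>\<omega>. \<phi> t \<omega> \<bullet> N t \<omega> \<partial>P)"
      by (intro integral_cong_AE) measurable
    also have "\<dots> = 0" using t N elim(1) by (intro has_ito_integral_orthogonal(2)[of t]) auto
    finally show ?case .
  qed
  let ?f = "\<lambda>t \<omega>. \<phi> t \<omega> \<bullet> N1 t \<omega> + \<phi> t \<omega> \<bullet> N2 t \<omega> - \<phi> t \<omega> \<bullet> Y t \<omega>"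
  have f_int: "integrable (PT 0 T) (case_prod ?f)"
    using Bochner_Integration.integrable_diff[OF Bochner_Integration.integrable_add[OF int(1,2)] int(3)]
    by (simp add: case_prod_unfold)
  have "integral\<^sup>L (PT 0 T) (case_prod ?f) = (\<integral>t. (\<integral>\<omega>. ?f t \<omega> \<partial>P) \<partial>R)"
    using expectation_path_integral(2,3)[OF f_int] by simp
  also have "\<dots> = 0" by (rule integral_eq_zero_AE[OF zero])
  finally have "integral\<^sup>L (PT 0 T) (case_prod (\<lambda>t \<omega>. \<phi> t \<omega> \<bullet> N1 t \<omega>)) + integral\<^sup>L (PT 0 T) (case_prod (\<lambda>t \<omega>. \<phi> t \<omega> \<bullet> N2 t \<omega>))
      = integral\<^sup>L (PT 0 T) (case_prod (\<lambda>t \<omega>. \<phi> t \<omega> \<bullet> Y t \<omega>))"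
    using int by (simp add: case_prod_unfold)
  then have balance: "(\<integral>\<omega>. (LINT t:{0..T}|lborel. \<phi> t \<omega> \<bullet> N1 t \<omega>) \<partial>P) + (\<integral>\<omega>. (LINT t:{0..T}|lborel. \<phi> t \<omega> \<bullet> N2 t \<omega>) \<partial>P)
      = (\<integral>\<omega>. (LINT t:{0..T}|lborel. \<phi> t \<omega> \<bullet> Y t \<omega>) \<partial>P)"
    using expectation_path_integral(2)[OF int(1)] expectation_path_integral(2)[OF int(2)]
      expectation_path_integral(2)[OF int(3)] by simp
  have \<psi>L: "case_prod \<psi> \<in> L2_PT" using \<psi> by (rule L2_of_H2)
  have DL: "case_prod D \<in> L2_PT" using D by (rule L2_of_H2)
  note D\<psi> = L2_PT_inner_integrable[OF DL \<psi>L]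
  have "AE \<omega> in P. (LINT t:{0..T}|lborel. \<phi> t \<omega> \<bullet> N1 t \<omega>) = D T \<omega> \<bullet> G \<omega>"
    using D_eq \<phi>_path
  proof eventually_elim
    case (elim \<omega>)
    have "(LINT t:{0..T}|lborel. \<phi> t \<omega> \<bullet> N1 t \<omega>) = (LINT t:{0..T}|lborel. (K T t *v \<phi> t \<omega>) \<bullet> G \<omega>)"
      by (simp only: N1_def inner_transpose_mult)
    also have "\<dots> = (LINT t:{0..T}|lborel. K T t *v \<phi> t \<omega>) \<bullet> G \<omega>"
      using integral_bounded_linear[OF bounded_linear_inner_left[of "G \<omega>"] K_integrable[OF T elim(2), unfolded set_integrable_def]]
      by (simp add: set_lebesgue_integral_def)
    finally show ?case using elim(1) T by simp
  qed
  then have 1: "(\<integral>\<omega>. (LINT t:{0..T}|lborel. \<phi> t \<omega> \<bullet> N1 t \<omega>) \<partial>P) = (\<integral>\<omega>. D T \<omega> \<bullet> G \<omega> \<partial>P)"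
    using borel_measurable_integrable[OF expectation_path_integral(1)[OF int(1)]]
      borel_measurable_integrable[OF L2_space_inner_integrable[OF D_T G]]
    by (intro integral_cong_AE)
  have "AE \<omega> in P. (LINT t:{0..T}|lborel. \<phi> t \<omega> \<bullet> N2 t \<omega>) = (LINT t:{0..T}|lborel. D t \<omega> \<bullet> \<psi> t \<omega>)"
    using D_eq \<phi>_path h_path
  proof eventually_elim
    case (elim \<omega>)
    let ?w = "\<lambda>s. K 0 s *v \<phi> s \<omega>"
    have w: "set_integrable lborel {0..T} ?w" by (rule set_integrable_matrix_vector_mult[OF K_cont' elim(2)])
    \<comment> \<open>\<open>D t\<close> collects the past of \<open>\<phi>\<close> and
      \<open>N2 t\<close> the future of \<open>\<psi>\<close>; exchanging the order of integration
      over the triangle turns one pairing into the other.\<close>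
    have "(LINT t:{0..T}|lborel. D t \<omega> \<bullet> \<psi> t \<omega>) = (LINT t:{0..T}|lborel. h t \<omega> \<bullet> (LINT s:{0..t}|lborel. ?w s))"
    proof (intro set_lebesgue_integral_cong allI impI)
      fix t assume t: "t \<in> {0..T}"
      have "D t \<omega> = K t 0 *v (LINT s:{0..t}|lborel. ?w s)" using elim(1) t K_integral[OF t elim(2)] by simp
      then show "D t \<omega> \<bullet> \<psi> t \<omega> = h t \<omega> \<bullet> (LINT s:{0..t}|lborel. ?w s)"
        unfolding h_def inner_transpose_mult by (simp add: inner_commute)
    qed simp
    also have "\<dots> = (LINT t:{0..T}|lborel. (LINT s:{t..T}|lborel. h s \<omega>) \<bullet> ?w t)"
      by (rule set_integral_fubini_triangle[OF bounded_bilinear_inner elim(3) w])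
    also have "\<dots> = (LINT t:{0..T}|lborel. \<phi> t \<omega> \<bullet> N2 t \<omega>)"
    proof (intro set_lebesgue_integral_cong allI impI)
      fix t assume t: "t \<in> {0..T}"
      show "(LINT s:{t..T}|lborel. h s \<omega>) \<bullet> ?w t = \<phi> t \<omega> \<bullet> N2 t \<omega>"
        unfolding N2_def inner_transpose_mult set_integral_tail[OF elim(3) t] H_def by (rule inner_commute)
    qed simp
    finally show ?case ..
  qed
  then have 2: "(\<integral>\<omega>. (LINT t:{0..T}|lborel. \<phi> t \<omega> \<bullet> N2 t \<omega>) \<partial>P) = (\<integral>\<omega>. (LINT t:{0..T}|lborel. D t \<omega> \<bullet> \<psi> t \<omega>) \<partial>P)"
    using borel_measurable_integrable[OF expectation_path_integral(1)[OF int(2)]]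
      borel_measurable_integrable[OF expectation_path_integral(1)[OF D\<psi>]]
    by (intro integral_cong_AE)
  show ?thesis using balance unfolding 1 2 .
qed

text \<open>On almost every path the two controls differ only on a null set of times, which the
  drift integral does not see. Together with \<open>state_unique\<close> this turns almost
  everywhere equality of controls into indistinguishability of states.\<close>

lemma state_equal_ae:
  assumes X: "state m \<xi> \<beta> X"
    and \<alpha>: "\<alpha> \<in> H2" and \<beta>: "\<beta> \<in> H2" and m: "continuous_on {0..T} m"
    and zero: "(\<integral>x. (norm (case_prod (\<lambda>t \<omega>. \<beta> t \<omega> - \<alpha> t \<omega>) x))\<^sup>2 \<partial>PT 0 T) = 0"
  shows "state m \<xi> \<alpha> X"
proof -
  have XS: "X \<in> S2" using X by (simp add: is_controlled_state_def)
  have "(\<lambda>t \<omega>. \<beta> t \<omega> - \<alpha> t \<omega>) \<in> H2" by (intro H2_diff \<alpha> \<beta>)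
  then have int: "integrable (PT 0 T) (case_prod (\<lambda>t \<omega>. (norm (\<beta> t \<omega> - \<alpha> t \<omega>))\<^sup>2))"
    by (simp add: H2_iff L2_space_iff case_prod_unfold)
  have "(\<integral>\<omega>. (LINT t:{0..T}|lborel. (norm (\<beta> t \<omega> - \<alpha> t \<omega>))\<^sup>2) \<partial>P) = 0"
    unfolding expectation_path_integral(2)[OF int] using zero by (simp add: case_prod_unfold)
  moreover have "AE \<omega> in P. 0 \<le> (LINT t:{0..T}|lborel. (norm (\<beta> t \<omega> - \<alpha> t \<omega>))\<^sup>2)"
    unfolding set_lebesgue_integral_def by simp
  ultimately have "AE \<omega> in P. (LINT t:{0..T}|lborel. (norm (\<beta> t \<omega> - \<alpha> t \<omega>))\<^sup>2) = 0"
    using integral_nonneg_eq_0_iff_AE[OF expectation_path_integral(1)[OF int]] by blast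
  then have eq: "AE \<omega> in P. AE t in R. \<beta> t \<omega> = \<alpha> t \<omega>"
    using expectation_path_integral(4)[OF int]
  proof eventually_elim
    case (elim \<omega>)
    then have "AE t in R. (norm (\<beta> t \<omega> - \<alpha> t \<omega>))\<^sup>2 = 0"
      by (subst integral_nonneg_eq_0_iff_AE[symmetric]) (auto simp: integral_R integrable_R)
    then show ?case by eventually_elim simp
  qed
  obtain N where N: "AE \<omega> in P. continuous_on {0..T} (\<lambda>t. N t \<omega>)"
    "\<forall>t\<in>{0..T}. has_ito_integral P F W 0 t (\<lambda>s \<omega>. K t s ** Sig s \<omega>) (N t)"
    "AE \<omega> in P. \<forall>t\<in>{0..T}. X t \<omega> = K t 0 *v \<xi> \<omega> + Mop m t
      + (LINT s:{0..t}|lborel. K t s *v (A s *v X s \<omega> + B s *v \<beta> s \<omega> + C s *v m s)) + N t \<omega>"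
    using X unfolding is_controlled_state_def by blast
  have "AE \<omega> in P. \<forall>t\<in>{0..T}. X t \<omega> = K t 0 *v \<xi> \<omega> + Mop m t
      + (LINT s:{0..t}|lborel. K t s *v (A s *v X s \<omega> + B s *v \<alpha> s \<omega> + C s *v m s)) + N t \<omega>"
    using N(3) eq drift_path_integrable[OF S2_H2[OF XS] \<alpha> m] drift_path_integrable[OF S2_H2[OF XS] \<beta> m]
  proof eventually_elim
    case (elim \<omega>)
    show ?case
    proof
      fix t assume t: "t \<in> {0..T}"
      have "AE s in lborel. s \<in> {0..T} \<longrightarrow> \<beta> s \<omega> = \<alpha> s \<omega>"
        using elim(2) by (subst (asm) AE_restrict_space_iff) auto
      then have "AE s in lborel. indicator {0..t} s *\<^sub>R (K t s *v (A s *v X s \<omega> + B s *v \<beta> s \<omega> + C s *v m s))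
         = indicator {0..t} s *\<^sub>R (K t s *v (A s *v X s \<omega> + B s *v \<alpha> s \<omega> + C s *v m s))"
        by eventually_elim (use t in \<open>auto simp: indicator_def\<close>)
      then have "(LINT s:{0..t}|lborel. K t s *v (A s *v X s \<omega> + B s *v \<beta> s \<omega> + C s *v m s))
        = (LINT s:{0..t}|lborel. K t s *v (A s *v X s \<omega> + B s *v \<alpha> s \<omega> + C s *v m s))"
        unfolding set_lebesgue_integral_def
        using K_integrable[OF t elim(3)] K_integrable[OF t elim(4)]
        by (intro integral_cong_AE) (auto simp: set_integrable_def)
      then show "X t \<omega> = K t 0 *v \<xi> \<omega> + Mop m t
          + (LINT s:{0..t}|lborel. K t s *v (A s *v X s \<omega> + B s *v \<alpha> s \<omega> + C s *v m s)) + N t \<omega>"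
        using elim(1) t by simp
    qed
  qed
  then show ?thesis unfolding is_controlled_state_def using XS N(1,2) by blast
qed

end

section \<open>Expansion of the quadratic costs\<close>

lemma quadratic_form_add:
  fixes M :: "real^'n^'n"
  assumes "transpose M = M"
  shows "(x + d) \<bullet> (M *v (x + d)) = x \<bullet> (M *v x) + 2 * (d \<bullet> (M *v x)) + d \<bullet> (M *v d)"
proof -
  have "x \<bullet> (M *v d) = d \<bullet> (M *v x)"
    using inner_transpose_mult(1)[of x M d] assms by (simp add: inner_commute)
  then show ?thesis by (simp add: matrix_vector_right_distrib inner_simps)
qed

text \<open>The factor paired with \<open>d\<close> in the linear term,
  \<open>(M + M') *v x - M' *v y\<close>, has exactly the form of the data of the backward equation,
  with \<open>y\<close> the target \<open>S *v m T\<close> or \<open>St t *v m t\<close>.\<close>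

lemma tracking_cost_add:
  fixes M M' :: "real^'n^'n"
  assumes "transpose M = M" "transpose M' = M'"
  shows "(x + d) \<bullet> (M *v (x + d)) + (x + d - y) \<bullet> (M' *v (x + d - y))
    = x \<bullet> (M *v x) + (x - y) \<bullet> (M' *v (x - y)) + d \<bullet> ((M + M') *v d)
      + 2 * (d \<bullet> ((M + M') *v x - M' *v y))"
proof -
  have "x + d - y = (x - y) + d" by simp
  then show ?thesis
    unfolding quadratic_form_add[OF assms(1)]
    by (simp only: quadratic_form_add[OF assms(2)])
       (simp add: matrix_vector_mult_add_rdistrib matrix_vector_mult_diff_distrib inner_simps)
qed

text \<open>Coercivity with constant \<open>lam\<close> makes \<open>M\<close> injective, hence
  invertible in finite dimension. Symmetry is inherited from the shifted matrix because the identity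
  is symmetric.\<close>

lemma pos_def_shift:
  fixes M :: "real^'n^'n"
  assumes lam: "0 < lam" and M: "pos_def_mat (M - lam *\<^sub>R mat 1)"
  shows "transpose M = M" "lam * (norm x)\<^sup>2 \<le> x \<bullet> (M *v x)" "M ** matrix_inv M = mat 1"
proof -
  have sym: "transpose (M - lam *\<^sub>R mat 1) = M - lam *\<^sub>R mat 1"
    using M by (simp add: pos_def_mat_def)
  show "transpose M = M"
  proof -
    have "M $ j $ i = M $ i $ j" for i j
      using arg_cong[OF sym, of "\<lambda>N. N $ i $ j"] by (simp add: transpose_def mat_def split: if_splits)
    then show ?thesis by (simp add: transpose_def vec_eq_iff)
  qed
  have expand: "y \<bullet> ((M - lam *\<^sub>R mat 1) *v y) = y \<bullet> (M *v y) - lam * (norm y)\<^sup>2" for y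
    by (simp add: matrix_vector_mult_diff_rdistrib scaleR_matrix_vector_assoc[symmetric] inner_simps power2_norm_eq_inner)
  have le: "lam * (norm y)\<^sup>2 \<le> y \<bullet> (M *v y)" for y
    using M expand[of y] by (cases "y = 0") (auto simp: pos_def_mat_def intro: less_imp_le)
  then show "lam * (norm x)\<^sup>2 \<le> x \<bullet> (M *v x)" .
  have "y = 0" if "M *v y = 0" for y
    using le[of y] that lam by (simp add: mult_le_0_iff)
  then have "\<exists>N. N ** M = mat 1" by (simp add: matrix_left_invertible_ker)
  then have "\<exists>N. M ** N = mat 1 \<and> N ** M = mat 1" by (metis matrix_left_right_inverse)
  then show "M ** matrix_inv M = mat 1"
    unfolding matrix_inv_def by (rule someI2_ex) simp
qed

locale lq_control = linear_volterra P F F00 W T K Mop A C B Sig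
  for P :: "'w measure" and F F00 and W :: "real \<Rightarrow> 'w \<Rightarrow> real^'q" and T
    and K :: "real \<Rightarrow> real \<Rightarrow> real^'d^'d" and Mop :: "(real \<Rightarrow> real^'d) \<Rightarrow> real \<Rightarrow> real^'d"
    and A C :: "real \<Rightarrow> real^'d^'d" and B :: "real \<Rightarrow> real^'k^'d" and Sig :: "real \<Rightarrow> 'w \<Rightarrow> real^'q^'d" +
  fixes Q Qbar S :: "real^'d^'d" and Qt Qbart St :: "real \<Rightarrow> real^'d^'d" and Rt :: "real \<Rightarrow> real^'k^'k"
    and lam :: real
  assumes terminal: "nonneg_def_mat Q" "nonneg_def_mat Qbar"
    and running_cont: "continuous_on {0..T} Qt" "continuous_on {0..T} Qbart"
      "continuous_on {0..T} St" "continuous_on {0..T} Rt"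
    and running: "\<And>t. t \<in> {0..T} \<Longrightarrow> nonneg_def_mat (Qt t)" "\<And>t. t \<in> {0..T} \<Longrightarrow> nonneg_def_mat (Qbart t)"
    and lam: "lam > 0" "\<And>t. t \<in> {0..T} \<Longrightarrow> pos_def_mat (Rt t - lam *\<^sub>R mat 1)"
begin

text \<open>The cost as a function of a given state, separated from the choice made in
  \<open>controlled_state\<close>, so that the comparison can be carried out for any state of a
  control.\<close>

definition cost where
  "cost m X \<alpha> = (\<integral>\<omega>. (LINT t:{0..T}|lborel. running_cost Qt Qbart St Rt m t (X t \<omega>) (\<alpha> t \<omega>))
    + terminal_cost Q Qbar S T m (X T \<omega>) \<partial>P)"

abbreviation fbsde where
  "fbsde \<equiv> solves_fbsde P F W T K Mop A B C Sig Q Qbar S Qt Qbart St Rt"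

abbreviation optimal where
  "optimal \<equiv> solves_control_problem P F W T K Mop A B C Sig Q Qbar S Qt Qbart St Rt"

abbreviation J where "J \<equiv> control_cost P F W T K Mop A B C Sig Q Qbar S Qt Qbart St Rt"

lemma J_eq_cost: "J m \<xi> \<alpha> = cost m (controlled_state P F W T K Mop A B C Sig m \<xi> \<alpha>) \<alpha>"
  by (simp add: control_cost_def cost_def Let_def)

lemma Rt_inverse: "t \<in> {0..T} \<Longrightarrow> Rt t ** matrix_inv (Rt t) = mat 1"
  using pos_def_shift(3)[OF lam(1) lam(2)] by blast

lemma feedback_H2:
  assumes "Y \<in> S2"
  shows "feedback B Rt Y \<in> H2"
proof -
  have "continuous_on {0..T} (\<lambda>t. matrix_inv (Rt t))"
    by (rule continuous_on_matrix_inverse[OF running_cont(4) Rt_inverse])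
  then have "(\<lambda>t \<omega>. - (matrix_inv (Rt t) *v (transpose (B t) *v Y t \<omega>))) \<in> H2"
    by (intro H2_uminus H2_matrix_mult continuous_on_transpose B_cont S2_H2 assms)
  then show ?thesis by (simp add: feedback_def[abs_def])
qed

text \<open>The first-order condition \<open>R \<alpha> = - B^T Y\<close> tested against a direction
  \<open>c\<close>; it trades the control part of the first variation for a pairing of
  \<open>B t *v c\<close> with \<open>Y\<close>.\<close>

lemma Rt_feedback:
  assumes "t \<in> {0..T}"
  shows "c \<bullet> (Rt t *v feedback B Rt Y t \<omega>) = - ((B t *v c) \<bullet> Y t \<omega>)"
proof -
  have "Rt t *v feedback B Rt Y t \<omega> = - ((Rt t ** matrix_inv (Rt t)) *v (transpose (B t) *v Y t \<omega>))"
    by (simp add: feedback_def matrix_vector_mul_assoc matrix_mul_assoc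
        bounded_bilinear.minus_right[OF bounded_bilinear_matrix_vector_mult] del: transpose_matrix_vector)
  then have "Rt t *v feedback B Rt Y t \<omega> = - (transpose (B t) *v Y t \<omega>)"
    by (simp only: Rt_inverse[OF assms] matrix_vector_mul_lid)
  then show ?thesis by (simp only: inner_minus_right inner_transpose_mult)
qed

lemma fbsde_state:
  assumes "fbsde m \<xi> X Y Z"
  shows "state m \<xi> (feedback B Rt Y) X"
proof -
  have eq: "A s *v X s \<omega> - B s *v (matrix_inv (Rt s) *v (transpose (B s) *v Y s \<omega>)) + C s *v m s
      = A s *v X s \<omega> + B s *v feedback B Rt Y s \<omega> + C s *v m s" for s \<omega>
    by (simp add: feedback_def bounded_bilinear.minus_right[OF bounded_bilinear_matrix_vector_mult] del: transpose_matrix_vector)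
  show ?thesis using assms unfolding solves_fbsde_def is_controlled_state_def eq by blast
qed

lemma running_cost_integrable:
  assumes X: "X \<in> H2" and \<alpha>: "\<alpha> \<in> H2" and m: "continuous_on {0..T} m"
  shows "integrable (PT 0 T) (case_prod (\<lambda>t \<omega>. running_cost Qt Qbart St Rt m t (X t \<omega>) (\<alpha> t \<omega>)))"
proof -
  have L: "case_prod X \<in> L2_PT" "case_prod \<alpha> \<in> L2_PT"
    using X \<alpha> by (auto simp: H2_iff)
  have XS: "case_prod (\<lambda>t \<omega>. X t \<omega> - St t *v m t) \<in> L2_PT"
    by (intro L2_PT_diff L L2_PT_deterministic continuous_intros running_cont m)
  show ?thesis
    using L2_PT_inner_integrable[OF L(1) L2_PT_matrix_mult[OF running_cont(1) L(1)]]
      L2_PT_inner_integrable[OF L(2) L2_PT_matrix_mult[OF running_cont(4) L(2)]]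
      L2_PT_inner_integrable[OF XS L2_PT_matrix_mult[OF running_cont(2) XS]]
    by (simp add: running_cost_def case_prod_unfold)
qed

lemma terminal_cost_integrable:
  assumes "X T \<in> L2_space P P"
  shows "integrable P (\<lambda>\<omega>. terminal_cost Q Qbar S T m (X T \<omega>))"
proof -
  note L = assms and XS = L2_space_diff[OF assms L2_space_const[of "S *v m T"]]
  show ?thesis
    using L2_space_inner_integrable[OF L L2_space_matrix_vector_mult[OF L, of Q]]
      L2_space_inner_integrable[OF XS L2_space_matrix_vector_mult[OF XS, of Qbar]]
    by (simp add: terminal_cost_def)
qed

lemma cost_eq:
  assumes X: "X \<in> S2" and \<alpha>: "\<alpha> \<in> H2" and m: "continuous_on {0..T} m"
  shows "cost m X \<alpha> = integral\<^sup>L (PT 0 T) (case_prod (\<lambda>t \<omega>. running_cost Qt Qbart St Rt m t (X t \<omega>) (\<alpha> t \<omega>)))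
    + (\<integral>\<omega>. terminal_cost Q Qbar S T m (X T \<omega>) \<partial>P)"
proof -
  note r = running_cost_integrable[OF S2_H2[OF X] \<alpha> m]
  have "T \<in> {0..T}" using T_pos by simp
  then have "integrable P (\<lambda>\<omega>. terminal_cost Q Qbar S T m (X T \<omega>))"
    by (intro terminal_cost_integrable S2_at[OF X])
  then show ?thesis
    unfolding cost_def using expectation_path_integral(1,2)[OF r] by simp
qed

text \<open>Expansion around \<open>x\<close> and \<open>\<alpha>\<close>: the quadratic term in
  \<open>d\<close> is nonnegative and is dropped, the one in \<open>\<gamma>\<close> is kept through
  its lower bound, and this remainder later gives uniqueness.\<close>

lemma running_cost_le:
  assumes t: "t \<in> {0..T}"
  shows "running_cost Qt Qbart St Rt m t x \<alpha> + lam / 2 * (norm \<gamma>)\<^sup>2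
      + (d \<bullet> ((Qt t + Qbart t) *v x - Qbart t *v (St t *v m t)) + \<gamma> \<bullet> (Rt t *v \<alpha>))
    \<le> running_cost Qt Qbart St Rt m t (x + d) (\<alpha> + \<gamma>)"
proof -
  have "0 \<le> d \<bullet> ((Qt t + Qbart t) *v d)"
    using running[OF t] by (simp add: nonneg_def_mat_def matrix_vector_mult_add_rdistrib inner_add_right)
  moreover have "transpose (Qt t) = Qt t" "transpose (Qbart t) = Qbart t"
    using running[OF t] by (simp_all add: nonneg_def_mat_def)
  note tracking_cost_add[OF this, of x d "St t *v m t"]
  moreover note quadratic_form_add[OF pos_def_shift(1)[OF lam(1) lam(2)[OF t]], of \<alpha> \<gamma>]
    pos_def_shift(2)[OF lam(1) lam(2)[OF t], of \<gamma>]
  \<comment> \<open>The bookkeeping is isolated as an inequality between real numbers: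
    \<open>p\<close> and \<open>w\<close> stand for the quadratic terms in \<open>d\<close> and
    \<open>\<gamma>\<close>, \<open>q\<close> and \<open>s\<close> for the linear ones.\<close>
  moreover have "1 / 2 * (a + r + b) + lam / 2 * n + (q + s) \<le> 1 / 2 * (e + e'' + e')"
    if "0 \<le> p" "e + e' = a + b + p + 2 * q" "e'' = r + 2 * s + w" "lam * n \<le> w"
    for a b p q r s w n e e' e'' :: real
    using that by (simp add: field_simps)
  ultimately show ?thesis unfolding running_cost_def by blast
qed

lemma terminal_cost_le:
  "terminal_cost Q Qbar S T m x + d \<bullet> ((Q + Qbar) *v x - Qbar *v (S *v m T))
    \<le> terminal_cost Q Qbar S T m (x + d)"
proof -
  have "0 \<le> d \<bullet> ((Q + Qbar) *v d)"
    using terminal by (simp add: nonneg_def_mat_def matrix_vector_mult_add_rdistrib inner_add_right)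
  then show ?thesis
    using tracking_cost_add[of Q Qbar x d "S *v m T"] terminal
    by (simp add: terminal_cost_def nonneg_def_mat_def)
qed

text \<open>The pointwise inequalities are integrated over time and paths. Their linear terms add up
  to the first variation, which the duality for \<open>\<phi> = A D + B \<gamma>\<close> shows to be
  zero, so only the remainder in \<open>\<gamma>\<close> is left.\<close>

lemma cost_lower_bound:
  assumes fbsde: "fbsde m \<xi> X Y Z"
    and \<beta>: "\<beta> \<in> H2" and X': "state m \<xi> \<beta> X'" and m: "continuous_on {0..T} m"
  shows "cost m X (feedback B Rt Y)
      + lam / 2 * (\<integral>x. (norm (case_prod (\<lambda>t \<omega>. \<beta> t \<omega> - feedback B Rt Y t \<omega>) x))\<^sup>2 \<partial>PT 0 T)
    \<le> cost m X' \<beta>"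
proof -
  define \<alpha> where "\<alpha> = feedback B Rt Y"
  define D where "D t \<omega> = X' t \<omega> - X t \<omega>" for t \<omega>
  define \<gamma> where "\<gamma> t \<omega> = \<beta> t \<omega> - \<alpha> t \<omega>" for t \<omega>
  define \<phi> where "\<phi> t \<omega> = A t *v D t \<omega> + B t *v \<gamma> t \<omega>" for t \<omega>
  define g where "g t \<omega> = (Qt t + Qbart t) *v X t \<omega> - Qbart t *v (St t *v m t)" for t \<omega>
  define \<psi> where "\<psi> t \<omega> = g t \<omega> + transpose (A t) *v Y t \<omega>" for t \<omega>
  define G where "G \<omega> = (Q + Qbar) *v X T \<omega> - Qbar *v (S *v m T)" for \<omega>
  have T: "T \<in> {0..T}" using T_pos by simp
  have XS: "X \<in> S2" and YS: "Y \<in> S2"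
    using fbsde by (auto simp: solves_fbsde_def)
  have X'S: "X' \<in> S2" using X' by (simp add: is_controlled_state_def)
  have \<alpha>: "\<alpha> \<in> H2" unfolding \<alpha>_def by (rule feedback_H2[OF YS])
  have X: "state m \<xi> \<alpha> X" unfolding \<alpha>_def by (rule fbsde_state[OF fbsde])
  have DH: "D \<in> H2" unfolding D_def by (intro H2_diff S2_H2 XS X'S)
  have \<gamma>: "\<gamma> \<in> H2" unfolding \<gamma>_def by (intro H2_diff \<alpha> \<beta>)
  have \<phi>: "\<phi> \<in> H2" unfolding \<phi>_def by (rule drift_H2[OF DH \<gamma>])
  have D_eq: "AE \<omega> in P. \<forall>t\<in>{0..T}. D t \<omega> = (LINT s:{0..t}|lborel. K t s *v \<phi> s \<omega>)"
    using state_difference[OF X X' \<alpha> \<beta> m] by (simp add: D_def \<phi>_def \<gamma>_def)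
  have D_T: "D T \<in> L2_space P P"
    using L2_space_diff[OF S2_at(2)[OF X'S T] S2_at(2)[OF XS T]] by (simp add: D_def[abs_def])
  have G: "G \<in> L2_space P P"
    unfolding G_def by (intro L2_space_diff L2_space_matrix_vector_mult S2_at(2)[OF XS T] L2_space_const)
  have g: "g \<in> H2"
    unfolding g_def by (intro H2_diff H2_matrix_mult H2_deterministic S2_H2 XS continuous_intros running_cont m)
  have \<psi>: "\<psi> \<in> H2"
    unfolding \<psi>_def by (intro H2_add[OF g] H2_matrix_mult continuous_intros A_cont S2_H2 YS)
  obtain N where N: "\<forall>t\<in>{0..T}. has_ito_integral P F W t T (\<lambda>s \<omega>. transpose (K s t) ** Z s \<omega>) (N t)"
    and Y_eq: "AE \<omega> in P. \<forall>t\<in>{0..T}. Y t \<omega> = transpose (K T t) *v G \<omega>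
      + (LINT s:{t..T}|lborel. transpose (K s t) *v \<psi> s \<omega>) - N t \<omega>"
    using fbsde unfolding solves_fbsde_def G_def \<psi>_def g_def by blast
  note duality = forward_backward_duality[OF \<phi> DH D_T D_eq G \<psi> YS N Y_eq]
  note L2_of_H2 = H2_iff[THEN iffD1, THEN conjunct2]
  note D\<psi> = L2_PT_inner_integrable[OF L2_of_H2[OF DH] L2_of_H2[OF \<psi>]]
    and \<phi>Y = L2_PT_inner_integrable[OF L2_of_H2[OF \<phi>] L2_of_H2[OF S2_H2[OF YS]]]
  define r where "r V \<beta> = case_prod (\<lambda>t \<omega>. running_cost Qt Qbart St Rt m t (V t \<omega>) (\<beta> t \<omega>))"
    for V and \<beta> :: "real \<Rightarrow> 'w \<Rightarrow> real^'k"
  define n where "n = case_prod (\<lambda>t \<omega>. (norm (\<gamma> t \<omega>))\<^sup>2)"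
  define p where "p = case_prod (\<lambda>t \<omega>. D t \<omega> \<bullet> \<psi> t \<omega>)"
  define q where "q = case_prod (\<lambda>t \<omega>. \<phi> t \<omega> \<bullet> Y t \<omega>)"
  have int: "integrable (PT 0 T) (r X \<alpha>)" "integrable (PT 0 T) (r X' \<beta>)" "integrable (PT 0 T) p" "integrable (PT 0 T) q"
    unfolding r_def p_def q_def by (intro running_cost_integrable S2_H2 XS X'S \<alpha> \<beta> m D\<psi> \<phi>Y)+
  have n_int: "integrable (PT 0 T) n"
    using L2_of_H2[OF \<gamma>] by (simp add: n_def L2_space_iff case_prod_unfold)
  have "r X \<alpha> x + lam / 2 * n x + (p x - q x) \<le> r X' \<beta> x" if "x \<in> space (PT 0 T)" for x
  proof -
    obtain t \<omega> where x: "x = (t, \<omega>)" by fastforce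
    then have t: "t \<in> {0..T}" using that by (simp add: space_pair_measure space_restrict_space)
    \<comment> \<open>The terms with \<open>A\<close> cancel: the pairing of \<open>D\<close> with
      \<open>A^T Y\<close> in \<open>p\<close> against that of \<open>A D\<close> with
      \<open>Y\<close> in \<open>q\<close>.\<close>
    have "p x - q x = D t \<omega> \<bullet> g t \<omega> - (B t *v \<gamma> t \<omega>) \<bullet> Y t \<omega>"
      unfolding x p_def q_def prod.case \<psi>_def \<phi>_def inner_add_right inner_add_left inner_transpose_mult by simp
    also have "\<dots> = D t \<omega> \<bullet> g t \<omega> + \<gamma> t \<omega> \<bullet> (Rt t *v \<alpha> t \<omega>)"
      unfolding \<alpha>_def Rt_feedback[OF t] by simp
    finally show ?thesis
      using running_cost_le[OF t, of m "X t \<omega>" "\<alpha> t \<omega>" "\<gamma> t \<omega>" "D t \<omega>"]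
      unfolding x r_def n_def by (simp add: g_def D_def \<gamma>_def)
  qed
  then have "(\<integral>x. r X \<alpha> x + lam / 2 * n x + (p x - q x) \<partial>PT 0 T) \<le> integral\<^sup>L (PT 0 T) (r X' \<beta>)"
    using int n_int by (intro integral_mono) auto
  then have running_le: "integral\<^sup>L (PT 0 T) (r X \<alpha>) + lam / 2 * integral\<^sup>L (PT 0 T) n
       + (integral\<^sup>L (PT 0 T) p - integral\<^sup>L (PT 0 T) q) \<le> integral\<^sup>L (PT 0 T) (r X' \<beta>)"
    using int n_int by simp
  let ?t = "\<lambda>X \<omega>. terminal_cost Q Qbar S T m (X T \<omega>)"
  have t_int: "integrable P (?t X)" "integrable P (?t X')" "integrable P (\<lambda>\<omega>. D T \<omega> \<bullet> G \<omega>)"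
    by (intro terminal_cost_integrable S2_at(2)[OF _ T] XS X'S L2_space_inner_integrable D_T G)+
  have "(\<integral>\<omega>. ?t X \<omega> + D T \<omega> \<bullet> G \<omega> \<partial>P) \<le> (\<integral>\<omega>. ?t X' \<omega> \<partial>P)"
  proof (intro integral_mono Bochner_Integration.integrable_add t_int)
    fix \<omega>
    show "?t X \<omega> + D T \<omega> \<bullet> G \<omega> \<le> ?t X' \<omega>"
      using terminal_cost_le[of m "X T \<omega>" "D T \<omega>"] by (simp add: G_def D_def)
  qed
  then have terminal_le: "(\<integral>\<omega>. ?t X \<omega> \<partial>P) + (\<integral>\<omega>. D T \<omega> \<bullet> G \<omega> \<partial>P) \<le> (\<integral>\<omega>. ?t X' \<omega> \<partial>P)"
    using t_int by simp
  have n_eq: "(\<integral>x. (norm (case_prod (\<lambda>t \<omega>. \<beta> t \<omega> - \<alpha> t \<omega>) x))\<^sup>2 \<partial>PT 0 T) = integral\<^sup>L (PT 0 T) n"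
    by (simp add: n_def case_prod_unfold \<gamma>_def)
  \<comment> \<open>The first variation vanishes: this is the duality, rewritten with integrals over
    the product space.\<close>
  have "(\<integral>\<omega>. D T \<omega> \<bullet> G \<omega> \<partial>P) + (integral\<^sup>L (PT 0 T) p - integral\<^sup>L (PT 0 T) q) = 0"
    using duality unfolding expectation_path_integral(2)[OF D\<psi>] expectation_path_integral(2)[OF \<phi>Y] p_def q_def by simp
  then show ?thesis
    using running_le terminal_le
    unfolding \<alpha>_def[symmetric] n_eq cost_eq[OF XS \<alpha> m] cost_eq[OF X'S \<beta> m] r_def by linarith
qed

lemma fbsde_optimal:
  fixes \<beta> :: "real \<Rightarrow> 'w \<Rightarrow> real^'k"
  assumes fbsde: "fbsde m \<xi> X Y Z"
    and m: "continuous_on {0..T} m"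
  shows "optimal m \<xi> (feedback B Rt Y) X"
    and "optimal m \<xi> \<beta> X'
      \<Longrightarrow> equal_ae P 0 T \<beta> (feedback B Rt Y) \<and> indistinguishable P 0 T X' X"
proof -
  let ?\<alpha> = "feedback B Rt Y" and ?cs = "controlled_state P F W T K Mop A B C Sig m \<xi>"
  let ?d = "\<lambda>\<beta>. \<integral>x. (norm (case_prod (\<lambda>t \<omega>. \<beta> t \<omega> - ?\<alpha> t \<omega>) x))\<^sup>2 \<partial>PT 0 T"
  have \<alpha>: "?\<alpha> \<in> H2" using fbsde by (intro feedback_H2) (simp add: solves_fbsde_def)
  have X: "state m \<xi> ?\<alpha> X" by (rule fbsde_state[OF fbsde])
  \<comment> \<open>The chosen state is a genuine one, because perturbing \<open>X\<close> provides
    a state for every admissible control.\<close>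
  have cs: "state m \<xi> \<beta> (?cs \<beta>)" if "\<beta> \<in> H2" for \<beta>
    unfolding controlled_state_def by (rule someI_ex[OF state_exists[OF X \<alpha> that m]])
  have lower: "cost m X ?\<alpha> + lam / 2 * ?d \<beta> \<le> J m \<xi> \<beta>" if "\<beta> \<in> H2" for \<beta>
    unfolding J_eq_cost by (rule cost_lower_bound[OF fbsde that cs[OF that] m])
  have d_nonneg: "0 \<le> ?d \<beta>" for \<beta> by simp
  \<comment> \<open>The state chosen for the feedback control need not be \<open>X\<close> itself;
    uniqueness identifies the two up to a null set and hence their costs.\<close>
  have J_opt: "J m \<xi> ?\<alpha> = cost m X ?\<alpha>"
  proof -
    have XS: "X \<in> S2" and cS: "?cs ?\<alpha> \<in> S2"
      using X cs[OF \<alpha>] by (auto simp: is_controlled_state_def)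
    have "AE \<omega> in P. \<forall>t\<in>{0..T}. ?cs ?\<alpha> t \<omega> = X t \<omega>"
      using state_unique[OF X cs[OF \<alpha>] \<alpha> m] by (simp add: indistinguishable_def)
    then have "AE \<omega> in P. (LINT t:{0..T}|lborel. running_cost Qt Qbart St Rt m t (?cs ?\<alpha> t \<omega>) (?\<alpha> t \<omega>))
        + terminal_cost Q Qbar S T m (?cs ?\<alpha> T \<omega>)
      = (LINT t:{0..T}|lborel. running_cost Qt Qbart St Rt m t (X t \<omega>) (?\<alpha> t \<omega>)) + terminal_cost Q Qbar S T m (X T \<omega>)"
      by eventually_elim (use T_pos in \<open>auto intro!: arg_cong2[where f = "(+)"] set_lebesgue_integral_cong\<close>)
    moreover have "(\<lambda>\<omega>. (LINT t:{0..T}|lborel. running_cost Qt Qbart St Rt m t (V t \<omega>) (?\<alpha> t \<omega>))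
        + terminal_cost Q Qbar S T m (V T \<omega>)) \<in> borel_measurable P" if "V \<in> S2" for V
      using that T_pos
      by (intro borel_measurable_integrable Bochner_Integration.integrable_add terminal_cost_integrable S2_at
          expectation_path_integral(1) running_cost_integrable S2_H2 \<alpha> m) auto
    ultimately show ?thesis
      unfolding J_eq_cost cost_def using XS cS by (intro integral_cong_AE)
  qed
  show "optimal m \<xi> ?\<alpha> X"
    unfolding solves_control_problem_def
  proof (intro conjI ballI \<alpha> X)
    fix \<beta> :: "real \<Rightarrow> 'w \<Rightarrow> real^'k"
    assume "\<beta> \<in> H2"
    then have "cost m X ?\<alpha> + lam / 2 * ?d \<beta> \<le> J m \<xi> \<beta>" by (rule lower)
    moreover have "0 \<le> lam / 2 * ?d \<beta>" by (intro mult_nonneg_nonneg d_nonneg) (use lam(1) in simp)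
    ultimately show "J m \<xi> ?\<alpha> \<le> J m \<xi> \<beta>" unfolding J_opt by linarith
  qed
  assume opt: "optimal m \<xi> \<beta> X'"
  then have \<beta>: "\<beta> \<in> H2" and X': "state m \<xi> \<beta> X'" and "J m \<xi> \<beta> \<le> J m \<xi> ?\<alpha>"
    using \<alpha> by (auto simp: solves_control_problem_def)
  \<comment> \<open>An optimal \<open>\<beta>\<close> costs no more than the feedback control, which
    the lower bound permits only if the remainder is zero.\<close>
  then have "lam / 2 * ?d \<beta> \<le> 0" using lower[OF \<beta>] J_opt by simp
  then have d: "?d \<beta> = 0" using d_nonneg[of \<beta>] lam(1) by (simp add: mult_le_0_iff)
  have "case_prod (\<lambda>t \<omega>. \<beta> t \<omega> - ?\<alpha> t \<omega>) \<in> L2_PT"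
    using H2_diff[OF \<beta> \<alpha>] by (simp add: H2_iff)
  then have "AE x in PT 0 T. (norm (case_prod (\<lambda>t \<omega>. \<beta> t \<omega> - ?\<alpha> t \<omega>) x))\<^sup>2 = 0"
    using d by (subst integral_nonneg_eq_0_iff_AE[symmetric]) (auto simp: L2_space_iff)
  then have "equal_ae P 0 T \<beta> ?\<alpha>"
    unfolding equal_ae_def by eventually_elim (auto simp: case_prod_unfold)
  \<comment> \<open>\<open>X'\<close> is a state for \<open>\<beta>\<close>; since the controls
    agree almost everywhere it is also one for the feedback control, whose state is unique.\<close>
  moreover have "indistinguishable P 0 T X' X"
    by (rule state_unique[OF X state_equal_ae[OF X' \<alpha> \<beta> m d] \<alpha> m])
  ultimately show "equal_ae P 0 T \<beta> ?\<alpha> \<and> indistinguishable P 0 T X' X" ..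
qed

end

theorem theorem3p4:
  fixes P :: "'w measure" and F :: "real \<Rightarrow> 'w measure" and F00 :: "'w set set"
    and W :: "real \<Rightarrow> 'w \<Rightarrow> real^'q" and T lam :: real
    and K :: "real \<Rightarrow> real \<Rightarrow> real^'d^'d"
    and Mop :: "(real \<Rightarrow> real^'d) \<Rightarrow> (real \<Rightarrow> real^'d)"
    and A C :: "real \<Rightarrow> real^'d^'d" and B :: "real \<Rightarrow> real^'k^'d"
    and Sig :: "real \<Rightarrow> 'w \<Rightarrow> real^'q^'d"
    and Q Qbar S :: "real^'d^'d"
    and Qt Qbart St :: "real \<Rightarrow> real^'d^'d" and Rt :: "real \<Rightarrow> real^'k^'k"
  assumes T_pos: "T > 0"
    and basis: "prob_space P" "complete_measure P" "brownian_motion P W"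
      "sigma_algebra (space P) F00" "F00 \<subseteq> sets P"
      "prob_space.indep_set P F00 (generated_sigma P W {0..})"
      "\<And>t. t \<ge> 0 \<Longrightarrow> F t = usual_augmentation P (\<lambda>u. F00 \<union> generated_sigma P W {0..u}) t"
    and kernel: "\<And>t. t \<in> {0..T} \<Longrightarrow> K t t = mat 1"
      "\<And>s u t. s \<in> {0..T} \<Longrightarrow> u \<in> {0..T} \<Longrightarrow> t \<in> {0..T} \<Longrightarrow> K t s = K t u ** K u s"
      "continuous_on {0..T} (\<lambda>t. K t 0)"
    and dynamics: "continuous_on {0..T} A" "continuous_on {0..T} B" "continuous_on {0..T} C"
      "Mop \<in> path_space T \<rightarrow> path_space T" "Sig \<in> H2_space P F 0 T"
    and terminal: "nonneg_def_mat Q" "nonneg_def_mat Qbar"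
    and running: "continuous_on {0..T} Qt" "continuous_on {0..T} Qbart"
      "continuous_on {0..T} St" "continuous_on {0..T} Rt"
      "\<And>t. t \<in> {0..T} \<Longrightarrow> nonneg_def_mat (Qt t)" "\<And>t. t \<in> {0..T} \<Longrightarrow> nonneg_def_mat (Qbart t)"
      "lam > 0" "\<And>t. t \<in> {0..T} \<Longrightarrow> pos_def_mat (Rt t - lam *\<^sub>R mat 1)"
    and fbsde_well_posed: "\<And>m \<xi>. m \<in> path_space T \<Longrightarrow> \<xi> \<in> L2_space P (F 0) \<Longrightarrow>
      \<exists>X Y Z. solves_fbsde P F W T K Mop A B C Sig Q Qbar S Qt Qbart St Rt m \<xi> X Y Z \<and>
        (\<forall>X' Y' Z'. solves_fbsde P F W T K Mop A B C Sig Q Qbar S Qt Qbart St Rt m \<xi> X' Y' Z' \<longrightarrow>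
           indistinguishable P 0 T X' X \<and> indistinguishable P 0 T Y' Y \<and> equal_ae P 0 T Z' Z)"
  shows "\<forall>m\<in>path_space T. \<forall>\<xi>\<in>L2_space P (F 0). \<forall>X Y Z.
    solves_fbsde P F W T K Mop A B C Sig Q Qbar S Qt Qbart St Rt m \<xi> X Y Z \<longrightarrow>
      solves_control_problem P F W T K Mop A B C Sig Q Qbar S Qt Qbart St Rt m \<xi> (feedback B Rt Y) X \<and>
      (\<forall>\<alpha> X'.
        solves_control_problem P F W T K Mop A B C Sig Q Qbar S Qt Qbart St Rt m \<xi> \<alpha> X' \<longrightarrow>
        equal_ae P 0 T \<alpha> (feedback B Rt Y) \<and> indistinguishable P 0 T X' X)"
proof -
  have "lq_control P F F00 W T K A C B Q Qbar Qt Qbart St Rt lam"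
    using assms(1-8) kernel dynamics(1-3) terminal running
    unfolding lq_control_def linear_volterra_def finite_horizon_def stochastic_basis_def
      lq_control_axioms_def linear_volterra_axioms_def finite_horizon_axioms_def stochastic_basis_axioms_def
    by blast
  then interpret lq_control P F F00 W T K Mop A C B Sig Q Qbar S Qt Qbart St Rt lam .
  show ?thesis
    using fbsde_optimal by (auto simp: path_space_def)
qed

end
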